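(* Let $G$ be a connected $\{P_k, K_m\}$-free graph with minimum degree $\delta(G)\geq \delta_k$ and $|V(G)|=n\geq k$. Then one of the following holds: (1) $G$ is a subgraph of $H \vee I_{n-\delta_k}$ if $k$ is even, and of $H \vee ( I_{n-\delta_k-2} \cup K_2)$ if $k$ is odd, for some $K_{m-1}$-free graph $H$ on $\delta_k$ vertices; (2) $m\ge \delta_k+2$ and $G$ is isomorphic to $G_1(n,k)$, to $G_2(n,k)$, or to a graph $G_3(n,k)$; (3) $k=7$, $m\geq 4$ and $G\cong G_4(n)$ or $G\cong G_5(n)$; (4) $k=9$, $m\geq 4$ and $G\cong I_2 \vee \frac{n-2}{2} K_2$, or $k=9$, $m\geq 5$ and $G\cong K_2 \vee \frac{n-2}{2} K_2$.
   Context: All graphs are finite and simple. $K_n$, $P_n$, $I_n$ denote the complete graph, the path, and the edgeless graph on $n$ vertices; $K_{1,s}$ is the star with $s$ leaves. For disjoint graphs $G,H$: $G\cup H$ is their disjoint union, $tG$ is the disjoint union of $t$ copies of $G$, and $G\vee H$ is obtained from $G\cup H$ by adding all edges between $V(G)$ and $V(H)$. A graph is $\mathcal H$-free if it contains no member of $\mathcal H$ as a subgraph. A block is a maximal connected subgraph without a cut vertex. Let $\delta_k=\lfloor k/2\rfloor-1$. For $\delta_k\le m-2$: $G_1(n,k)=K_1\vee tK_{\delta_k}$ where $n=1+t\delta_k$, $t\ge1$ (the vertex of $K_1$ is its centre); for $k$ odd, $G_2(n,k)$ is the $n$-vertex graph obtained from $G_1(n_1,k)$ and $G_1(n_2,k)$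 (disjoint) by joining their centres by an edge, where $n=n_1+n_2$; for $k$ odd, a graph $G_3(n,k)$ is any $n$-vertex graph obtained from $G_1(n-1,k)$ by replacing one block $K_{\delta_k+1}$ by a $K_m$-free block $B$ of order $\delta_k+2$ (sharing the centre as its cut vertex) such that the resulting graph has minimum degree at least $\delta_k$. $G_4(n)$ (resp. $G_5(n)$) is the $n$-vertex graph obtained from disjoint $G_1(n_1,7)$ and $K_{1,n_2-2}$ by joining the centre of $G_1(n_1,7)$ to all leaves of $K_{1,n_2-2}$ (resp. to all vertices of $K_{1,n_2-2}$), where $n_2\ge4$ and $n=n_1+n_2-1$. *)

theory Defs
  imports Main
begin

text \<open>Finite simple graphs: a vertex set together with a set of 2-element edges.\<close>

type_synonym 'a graph = "'a set \<times> 'a set set"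

abbreviation verts :: "'a graph \<Rightarrow> 'a set" where "verts G \<equiv> fst G"
abbreviation edges :: "'a graph \<Rightarrow> 'a set set" where "edges G \<equiv> snd G"

definition graph :: "'a graph \<Rightarrow> bool" where
  "graph G \<longleftrightarrow> finite (verts G) \<and> (\<forall>e\<in>edges G. e \<subseteq> verts G \<and> card e = 2)"

definition degree :: "'a graph \<Rightarrow> 'a \<Rightarrow> nat" where
  "degree G v = card {u \<in> verts G. {u, v} \<in> edges G}"

definition min_degree :: "'a graph \<Rightarrow> nat" where
  "min_degree G = Min (degree G ` verts G)"

definition adj_rel :: "'a graph \<Rightarrow> ('a \<times> 'a) set" where
  "adj_rel G = {(u, v). {u, v} \<in> edges G}"

definition connected_graph :: "'a graph \<Rightarrow> bool" where
  "connected_graph G \<longleftrightarrow> (\<forall>u\<in>verts G. \<forall>v\<in>verts G. (u, v) \<in> (adj_rel G)\<^sup>*)"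

definition delete_vertex :: "'a graph \<Rightarrow> 'a \<Rightarrow> 'a graph" where
  "delete_vertex G v = (verts G - {v}, {e \<in> edges G. v \<notin> e})"

text \<open>A (connected) graph without a cut vertex.\<close>
definition no_cut_vertex :: "'a graph \<Rightarrow> bool" where
  "no_cut_vertex G \<longleftrightarrow> (\<forall>v\<in>verts G. connected_graph (delete_vertex G v))"

text \<open>H is (isomorphic to) a subgraph of G.\<close>
definition subgraph_of :: "'b graph \<Rightarrow> 'a graph \<Rightarrow> bool" where
  "subgraph_of H G \<longleftrightarrow> (\<exists>f. inj_on f (verts H) \<and> f ` verts H \<subseteq> verts G \<and>
      (\<forall>e\<in>edges H. f ` e \<in> edges G))"

definition iso :: "'a graph \<Rightarrow> 'b graph \<Rightarrow> bool" where
  "iso G H \<longleftrightarrow> (\<exists>f. bij_betw f (verts G) (verts H) \<and>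
      (\<forall>u\<in>verts G. \<forall>v\<in>verts G. {u, v} \<in> edges G \<longleftrightarrow> {f u, f v} \<in> edges H))"

definition path_graph :: "nat \<Rightarrow> nat graph" where
  "path_graph k = ({0..<k}, {{i, Suc i} | i. Suc i < k})"

definition complete_graph :: "nat \<Rightarrow> nat graph" where
  "complete_graph m = ({0..<m}, {{i, j} | i j. i < m \<and> j < m \<and> i \<noteq> j})"

definition empty_graph :: "nat \<Rightarrow> nat graph" where
  "empty_graph n = ({0..<n}, {})"

definition disj_union :: "'a graph \<Rightarrow> 'b graph \<Rightarrow> ('a + 'b) graph" where
  "disj_union G H = (Inl ` verts G \<union> Inr ` verts H, (\<lambda>e. Inl ` e) ` edges G \<union> (\<lambda>e. Inr ` e) ` edges H)"

definition join :: "'a graph \<Rightarrow> 'b graph \<Rightarrow> ('a + 'b) graph" where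
  "join G H = (verts (disj_union G H),
     edges (disj_union G H) \<union> {{Inl u, Inr v} | u v. u \<in> verts G \<and> v \<in> verts H})"

text \<open>t disjoint copies of G.\<close>
definition copies :: "nat \<Rightarrow> 'a graph \<Rightarrow> (nat \<times> 'a) graph" where
  "copies t G = ({0..<t} \<times> verts G, {(\<lambda>x. (i, x)) ` e | i e. i < t \<and> e \<in> edges G})"

definition add_edges :: "'a graph \<Rightarrow> 'a set set \<Rightarrow> 'a graph" where
  "add_edges G F = (verts G, edges G \<union> F)"

definition delta :: "nat \<Rightarrow> nat" where
  "delta k = k div 2 - 1"

text \<open>G_1(1 + t*delta k, k) = K_1 join t K_{delta k}; its centre is Inl 0.\<close>
definition G1 :: "nat \<Rightarrow> nat \<Rightarrow> (nat + nat \<times> nat) graph" where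
  "G1 k t = join (complete_graph 1) (copies t (complete_graph (delta k)))"

text \<open>G_2: G_1(1+t1*delta k,k) and G_1(1+t2*delta k,k) with centres joined.\<close>
definition G2 :: "nat \<Rightarrow> nat \<Rightarrow> nat \<Rightarrow> ((nat + nat \<times> nat) + (nat + nat \<times> nat)) graph" where
  "G2 k t1 t2 = add_edges (disj_union (G1 k t1) (G1 k t2)) {{Inl (Inl 0), Inr (Inl 0)}}"

text \<open>G_3 construction: from G_1(1+t*delta k,k), replace the block on centre plus
  copy 0 by a graph B with edge set EB on the centre plus delta k + 1 new vertices.\<close>
definition G3_block_verts :: "nat \<Rightarrow> (nat + nat \<times> nat) set" where
  "G3_block_verts k = {Inl 0} \<union> {Inr (0, j) | j. j < delta k + 1}"

definition G3_graph :: "nat \<Rightarrow> nat \<Rightarrow> (nat + nat \<times> nat) set set \<Rightarrow> (nat + nat \<times> nat) graph" where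
  "G3_graph k t EB =
     (let Vr = verts (G1 k t) - {Inr (0, j) | j. True};
          Er = {e \<in> edges (G1 k t). e \<subseteq> Vr}
      in (Vr \<union> G3_block_verts k, Er \<union> EB))"

definition is_G3 :: "nat \<Rightarrow> nat \<Rightarrow> nat \<Rightarrow> 'a graph \<Rightarrow> bool" where
  "is_G3 n k m G \<longleftrightarrow> (\<exists>t EB. 1 \<le> t \<and> n = 2 + t * delta k \<and>
      graph (G3_block_verts k, EB) \<and>
      connected_graph (G3_block_verts k, EB) \<and>
      no_cut_vertex (G3_block_verts k, EB) \<and>
      \<not> subgraph_of (complete_graph m) (G3_block_verts k, EB) \<and>
      min_degree (G3_graph k t EB) \<ge> delta k \<and>
      iso G (G3_graph k t EB))"

text \<open>Star K_{1,s}: centre Inl 0, leaves Inr j.\<close>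
definition star :: "nat \<Rightarrow> (nat + nat) graph" where
  "star s = join (complete_graph 1) (empty_graph s)"

definition G4 :: "nat \<Rightarrow> nat \<Rightarrow> ((nat + nat \<times> nat) + (nat + nat)) graph" where
  "G4 t s = add_edges (disj_union (G1 7 t) (star s)) {{Inl (Inl 0), Inr (Inr j)} | j. j < s}"

definition G5 :: "nat \<Rightarrow> nat \<Rightarrow> ((nat + nat \<times> nat) + (nat + nat)) graph" where
  "G5 t s = add_edges (disj_union (G1 7 t) (star s))
     ({{Inl (Inl 0), Inr (Inr j)} | j. j < s} \<union> {{Inl (Inl 0), Inr (Inl 0)}})"

end

theory Submission
  imports Defs
begin

text \<open>
  Take a longest path, on \<open>p < n\<close> vertices, in a connected graph of minimum degree \<open>d\<close>. Its vertex
  set spans no cycle, so the neighbours of one end, shifted by one step, avoid the neighbours of the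
  other end; hence \<open>2 * d < p\<close>, and \<open>p \<in> {2 * d + 1, 2 * d + 2}\<close> in the situation of the theorem.

  If the two neighbourhoods cross, closing the path at a tightest crossing gives a cycle of length
  \<open>N\<close> with \<open>2 * d \<le> N < p\<close>. When every vertex off the cycle has all its neighbours on it, these
  neighbourhoods contain no two consecutive cycle vertices and coincide in a set \<open>S\<close> of \<open>d\<close> vertices,
  and a chord outside \<open>S\<close> would lengthen the cycle; so \<open>S\<close> meets all edges but at most one. Otherwise
  \<open>N = 2 * d\<close>, \<open>p = 2 * d + 2\<close>, and a component \<open>K\<^sub>2\<close> off the cycle exists; the neighbours of its two ends
  are at distance zero or at least three along the cycle, which forces \<open>d \<le> 3\<close> and leads to the
  sporadic graphs for \<open>k = 7\<close> and \<open>k = 9\<close>.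

  If no longest path has a crossing, rotating the path around its ends shows that the two end
  segments are complete graphs (or, on one side, a block with a spanning cycle) hanging at a cut
  vertex, and the length bound makes all other components complete of order \<open>d\<close>.
\<close>

section \<open>Paths and cycles\<close>

text \<open>The bound \<open>2 * d + 2\<close> comes from \<open>k\<close>, which is
  \<open>2 * d + 2\<close> or \<open>2 * d + 3\<close>: a graph without \<open>P_k\<close> has
  \<open>p < k\<close>, and \<open>n \<ge> k\<close> leaves a vertex off every longest path. This
  vertex and connectedness are what make a cycle on \<open>p\<close> vertices impossible. The
  obstacle is a cycle of length \<open>2 * d\<close> when \<open>p\<close> is two larger, since the
  slack of two lets a \<open>K_2\<close> live off the cycle. If its ends attach to the sets
  \<open>X\<close> and \<open>Y\<close>, the translates \<open>X\<close>, \<open>X + 1\<close> and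
  \<open>Y - 1\<close> are disjoint on the cycle, so \<open>3 * (d - 1) \<le> 2 * d\<close>. This is
  the origin of \<open>d \<le> 3\<close> and of the exceptional values 7 and 9 of \<open>k\<close>.
  The number \<open>m\<close> enters only when a structure is read off: a clique found in it bounds
  \<open>m\<close> from below, and in the join case every clique of the \<open>d\<close>-set extends
  by one vertex.\<close>

locale sgraph =
  fixes V :: "'a set" and adj :: "'a \<Rightarrow> 'a \<Rightarrow> bool"
  assumes fin: "finite V"
    and sym: "adj u v \<Longrightarrow> adj v u"
    and irr: "\<not> adj u u"
    and adjV: "adj u v \<Longrightarrow> u \<in> V"
begin

definition path :: "'a list \<Rightarrow> bool" where
  "path xs \<longleftrightarrow> distinct xs \<and> set xs \<subseteq> V \<and> successively adj xs"

definition nb :: "'a \<Rightarrow> 'a set" where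
  "nb v = {u. adj v u}"

text \<open>Indices range over all integers and vertices repeat with period \<open>N\<close>, so
  rotations and reversals of a cycle are mere changes of index and no wrap-around cases
  arise.\<close>

definition cyc :: "nat \<Rightarrow> (int \<Rightarrow> 'a) \<Rightarrow> bool" where
  "cyc N c \<longleftrightarrow> 3 \<le> N \<and> (\<forall>i j. c i = c j \<longleftrightarrow> i mod int N = j mod int N) \<and> (\<forall>i. adj (c i) (c (i + 1)))"

lemma adj_commute: "adj u v \<longleftrightarrow> adj v u"
  using sym by blast

lemma adjV2: "adj u v \<Longrightarrow> v \<in> V"
  using sym adjV by blast

lemma adj_neq: "adj u v \<Longrightarrow> u \<noteq> v"
  using irr by blast

lemma finite_nb [simp]: "finite (nb v)"
  by (rule finite_subset[OF _ fin]) (auto simp: nb_def intro: adjV2)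

lemma path_Nil [simp]: "path []"
  by (simp add: path_def)

lemma path_append:
  "path (xs @ ys) \<longleftrightarrow> path xs \<and> path ys \<and> set xs \<inter> set ys = {} \<and>
     (xs = [] \<or> ys = [] \<or> adj (last xs) (hd ys))"
  by (auto simp: path_def successively_append_iff)

lemma path_Cons:
  "path (x # xs) \<longleftrightarrow> x \<in> V \<and> x \<notin> set xs \<and> path xs \<and> (xs = [] \<or> adj x (hd xs))"
  by (auto simp: path_def successively_Cons)

lemma path_rev [simp]: "path (rev xs) \<longleftrightarrow> path xs"
proof -
  have "(\<lambda>x y. adj y x) = adj" using adj_commute by blast
  then have "successively (\<lambda>x y. adj y x) xs = successively adj xs" by (rule arg_cong)
  then show ?thesis by (simp add: path_def)
qed

lemma path_distinct: "path xs \<Longrightarrow> distinct xs"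
  by (simp add: path_def)

lemma path_subset: "path xs \<Longrightarrow> set xs \<subseteq> V"
  by (simp add: path_def)

lemma path_nth: "path xs \<Longrightarrow> Suc i < length xs \<Longrightarrow> adj (xs ! i) (xs ! Suc i)"
  by (simp add: path_def successively_conv_nth)

lemma cyc_of_path:
  assumes "path xs" "3 \<le> length xs" "adj (last xs) (hd xs)"
  obtains c where "cyc (length xs) c" "range c = set xs"
proof -
  let ?N = "length xs"
  define c where "c = (\<lambda>i. xs ! nat (i mod int ?N))"
  have pos: "0 < int ?N" using assms(2) by linarith
  have lt: "nat (i mod int ?N) < ?N" for i
    using pos by (simp add: nat_less_iff)
  have inj: "c i = c j \<longleftrightarrow> i mod int ?N = j mod int ?N" for i j
  proof -
    have "c i = c j \<longleftrightarrow> nat (i mod int ?N) = nat (j mod int ?N)"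
      unfolding c_def using nth_eq_iff_index_eq[OF path_distinct[OF assms(1)] lt lt] .
    also have "\<dots> \<longleftrightarrow> i mod int ?N = j mod int ?N"
      using pos by (metis int_nat_eq pos_mod_sign)
    finally show ?thesis .
  qed
  have adj: "adj (c i) (c (i + 1))" for i
  proof -
    define r where "r = i mod int ?N"
    have r: "0 \<le> r" "r < int ?N" using pos by (auto simp: r_def)
    have r1: "(i + 1) mod int ?N = (r + 1) mod int ?N" by (simp add: r_def mod_simps)
    show ?thesis
    proof (cases "r + 1 = int ?N")
      case True
      then have "(i + 1) mod int ?N = 0" using r1 by simp
      then have c1: "c (i + 1) = hd xs" using pos by (simp add: c_def hd_conv_nth)
      have "nat r = ?N - 1" using True r by linarith
      then have "c i = last xs" using pos by (auto simp: c_def r_def[symmetric] last_conv_nth)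
      then show ?thesis using c1 assms(3) by simp
    next
      case False
      then have "(i + 1) mod int ?N = r + 1" using r1 r by simp
      then have c1: "c (i + 1) = xs ! Suc (nat r)" using r by (simp add: c_def nat_add_distrib)
      have "Suc (nat r) < ?N" using False r by linarith
      then show ?thesis using path_nth[OF assms(1)] c1 by (simp add: c_def r_def[symmetric])
    qed
  qed
  have "range c = set xs"
  proof
    show "range c \<subseteq> set xs" using lt by (auto simp: c_def)
    show "set xs \<subseteq> range c"
    proof
      fix x assume "x \<in> set xs"
      then obtain k where k: "k < ?N" "xs ! k = x" by (auto simp: in_set_conv_nth)
      then have "c (int k) = x" by (simp add: c_def)
      then show "x \<in> range c" by blast
    qed
  qed
  moreover have "cyc ?N c" using assms(2) inj adj by (simp add: cyc_def)
  ultimately show ?thesis using that by blast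
qed

lemma cyc_ge3: "cyc N c \<Longrightarrow> 3 \<le> N"
  by (simp add: cyc_def)

lemma cyc_adj: "cyc N c \<Longrightarrow> adj (c i) (c (i + 1))"
  by (simp add: cyc_def)

lemma cyc_adj': "cyc N c \<Longrightarrow> j = i + 1 \<or> i = j + 1 \<Longrightarrow> adj (c i) (c j)"
  using cyc_adj sym by metis

lemma cyc_inV: "cyc N c \<Longrightarrow> c i \<in> V"
  using cyc_adj adjV by blast

lemma cyc_reflect: "cyc N c \<Longrightarrow> cyc N (\<lambda>i. c (s - i))"
  unfolding cyc_def
proof (elim conjE, intro conjI allI)
  assume a: "\<forall>i j. (c i = c j) = (i mod int N = j mod int N)" "\<forall>i. adj (c i) (c (i + 1))"
  show "adj (c (s - i)) (c (s - (i + 1)))" for i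
    using sym[OF a(2)[rule_format, of "s - (i + 1)"]] by simp
  show "(c (s - i) = c (s - j)) = (i mod int N = j mod int N)" for i j
  proof -
    have "(s - i) mod int N = (s - j) mod int N \<longleftrightarrow> int N dvd (j - i)"
      by (simp add: mod_eq_dvd_iff)
    also have "\<dots> \<longleftrightarrow> i mod int N = j mod int N"
      by (metis mod_eq_dvd_iff)
    finally show ?thesis using a(1) by blast
  qed
qed

text \<open>A rotation is a composite of two reflections.\<close>

lemma cyc_shift: "cyc N c \<Longrightarrow> cyc N (\<lambda>i. c (i + s))"
  using cyc_reflect[of N "\<lambda>i. c (s - i)" 0] cyc_reflect[of N c s] by (simp add: add.commute)

lemma range_reflect: "range (\<lambda>i::int. c (s - i)) = range c"
proof -
  have "c i = c (s - (s - i))" for i by simp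
  then show ?thesis by blast
qed

lemma cyc_eq:
  assumes "cyc N c" "\<bar>i - j\<bar> < int N"
  shows "c i = c j \<longleftrightarrow> i = j"
proof -
  have "c i = c j \<longleftrightarrow> int N dvd (i - j)"
    using assms(1) by (simp add: cyc_def mod_eq_dvd_iff)
  also have "\<dots> \<longleftrightarrow> i = j"
    using assms(2) zdvd_not_zless[of "\<bar>i - j\<bar>" "int N"] by fastforce
  finally show ?thesis .
qed

lemma cyc_period:
  assumes "cyc N c"
  shows "c (i + int N) = c i"
  using assms by (simp add: cyc_def)

lemma cyc_range:
  assumes "cyc N c"
  shows "range c = c ` {a..<a + int N}"
proof -
  have N: "0 < int N" using cyc_ge3[OF assms] by linarith
  have "c i \<in> c ` {a..<a + int N}" for i
  proof -
    define j where "j = a + (i - a) mod int N"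
    have "j \<in> {a..<a + int N}" using N by (simp add: j_def)
    moreover have "c j = c i" using assms by (simp add: cyc_def j_def mod_simps)
    ultimately show ?thesis by (metis imageI)
  qed
  then show ?thesis by blast
qed

lemma cyc_obtain_index:
  assumes "cyc N c" "v \<in> range c"
  obtains i where "v = c i" "a \<le> i" "i < a + int N"
  using assms cyc_range[OF assms(1), of a] by auto

lemma cyc_card:
  assumes "cyc N c"
  shows "card (range c) = N"
proof -
  have "inj_on c {0..<int N}" by (rule inj_onI) (use cyc_eq[OF assms] in auto)
  then show ?thesis using cyc_range[OF assms, of 0] by (simp add: card_image)
qed

lemma cyc_finite: "cyc N c \<Longrightarrow> finite (range c)"
  using cyc_range by (metis finite_atLeastLessThan_int finite_imageI)

lemma successively_map_upto:
  assumes "\<And>i. R (c i) (c (i + 1 :: int))"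
  shows "successively R (map c [a..b])"
proof (induction "nat (b - a + 1)" arbitrary: a)
  case 0
  then show ?case by simp
next
  case (Suc n)
  then have "[a..b] = a # [a + 1..b]" by (simp add: upto_rec1)
  moreover have "successively R (map c [a + 1..b])" using Suc by simp
  moreover have "map c [a + 1..b] = [] \<or> hd (map c [a + 1..b]) = c (a + 1)"
    using upto_rec1[of "a + 1" b] by (cases "a + 1 \<le> b") auto
  ultimately show ?case using assms by (simp only: list.map successively_Cons) metis
qed

lemma cyc_path:
  assumes "cyc N c" "b < a + int N"
  shows "path (map c [a..b])"
proof -
  have "inj_on c {a..b}" by (rule inj_onI) (use cyc_eq[OF assms(1)] assms(2) in auto)
  then have "distinct (map c [a..b])" by (simp add: distinct_map)
  moreover have "successively adj (map c [a..b])"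
    by (rule successively_map_upto) (rule cyc_adj[OF assms(1)])
  ultimately show ?thesis using cyc_inV[OF assms(1)] by (auto simp: path_def)
qed

lemma hd_map_upto [simp]: "a \<le> b \<Longrightarrow> hd (map c [a..b]) = c a"
  by (simp add: upto_rec1)

lemma last_map_upto [simp]: "a \<le> b \<Longrightarrow> last (map c [a..b]) = c b"
  by (simp add: upto_rec2)

lemma map_upto_Nil [simp]: "map c [a..b] = [] \<longleftrightarrow> b < (a::int)"
  by simp

end

section \<open>Longest paths\<close>

text \<open>\<open>p\<close> bounds the length of all paths. Results about a longest path take one
  of length exactly \<open>p\<close> as a hypothesis, while arguments about cycles work with the
  bound.\<close>

locale longest = sgraph +
  fixes d p :: nat
  assumes conn: "u \<in> V \<Longrightarrow> v \<in> V \<Longrightarrow> (u, v) \<in> {(x, y). adj x y}\<^sup>*"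
    and mindeg: "v \<in> V \<Longrightarrow> d \<le> card (nb v)"
    and maxp: "path xs \<Longrightarrow> length xs \<le> p"
    and p_lt: "p < card V"
begin

text \<open>A walk from \<open>K\<close> to \<open>x\<close> is followed while a path avoiding
  \<open>K\<close> is maintained: a visit to \<open>K\<close> restarts it, and a repeated vertex
  cuts it back to its earlier occurrence.\<close>

lemma reach:
  assumes "x \<in> V - K" "K \<inter> V \<noteq> {}"
  obtains ws c where "path ws" "ws \<noteq> []" "set ws \<inter> K = {}" "last ws = x" "c \<in> K" "adj c (hd ws)"
proof -
  obtain c0 where c0: "c0 \<in> K" "c0 \<in> V" using assms(2) by blast
  have "(c0, x) \<in> {(x, y). adj x y}\<^sup>*" using conn c0 assms(1) by blast
  then have "x \<notin> K \<longrightarrow> (\<exists>ws c. path ws \<and> ws \<noteq> [] \<and> set ws \<inter> K = {} \<and> last ws = x \<and> c \<in> K \<and> adj c (hd ws))"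
  proof (induction rule: rtrancl_induct)
    case base
    then show ?case using c0 by simp
  next
    case (step y z)
    then have yz: "adj y z" by simp
    show ?case
    proof
      assume z: "z \<notin> K"
      show "\<exists>ws c. path ws \<and> ws \<noteq> [] \<and> set ws \<inter> K = {} \<and> last ws = z \<and> c \<in> K \<and> adj c (hd ws)"
      proof (cases "y \<in> K")
        case True
        have "path [z]" using adjV2[OF yz] by (simp add: path_Cons)
        moreover have "set [z] \<inter> K = {}" using z by simp
        ultimately show ?thesis using True yz by (metis last.simps list.distinct(1) list.sel(1))
      next
        case False
        then obtain ws c where ws: "path ws" "ws \<noteq> []" "set ws \<inter> K = {}" "last ws = y" "c \<in> K" "adj c (hd ws)"
          using step.IH by blast
        show ?thesis
        proof (cases "z \<in> set ws")
          case True
          then obtain as bs where s: "ws = as @ z # bs" by (meson split_list)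
          then have "path ((as @ [z]) @ bs)" using ws(1) by simp
          then have "path (as @ [z])" using path_append by blast
          moreover have "hd (as @ [z]) = hd ws" using s by (cases as) auto
          moreover have "set (as @ [z]) \<inter> K = {}" using ws(3) s by auto
          ultimately show ?thesis using ws by (intro exI[of _ "as @ [z]"] exI[of _ c]) auto
        next
          case zn: False
          have "path (ws @ [z])"
            using ws yz zn adjV2[OF yz] by (auto simp: path_append path_Cons)
          moreover have "set (ws @ [z]) \<inter> K = {}" using ws(3) z by auto
          ultimately show ?thesis using ws by (intro exI[of _ "ws @ [z]"] exI[of _ c]) auto
        qed
      qed
    qed
  qed
  then show ?thesis using that assms(1) by blast
qed

lemma p_pos: "0 < p"
proof -
  obtain x where "x \<in> V" using p_lt by fastforce
  then have "path [x]" by (simp add: path_Cons)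
  from maxp[OF this] show ?thesis by simp
qed

lemma outside_ex:
  assumes "finite K" "card K \<le> p"
  obtains x where "x \<in> V - K"
proof -
  have "\<not> V \<subseteq> K" using card_mono[OF assms(1), of V] assms(2) p_lt by linarith
  then show ?thesis using that by blast
qed

lemma hd_nb:
  assumes "path xs" "length xs = p"
  shows "nb (hd xs) \<subseteq> set xs - {hd xs}"
proof
  fix y assume "y \<in> nb (hd xs)"
  then have y: "adj (hd xs) y" by (simp add: nb_def)
  have "y \<in> set xs"
  proof (rule ccontr)
    assume "y \<notin> set xs"
    then have "path (y # xs)" using assms(1) y adjV2[OF y] sym by (auto simp: path_Cons)
    from maxp[OF this] show False using assms(2) by simp
  qed
  then show "y \<in> set xs - {hd xs}" using adj_neq[OF y] by auto
qed

lemma last_nb: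
  assumes "path xs" "length xs = p"
  shows "nb (last xs) \<subseteq> set xs - {last xs}"
  using hd_nb[of "rev xs"] assms by (simp add: hd_rev)

text \<open>On at most two vertices every vertex of the path is an end, and the ends of a longest
  path have no neighbours off it; connectedness requires an edge leaving the path.\<close>

lemma p_ge3:
  assumes "path xs" "length xs = p"
  shows "3 \<le> p"
proof (rule ccontr)
  assume "\<not> 3 \<le> p"
  then have p2: "length xs \<le> 2" using assms(2) by simp
  have ne: "xs \<noteq> []" using assms(2) p_pos by auto
  obtain x where x: "x \<in> V - set xs"
    using outside_ex[of "set xs"] card_length[of xs] assms(2) by auto
  have "set xs \<inter> V \<noteq> {}" using ne path_subset[OF assms(1)] by (cases xs) auto
  with x obtain ws c where w: "path ws" "ws \<noteq> []" "set ws \<inter> set xs = {}" "c \<in> set xs" "adj c (hd ws)"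
    using reach by metis
  have "c = hd xs \<or> c = last xs"
    using p2 w(4) ne by (cases xs; cases "tl xs") auto
  then have "hd ws \<in> set xs" using w(5) hd_nb[OF assms] last_nb[OF assms] by (auto simp: nb_def)
  then show False using w(2,3) hd_in_set[OF w(2)] by blast
qed

text \<open>Opening the cycle at the edge from \<open>c i\<close> to \<open>c (i + 1)\<close> and
  attaching \<open>us\<close> and \<open>ws\<close> to the two ends gives one path. Either list may
  be empty, so the bound also serves for a single attached path.\<close>

lemma cyc_ends_path:
  assumes c: "cyc N c" and us: "path us" "set us \<inter> range c = {}" "us = [] \<or> adj (c i) (hd us)"
    and ws: "path ws" "set ws \<inter> range c = {}" "ws = [] \<or> adj (c (i + 1)) (hd ws)"
    and dj: "set us \<inter> set ws = {}"
  shows "N + length us + length ws \<le> p"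
proof -
  have N: "0 < int N" using cyc_ge3[OF c] by linarith
  have p1: "path (map c [i + 1..i + int N])" by (rule cyc_path[OF c]) simp
  have l: "last (map c [i + 1..i + int N]) = c i" "hd (map c [i + 1..i + int N]) = c (i + 1)"
    using N cyc_period[OF c] by auto
  have s: "set (map c [i + 1..i + int N]) \<subseteq> range c" by auto
  have "path (rev ws @ map c [i + 1..i + int N] @ us)"
    unfolding path_append
    using p1 us ws dj s l sym N
    by (auto simp: last_rev hd_append)
  from maxp[OF this] show ?thesis by simp
qed

text \<open>An outside vertex exists and is reached from the cycle, so opening the cycle there gains
  at least one vertex.\<close>

lemma cyc_lt:
  assumes c: "cyc N c"
  shows "N < p"
proof (rule ccontr)
  assume a: "\<not> N < p"
  have le: "N \<le> p" using cyc_ends_path[OF c, of "[]" 0 "[]"] by simp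
  obtain x where x: "x \<in> V - range c"
    using outside_ex[OF cyc_finite[OF c]] cyc_card[OF c] le by auto
  have "range c \<inter> V \<noteq> {}" using cyc_inV[OF c] by blast
  with x obtain ws v where w: "path ws" "ws \<noteq> []" "set ws \<inter> range c = {}" "v \<in> range c" "adj v (hd ws)"
    using reach by metis
  then obtain i where "adj (c i) (hd ws)" by blast
  then have "N + length ws + length [] \<le> p"
    using cyc_ends_path[OF c w(1) w(3), of i "[]"] by simp
  then show False using w(2) a by (cases ws) auto
qed

lemma closed_list_short:
  assumes "path xs" "3 \<le> length xs" "length xs = p"
  shows "\<not> adj (last xs) (hd xs)"
  using cyc_of_path[OF assms(1,2)] cyc_lt assms(3) by blast

text \<open>Neighbours of the head are recorded by the index of their predecessor, which puts them
  in the same range \<open>{..<p - 1}\<close> as the neighbours of the last vertex.\<close>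

lemma hd_nb_indices:
  assumes xs: "path xs" "length xs = p"
  shows "d \<le> card {i. i + 1 < p \<and> adj (hd xs) (xs ! (i + 1))}"
proof -
  let ?A = "{i. i + 1 < p \<and> adj (hd xs) (xs ! (i + 1))}"
  have ne: "xs \<noteq> []" using xs p_pos by auto
  have "nb (hd xs) \<subseteq> (\<lambda>i. xs ! (i + 1)) ` ?A"
  proof
    fix y assume y: "y \<in> nb (hd xs)"
    then have "y \<in> set xs" "y \<noteq> hd xs" using hd_nb[OF xs] by auto
    then obtain j where j: "j < p" "xs ! j = y" using xs(2) by (auto simp: in_set_conv_nth)
    have "j \<noteq> 0" using j \<open>y \<noteq> hd xs\<close> ne by (metis hd_conv_nth)
    then obtain i where "j = i + 1" by (cases j) auto
    then show "y \<in> (\<lambda>i. xs ! (i + 1)) ` ?A" using j y by (auto simp: nb_def)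
  qed
  moreover have f: "finite ?A" by (rule finite_subset[of _ "{..p}"]) auto
  ultimately have "card (nb (hd xs)) \<le> card ((\<lambda>i. xs ! (i + 1)) ` ?A)" by (intro card_mono) auto
  also have "\<dots> \<le> card ?A" by (rule card_image_le[OF f])
  finally show ?thesis using mindeg[of "hd xs"] path_subset[OF xs(1)] ne hd_in_set[OF ne] by fastforce
qed

lemma last_nb_indices:
  assumes xs: "path xs" "length xs = p"
  shows "d \<le> card {i. i + 1 < p \<and> adj (last xs) (xs ! i)}"
proof -
  let ?A = "{i. i + 1 < p \<and> adj (last xs) (xs ! i)}"
  have ne: "xs \<noteq> []" using xs p_pos by auto
  have "nb (last xs) \<subseteq> (\<lambda>i. xs ! i) ` ?A"
  proof
    fix y assume y: "y \<in> nb (last xs)"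
    then have "y \<in> set xs" "y \<noteq> last xs" using last_nb[OF xs] by auto
    then obtain j where j: "j < p" "xs ! j = y" using xs(2) by (auto simp: in_set_conv_nth)
    have "j + 1 \<noteq> p" using j \<open>y \<noteq> last xs\<close> ne xs(2) by (metis add_diff_cancel_right' last_conv_nth)
    then show "y \<in> (\<lambda>i. xs ! i) ` ?A" using j y by (auto simp: nb_def)
  qed
  moreover have f: "finite ?A" by (rule finite_subset[of _ "{..p}"]) auto
  ultimately have "card (nb (last xs)) \<le> card ((\<lambda>i. xs ! i) ` ?A)" by (intro card_mono) auto
  also have "\<dots> \<le> card ?A" by (rule card_image_le[OF f])
  finally show ?thesis using mindeg[of "last xs"] path_subset[OF xs(1)] ne last_in_set[OF ne] by fastforce
qed

text \<open>A crossing pair \<open>b < a\<close> closes the path into the cycle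
  \<open>v\<^sub>0 \<dots> v\<^sub>b v\<^sub>p\<^sub>-\<^sub>1 \<dots> v\<^sub>a\<^sub>+\<^sub>1\<close>; the case \<open>b = a\<close> is impossible for a longest path.\<close>

lemma crossing_path:
  assumes xs: "path xs" "length xs = p" and b: "b \<le> a" "a + 1 < p"
    and ad: "adj (hd xs) (xs ! (a + 1))" "adj (last xs) (xs ! b)"
  defines "ys \<equiv> take (b + 1) xs @ rev (drop (a + 1) xs)"
  shows "path ys" "adj (last ys) (hd ys)" "length ys = p - (a - b)"
proof -
  have ne: "xs \<noteq> []" using xs p_pos by auto
  have pt: "path (take (b + 1) xs)" "path (drop (a + 1) xs)"
    using xs(1) path_append append_take_drop_id by metis+
  have "set (take (b + 1) xs) \<inter> set (drop (a + 1) xs) = {}"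
    using set_take_disj_set_drop_if_distinct[OF path_distinct[OF xs(1)], of "b + 1" "a + 1"] b by simp
  moreover have l: "last (take (b + 1) xs) = xs ! b"
    using b xs(2) by (simp add: take_Suc_conv_app_nth)
  moreover have "hd (rev (drop (a + 1) xs)) = last xs" using b xs(2) by (simp add: hd_rev)
  ultimately show "path ys" unfolding ys_def path_append using pt ad sym by auto
  have "last ys = xs ! (a + 1)" "hd ys = hd xs"
    using b xs(2) ne by (auto simp: ys_def last_rev hd_drop_conv_nth)
  then show "adj (last ys) (hd ys)" using ad sym by simp
  show "length ys = p - (a - b)" using b xs(2) by (auto simp: ys_def)
qed

lemma ends_disjoint:
  assumes xs: "path xs" "length xs = p" and i: "i + 1 < p"
    and ad: "adj (hd xs) (xs ! (i + 1))"
  shows "\<not> adj (last xs) (xs ! i)"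
proof
  assume "adj (last xs) (xs ! i)"
  from crossing_path[OF xs order_refl i ad this] p_ge3[OF xs] closed_list_short
  show False by fastforce
qed

lemma p_lower:
  assumes xs: "path xs" "length xs = p"
  shows "2 * d < p"
proof -
  let ?A = "{i. i + 1 < p \<and> adj (hd xs) (xs ! (i + 1))}"
  let ?B = "{i. i + 1 < p \<and> adj (last xs) (xs ! i)}"
  have f: "finite ?A" "finite ?B" by (auto intro: finite_subset[of _ "{..p}"])
  have "?A \<inter> ?B = {}" using ends_disjoint[OF xs] by auto
  then have "card ?A + card ?B = card (?A \<union> ?B)" using f by (simp add: card_Un_disjoint)
  also have "\<dots> \<le> card {..<p - 1}" by (rule card_mono) auto
  finally show ?thesis using hd_nb_indices[OF xs] last_nb_indices[OF xs] p_pos by simp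
qed

text \<open>Choosing the crossing pair with the smallest gap, no index strictly between is used,
  so the gap is bounded by the number of unused indices.\<close>

lemma crossing:
  assumes xs: "path xs" "length xs = p" and ij: "i < j" "j < p"
    and ad: "adj (hd xs) (xs ! j)" "adj (last xs) (xs ! i)"
  obtains N c where "cyc N c" "2 * d \<le> N"
proof -
  let ?A = "{i. i + 1 < p \<and> adj (hd xs) (xs ! (i + 1))}"
  let ?B = "{i. i + 1 < p \<and> adj (last xs) (xs ! i)}"
  have f: "finite ?A" "finite ?B" by (auto intro: finite_subset[of _ "{..p}"])
  have dj: "?A \<inter> ?B = {}" using ends_disjoint[OF xs] by auto
  define P where "P = (\<lambda>g. \<exists>a b. a \<in> ?A \<and> b \<in> ?B \<and> b < a \<and> g = a - b)"
  have "P (j - 1 - i)"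
  proof -
    have "j - 1 \<in> ?A" "i \<in> ?B" using ij ad by auto
    moreover have "i \<noteq> j - 1" using calculation dj by blast
    ultimately show ?thesis unfolding P_def using ij by (intro exI[of _ "j - 1"] exI[of _ i]) auto
  qed
  then have "P (LEAST g. P g)" by (rule LeastI)
  then obtain a b where ab: "a \<in> ?A" "b \<in> ?B" "b < a" "(LEAST g. P g) = a - b"
    unfolding P_def by blast
  have mi: "a - b \<le> a' - b'" if "a' \<in> ?A" "b' \<in> ?B" "b' < a'" for a' b'
  proof -
    have "P (a' - b')" unfolding P_def using that by blast
    then show ?thesis using Least_le[of P] ab(4) by metis
  qed
  have between: "t \<notin> ?A \<union> ?B" if "b < t" "t < a" for t
    using mi[of t b] mi[of a t] that ab by auto
  have "{b + 1..<a} \<inter> (?A \<union> ?B) = {}" using between by auto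
  then have "card {b + 1..<a} + card (?A \<union> ?B) = card ({b + 1..<a} \<union> (?A \<union> ?B))"
    using f by (simp add: card_Un_disjoint)
  also have "\<dots> \<le> card {..<p - 1}" by (rule card_mono) (use ab in auto)
  finally have "(a - (b + 1)) + card (?A \<union> ?B) \<le> p - 1" by simp
  moreover have "card (?A \<union> ?B) = card ?A + card ?B" using f dj by (simp add: card_Un_disjoint)
  ultimately have g: "(a - b) + 2 * d \<le> p"
    using hd_nb_indices[OF xs] last_nb_indices[OF xs] ab(3) p_pos by linarith
  define ys where "ys = take (b + 1) xs @ rev (drop (a + 1) xs)"
  have ys: "path ys" "adj (last ys) (hd ys)" "length ys = p - (a - b)"
    unfolding ys_def using crossing_path[OF xs, of b a] ab by auto
  \<comment> \<open>The first edge of the path puts 0 into \<open>?A\<close>, hence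
    \<open>b \<ge> 1\<close>: at least two vertices from the front and one from the back remain, as
    many as a cycle needs.\<close>
  have "Suc 0 < length xs" using p_ge3[OF xs] xs(2) by linarith
  then have "adj (xs ! 0) (xs ! Suc 0)" using path_nth[OF xs(1)] by blast
  moreover have "hd xs = xs ! 0" using \<open>Suc 0 < length xs\<close> by (metis hd_conv_nth list.size(3) not_less_zero)
  ultimately have "0 + 1 < p \<and> adj (hd xs) (xs ! (0 + 1))"
    using \<open>Suc 0 < length xs\<close> xs(2) by (metis One_nat_def add_0)
  then have "0 \<in> ?A" by blast
  then have "0 \<notin> ?B" using dj by (metis (no_types, lifting) disjoint_iff)
  then have "b \<noteq> 0" using ab(2) by (metis (no_types, lifting))
  moreover have "a + 1 < p" using ab(1) by blast
  ultimately have "3 \<le> length ys" using ys(3) ab(3) by linarith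
  from cyc_of_path[OF ys(1) this ys(2)] obtain c where "cyc (length ys) c" by blast
  then show ?thesis using that g ys(3) by auto
qed

end

section \<open>Rotations of longest paths without crossings\<close>

text \<open>The condition is required of every longest path, since rotation keeps replacing the
  path.\<close>

locale noncrossing = longest +
  assumes nocross: "path xs \<Longrightarrow> length xs = p \<Longrightarrow> i < j \<Longrightarrow> j < p \<Longrightarrow>
    adj (hd xs) (xs ! j) \<Longrightarrow> \<not> adj (last xs) (xs ! i)"
begin

text \<open>If the head saw position \<open>j\<close> inside \<open>zs\<close>, every neighbour of
  the last vertex would have index at least \<open>j\<close>; fewer than
  \<open>length zs \<le> d\<close> such indices are available.\<close>

lemma hd_nb_front:
  assumes "path (ys @ zs)" "length (ys @ zs) = p" "length zs \<le> d" "ys \<noteq> []"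
  shows "nb (hd ys) \<subseteq> set ys - {hd ys}"
proof -
  let ?xs = "ys @ zs"
  have hd: "hd ?xs = hd ys" using assms(4) by simp
  have "\<not> adj (hd ys) z" if z: "z \<in> set zs" for z
  proof
    assume a: "adj (hd ys) z"
    obtain k where k: "k < length zs" "zs ! k = z" using z by (auto simp: in_set_conv_nth)
    define j where "j = length ys + k"
    have j: "j < p" "?xs ! j = z" using k assms(2) by (auto simp: j_def nth_append)
    have "{i. i + 1 < p \<and> adj (last ?xs) (?xs ! i)} \<subseteq> {j..<p - 1}"
    proof
      fix i assume i: "i \<in> {i. i + 1 < p \<and> adj (last ?xs) (?xs ! i)}"
      then have "\<not> i < j" using nocross[OF assms(1,2) _ j(1)] a hd j(2) by auto
      then show "i \<in> {j..<p - 1}" using i by auto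
    qed
    then have "card {i. i + 1 < p \<and> adj (last ?xs) (?xs ! i)} \<le> card {j..<p - 1}"
      by (intro card_mono) auto
    then have "d \<le> p - 1 - j" using last_nb_indices[OF assms(1,2)] by simp
    moreover have "p - 1 - j < length zs" using assms(2) k by (simp add: j_def)
    ultimately show False using assms(3) by simp
  qed
  then show ?thesis using hd_nb[OF assms(1,2)] hd by (auto simp: nb_def)
qed

text \<open>The edge from the head to \<open>c\<close> bars the neighbours of the last vertex from
  all positions before \<open>c\<close>.\<close>

lemma last_nb_back:
  assumes "path (as @ c # bs)" "length (as @ c # bs) = p" "as \<noteq> []" "adj (hd as) c"
  shows "nb (last (c # bs)) \<subseteq> set (c # bs) - {last (c # bs)}"
proof
  let ?xs = "as @ c # bs"
  fix y assume "y \<in> nb (last (c # bs))"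
  then have y: "adj (last ?xs) y" by (simp add: nb_def)
  then have yy: "y \<in> set ?xs - {last ?xs}" using last_nb[OF assms(1,2)] by (auto simp: nb_def)
  moreover have "y \<notin> set as"
  proof
    assume "y \<in> set as"
    then obtain i where i: "i < length as" "as ! i = y" by (auto simp: in_set_conv_nth)
    then have "adj (last ?xs) (?xs ! i)" using y by (simp add: nth_append)
    moreover have "adj (hd ?xs) (?xs ! length as)" using assms(3,4) by simp
    ultimately show False using nocross[OF assms(1,2) i(1)] assms(2) by simp
  qed
  ultimately show "y \<in> set (c # bs) - {last (c # bs)}" by auto
qed

end

section \<open>Clique components hanging at a set of vertices\<close>

context longest begin

text \<open>Encodes that \<open>U\<close> is a union of components of the graph without
  \<open>K\<close>, each a clique of order \<open>s\<close> completely joined to \<open>K\<close>.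
  Exact neighbourhoods avoid naming the partition into cliques.\<close>

definition cliques :: "nat \<Rightarrow> 'a set \<Rightarrow> 'a set \<Rightarrow> bool" where
  "cliques s U K \<longleftrightarrow> U \<subseteq> V - K \<and>
     (\<forall>x\<in>U. \<exists>D\<subseteq>U. x \<in> D \<and> card D = s \<and> (\<forall>y\<in>D. nb y = D \<union> K - {y}))"

lemma cliques_Un: "cliques s U K \<Longrightarrow> cliques s U' K \<Longrightarrow> cliques s (U \<union> U') K"
  unfolding cliques_def
proof (elim conjE, intro conjI ballI)
  fix x assume a: "\<forall>x\<in>U. \<exists>D\<subseteq>U. x \<in> D \<and> card D = s \<and> (\<forall>y\<in>D. nb y = D \<union> K - {y})"
    "\<forall>x\<in>U'. \<exists>D\<subseteq>U'. x \<in> D \<and> card D = s \<and> (\<forall>y\<in>D. nb y = D \<union> K - {y})"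
  assume "x \<in> U \<union> U'"
  then obtain D where "D \<subseteq> U \<or> D \<subseteq> U'" "x \<in> D \<and> card D = s \<and> (\<forall>y\<in>D. nb y = D \<union> K - {y})"
    using a by (metis UnE)
  then show "\<exists>D\<subseteq>U \<union> U'. x \<in> D \<and> card D = s \<and> (\<forall>y\<in>D. nb y = D \<union> K - {y})"
    by (intro exI[of _ D] conjI) auto
qed auto

lemma cliques_single:
  "D \<subseteq> V - K \<Longrightarrow> card D = s \<Longrightarrow> (\<And>y. y \<in> D \<Longrightarrow> nb y = D \<union> K - {y}) \<Longrightarrow> cliques s D K"
  unfolding cliques_def by blast

text \<open>By the degree bound the head of any admissible arrangement sees \<open>c\<close> and all
  other vertices of \<open>as\<close>. In particular it sees the successor of \<open>y\<close>, so
  the initial segment up to \<open>y\<close> may be reversed and \<open>y\<close> becomes a head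
  itself.\<close>

lemma rotation_clique:
  assumes path: "path (as @ c # rest)" and len: "length as = d"
    and front: "\<And>as'. path (as' @ c # rest) \<Longrightarrow> set as' = set as \<Longrightarrow> nb (hd as') \<subseteq> insert c (set as)"
    and y: "y \<in> set as"
  shows "nb y = set as \<union> {c} - {y}"
proof -
  have dist: "distinct (as @ c # rest)" using path path_distinct by blast
  have all: "nb (hd as') = insert c (set as) - {hd as'}"
    if p: "path (as' @ c # rest)" and s: "set as' = set as" for as'
  proof -
    have ne: "as' \<noteq> []" using y s by auto
    have h: "hd as' \<in> set as" using hd_in_set[OF ne] s by simp
    have "hd as' \<in> V" using path_subset[OF path] h by auto
    then have "d \<le> card (nb (hd as'))" by (rule mindeg)
    moreover have "card (insert c (set as) - {hd as'}) = d"
      using h dist len by (auto simp: card_Diff_singleton distinct_card)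
    moreover have "nb (hd as') \<subseteq> insert c (set as) - {hd as'}"
      using front[OF p s] irr by (auto simp: nb_def)
    ultimately show ?thesis by (intro card_seteq) auto
  qed
  obtain A B where AB: "as = A @ y # B" using y by (meson split_list)
  define as' where "as' = rev (A @ [y]) @ B"
  have s: "set as' = set as" by (auto simp: as'_def AB)
  have "path (as' @ c # rest)"
  proof (cases "A = []")
    case True
    then show ?thesis using path AB by (simp add: as'_def)
  next
    case False
    have "hd as \<in> set A" using AB False by simp
    moreover have "hd (B @ c # rest) \<in> insert c (set B)" by (cases B) auto
    ultimately have "hd (B @ c # rest) \<in> insert c (set as) - {hd as}"
      using dist AB by auto
    then have "adj (hd as) (hd (B @ c # rest))"
      using all[OF path refl] by (simp add: nb_def set_eq_iff)
    moreover have "path ((A @ [y]) @ (B @ c # rest))" using path AB by simp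
    moreover have "last (rev (A @ [y])) = hd as" using AB False by (simp add: last_rev)
    ultimately have "path (rev (A @ [y]) @ (B @ c # rest))"
      unfolding path_append[of "A @ [y]"] path_append[of "rev (A @ [y])"] path_rev by simp
    then show ?thesis by (simp add: as'_def)
  qed
  from all[OF this s] show ?thesis by (simp add: as'_def)
qed

lemma max_list_ex:
  assumes "P xs0" "\<And>xs. P xs \<Longrightarrow> path xs"
  obtains xs where "P xs" "\<And>ys. P ys \<Longrightarrow> length ys \<le> length xs"
proof -
  have "\<exists>xs. P xs \<and> (\<forall>ys. P ys \<longrightarrow> length ys \<le> length xs)"
    using assms maxp by (intro ex_has_greatest_nat[of P xs0 length "Suc p"]) (auto simp: less_Suc_eq_le)
  then show ?thesis using that by blast
qed

text \<open>Take a longest path in \<open>W\<close> that contains \<open>x\<close> and ends at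
  \<open>c\<close>. Its first vertex has neighbours only on it, so the degree bound gives
  \<open>d\<close> vertices before \<open>c\<close>, the most that \<open>short\<close> allows, and
  \<open>rotation_clique\<close> applies.\<close>

lemma hanging_cliques:
  assumes W: "W \<subseteq> V" and c: "c \<in> V" "c \<notin> W"
    and closed: "\<And>x. x \<in> W \<Longrightarrow> nb x \<subseteq> insert c W"
    and short: "\<And>ws. path (c # ws) \<Longrightarrow> set ws \<subseteq> W \<Longrightarrow> length ws \<le> d"
  shows "cliques d W {c}"
proof -
  have "\<exists>D\<subseteq>W. x \<in> D \<and> card D = d \<and> (\<forall>y\<in>D. nb y = D \<union> {c} - {y})" if x: "x \<in> W" for x
  proof -
    have "(V - W) \<inter> V \<noteq> {}" "x \<in> V - (V - W)" using c x W by auto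
    then obtain ws e where ws: "path ws" "ws \<noteq> []" "set ws \<inter> (V - W) = {}" "last ws = x"
      "e \<in> V - W" "adj e (hd ws)" using reach by metis
    have wsW: "set ws \<subseteq> W" using ws(3) path_subset[OF ws(1)] by blast
    have "hd ws \<in> W" using wsW ws(2) hd_in_set by blast
    then have "e \<in> insert c W" using closed[of "hd ws"] sym[OF ws(6)] by (auto simp: nb_def)
    then have ec: "e = c" using ws(5) by blast
    define P where "P = (\<lambda>xs. path (xs @ [c]) \<and> set xs \<subseteq> W \<and> x \<in> set xs)"
    have "path (c # ws)" using ws ec wsW c by (auto simp: path_Cons)
    then have "path (rev (c # ws))" by (simp only: path_rev)
    then have "P (rev ws)" using wsW ws(2,4) last_in_set[OF ws(2)] by (simp add: P_def)
    moreover have "path xs" if "P xs" for xs using that by (simp add: P_def path_append)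
    ultimately obtain as where as: "P as" and mx: "\<And>ys. P ys \<Longrightarrow> length ys \<le> length as"
      using max_list_ex[of P] by metis
    have pa: "path (as @ [c])" and sa: "set as \<subseteq> W" and xa: "x \<in> set as" using as by (auto simp: P_def)
    have ne: "as \<noteq> []" using xa by auto
    have front: "nb (hd as') \<subseteq> insert c (set as)"
      if p: "path (as' @ c # [])" and s: "set as' = set as" for as'
    proof
      fix z assume z: "z \<in> nb (hd as')"
      have len: "length as' = length as"
        using p pa s by (metis distinct_append distinct_card path_distinct)
      have ne': "as' \<noteq> []" using ne s by auto
      then have "hd as' \<in> W" using s sa hd_in_set by blast
      then have zW: "z \<in> insert c W" using closed z by blast
      show "z \<in> insert c (set as)"
      proof (rule ccontr)
        assume n: "z \<notin> insert c (set as)"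
        then have "path ((z # as') @ [c])"
          using p z s ne' adjV2[of "hd as'" z] sym by (auto simp: path_Cons nb_def)
        then have "P (z # as')" using n zW s sa xa by (auto simp: P_def)
        from mx[OF this] show False using len by simp
      qed
    qed
    have "path (rev (as @ [c]))" using pa by (simp only: path_rev)
    then have le: "length as \<le> d" using short[of "rev as"] sa by simp
    have h: "hd as \<in> set as" using ne by simp
    have "d \<le> card (nb (hd as))" using mindeg h sa W by blast
    also have "\<dots> \<le> card (insert c (set as) - {hd as})"
      by (rule card_mono) (use front[OF pa refl] irr in \<open>auto simp: nb_def\<close>)
    also have "\<dots> = length as"
      using h path_distinct[OF pa] by (auto simp: card_Diff_singleton distinct_card)
    finally have len: "length as = d" using le by simp
    have "nb y = set as \<union> {c} - {y}" if "y \<in> set as" for y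
      by (rule rotation_clique[OF pa len front that])
    moreover have "card (set as) = d" using len path_distinct[OF pa] by (simp add: distinct_card)
    ultimately show ?thesis using sa xa by blast
  qed
  then show ?thesis using W c by (auto simp: cliques_def)
qed

lemma nb_outside:
  assumes "x \<in> V - K - A - B"
    and "\<And>y. y \<in> A \<Longrightarrow> nb y \<subseteq> K \<union> A" "\<And>y. y \<in> B \<Longrightarrow> nb y \<subseteq> K \<union> B"
  shows "nb x \<subseteq> K \<union> (V - K - A - B)"
proof
  fix z assume "z \<in> nb x"
  then have "x \<in> nb z" "z \<in> V" using sym adjV2 by (auto simp: nb_def)
  then show "z \<in> K \<union> (V - K - A - B)" using assms(1) assms(2,3)[of z] by auto
qed

lemma list_split_at:
  assumes "n < length xs"
  shows "\<exists>as c bs. xs = as @ c # bs \<and> length as = n \<and> length bs = length xs - n - 1"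
  using assms id_take_nth_drop[OF assms]
  by (intro exI[of _ "take n xs"] exI[of _ "xs ! n"] exI[of _ "drop (Suc n) xs"]) simp

end

context noncrossing begin

text \<open>The path splits into a middle vertex \<open>c\<close> and two segments of
  \<open>d\<close> vertices. Each end sees only its own segment and \<open>c\<close>, so rotation
  makes both segments cliques. A path from \<open>c\<close> into the rest extends the
  \<open>d + 1\<close> vertices of \<open>as @ [c]\<close>, which leaves it at most
  \<open>d\<close>.\<close>

lemma windmill:
  assumes p: "p = 2 * d + 1" and d: "1 \<le> d" and xs: "path xs" "length xs = p"
  obtains c where "c \<in> V" "cliques d (V - {c}) {c}"
proof -
  have side: "nb y = set as \<union> {c} - {y}"
    if path: "path (as @ c # bs)" and len: "length as = d" "length bs = d" and y: "y \<in> set as" for as bs c y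
  proof (rule rotation_clique[OF path len(1) _ y])
    fix as' assume a: "path (as' @ c # bs)" "set as' = set as"
    then have "length as' = d" using path len(1) by (metis distinct_append distinct_card path_distinct)
    then have "nb (hd (as' @ [c])) \<subseteq> set (as' @ [c]) - {hd (as' @ [c])}"
      using hd_nb_front[of "as' @ [c]" bs] a len p by simp
    moreover have "as' \<noteq> []" using a(2) y by auto
    ultimately show "nb (hd as') \<subseteq> insert c (set as)" using a(2) by auto
  qed
  have "d < length xs" using p xs(2) by simp
  from list_split_at[OF this] obtain as c bs
    where s: "xs = as @ c # bs" "length as = d" "length bs = length xs - d - 1" by blast
  then have s: "xs = as @ c # bs" "length as = d" "length bs = d" using p xs(2) by simp_all
  have dist: "distinct (as @ c # bs)" using xs s path_distinct by blast
  have A: "nb y = set as \<union> {c} - {y}" if "y \<in> set as" for y using side xs s that by blast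
  have "path (rev (as @ c # bs))" using xs(1) s(1) by (simp only: path_rev)
  then have "path (rev bs @ c # rev as)" by simp
  then have B: "nb y = set bs \<union> {c} - {y}" if "y \<in> set bs" for y
    using side[of "rev bs" c "rev as" y] s that by simp
  have sV: "set as \<subseteq> V" "set bs \<subseteq> V" "c \<in> V" using path_subset[OF xs(1)] s(1) by auto
  define W where "W = V - {c} - set as - set bs"
  have "cliques d W {c}"
  proof (rule hanging_cliques)
    show "nb x \<subseteq> insert c W" if "x \<in> W" for x
      using nb_outside[of x "{c}" "set as" "set bs"] that A B unfolding W_def by auto
    show "length ws \<le> d" if "path (c # ws)" "set ws \<subseteq> W" for ws
    proof -
      have "path (as @ [c])" using xs(1) s(1) path_append[of "as @ [c]" bs] by simp
      then have "path (as @ c # ws)" using that unfolding path_append by (auto simp: W_def)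
      from maxp[OF this] show ?thesis using p s by simp
    qed
  qed (use sV in \<open>auto simp: W_def\<close>)
  moreover have "cliques d (set as) {c}"
    using A dist sV s by (intro cliques_single) (auto simp: distinct_card)
  moreover have "cliques d (set bs) {c}"
    using B dist sV s by (intro cliques_single) (auto simp: distinct_card)
  ultimately have "cliques d (W \<union> set as \<union> set bs) {c}" by (intro cliques_Un)
  moreover have "W \<union> set as \<union> set bs = V - {c}" using sV dist by (auto simp: W_def)
  ultimately show ?thesis using that sV by simp
qed

text \<open>Since \<open>hd as\<close> sees \<open>c\<close>, the vertices of \<open>as\<close> and
  \<open>c\<close> form a cycle of length \<open>d + 2\<close>. It must be shown that no vertex of
  \<open>as\<close> has a neighbour beyond it. Rotation proves this for all but at most one vertex
  \<open>y\<close>, and an exceptional \<open>y\<close> would carry a path long enough to force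
  \<open>d = 2\<close>, where the cycle itself has the forbidden length
  \<open>2 * d\<close>.\<close>

lemma windmill_with_large_block:
  assumes p: "p = 2 * d + 2" and d: "1 \<le> d" and path: "path (as @ c # bs)"
    and len: "length as = d + 1" "length bs = d" and ac: "adj (hd as) c"
    and no_cyc: "\<And>c. \<not> cyc (2 * d) c"
  obtains cy where "cyc (d + 2) cy" "c \<in> range cy" "cliques d (V - range cy) {c}"
proof -
  have dist: "distinct (as @ c # bs)" using path path_distinct by blast
  have sV: "set as \<subseteq> V" "set bs \<subseteq> V" "c \<in> V" using path_subset[OF path] by auto
  have ne: "as \<noteq> []" using len by auto
  have h0: "hd as = as ! 0" using ne by (simp add: hd_conv_nth)
  have "path (rev (as @ c # bs))" using path by (simp only: path_rev)
  then have rpath: "path (rev bs @ c # rev as)" by simp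
  have B: "nb y = set bs \<union> {c} - {y}" if y: "y \<in> set bs" for y
  proof -
    have "nb y = set (rev bs) \<union> {c} - {y}"
    proof (rule rotation_clique[OF rpath])
      fix bs' assume b: "path (bs' @ c # rev as)" "set bs' = set (rev bs)"
      have "path (rev (bs' @ c # rev as))" using b(1) by (simp only: path_rev)
      then have pb: "path (as @ c # rev bs')" by simp
      have "length bs' = d" using b rpath len(2)
        by (metis distinct_append distinct_card length_rev path_distinct)
      then have "nb (last (c # rev bs')) \<subseteq> set (c # rev bs') - {last (c # rev bs')}"
        using last_nb_back[OF pb _ ne ac] p len by simp
      moreover have "bs' \<noteq> []" using b(2) y by auto
      ultimately show "nb (hd bs') \<subseteq> insert c (set (rev bs))"
        using b(2) by (auto simp: last_rev)
    qed (use len y in auto)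
    then show ?thesis by simp
  qed
  have front: "nb (hd as') \<subseteq> insert c (set as)" if a: "path (as' @ c # bs)" "set as' = set as" for as'
  proof -
    have "length as' = d + 1" using path a len(1) by (metis distinct_append distinct_card path_distinct)
    then have "nb (hd (as' @ [c])) \<subseteq> set (as' @ [c]) - {hd (as' @ [c])}"
      using hd_nb_front[of "as' @ [c]" bs] a len p by simp
    moreover have "as' \<noteq> []" using a(2) ne by auto
    ultimately show ?thesis using a(2) by auto
  qed
  \<comment> \<open>If the head sees the successor of \<open>as ! j\<close>, which for
    \<open>j = d\<close> is \<open>c\<close>, reversing the first \<open>j + 1\<close> vertices
    makes \<open>as ! j\<close> the head of another longest path.\<close>
  have rot: "nb (as ! j) \<subseteq> insert c (set as)"
    if j: "j \<le> d" and e: "j = d \<or> adj (hd as) (as ! (j + 1))" for j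
  proof -
    define as' where "as' = rev (take (j + 1) as) @ drop (j + 1) as"
    have "set as' = set (take (j + 1) as @ drop (j + 1) as)"
      unfolding as'_def by (simp del: append_take_drop_id)
    then have s: "set as' = set as" by (simp only: append_take_drop_id)
    have "path ((take (j + 1) as @ drop (j + 1) as) @ c # bs)"
      using path by (simp only: append_take_drop_id)
    then have "path (take (j + 1) as @ (drop (j + 1) as @ c # bs))" by (simp only: append_assoc)
    moreover have "last (rev (take (j + 1) as)) = hd as" using ne by (simp add: last_rev)
    moreover have "adj (hd as) (hd (drop (j + 1) as @ c # bs))"
    proof (cases "j = d")
      case True
      then show ?thesis using ac len by simp
    next
      case False
      then show ?thesis using e j len by (simp add: hd_append hd_drop_conv_nth)
    qed
    ultimately have "path (rev (take (j + 1) as) @ (drop (j + 1) as @ c # bs))"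
      unfolding path_append[of "take (j + 1) as"] path_append[of "rev (take (j + 1) as)"] path_rev
      by simp
    then have "path (as' @ c # bs)" by (simp add: as'_def)
    from front[OF this s] show ?thesis using j len
      by (simp add: as'_def hd_rev take_Suc_conv_app_nth)
  qed
  have pac: "path (as @ [c])" using path path_append[of "as @ [c]" bs] by simp
  have lc: "length (as @ [c]) = d + 2" "adj (last (as @ [c])) (hd (as @ [c]))"
    using len ac sym ne by auto
  obtain cy where cy: "cyc (d + 2) cy" "range cy = set (as @ [c])"
    using cyc_of_path[OF pac _ lc(2)] lc(1) d by auto
  have A: "nb y \<subseteq> insert c (set as)" if y: "y \<in> set as" for y
  proof (rule ccontr)
    assume n: "\<not> nb y \<subseteq> insert c (set as)"
    obtain j where j: "j \<le> d" "y = as ! j" using y len by (auto simp: in_set_conv_nth less_Suc_eq_le)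
    have jd: "j < d" "\<not> adj (hd as) (as ! (j + 1))" using rot[of j] n j by auto
    have j0: "j \<noteq> 0" using front[OF path refl] n j h0 by auto
    \<comment> \<open>The head has only \<open>d + 1\<close> candidate neighbours, \<open>c\<close>
      and the other vertices of \<open>as\<close>, so it misses at most one of them and at most one
      vertex resists rotation.\<close>
    have others: "nb x \<subseteq> insert c (set as)" if x: "x \<in> set as" "x \<noteq> y" for x
    proof (rule ccontr)
      assume nx: "\<not> nb x \<subseteq> insert c (set as)"
      obtain i where i: "i \<le> d" "x = as ! i" using x len by (auto simp: in_set_conv_nth less_Suc_eq_le)
      have id: "i < d" "\<not> adj (hd as) (as ! (i + 1))" using rot[of i] nx i by auto
      have ij: "i \<noteq> j" using i j x by auto
      have neq: "as ! (i + 1) \<noteq> as ! (j + 1)" "as ! (i + 1) \<noteq> as ! 0" "as ! (j + 1) \<noteq> as ! 0"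
        using ij id(1) jd(1) len dist by (auto simp: nth_eq_iff_index_eq)
      have m: "as ! (i + 1) \<in> set as" "as ! (j + 1) \<in> set as" "as ! 0 \<in> set as"
        using id(1) jd(1) len by auto
      have "nb (hd as) \<subseteq> insert c (set as) - {as ! 0, as ! (i + 1), as ! (j + 1)}"
        using front[OF path refl] id(2) jd(2) irr h0 by (auto simp: nb_def)
      then have "card (nb (hd as)) \<le> card (insert c (set as) - {as ! 0, as ! (i + 1), as ! (j + 1)})"
        by (intro card_mono) auto
      also have "\<dots> = card (insert c (set as)) - card {as ! 0, as ! (i + 1), as ! (j + 1)}"
        using m by (intro card_Diff_subset) auto
      also have "\<dots> = d + 2 - 3" using dist len neq by (auto simp: distinct_card)
      finally have "card (nb (hd as)) < d" using d by linarith
      moreover have "hd as \<in> V" using sV hd_in_set[OF ne] by blast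
      ultimately show False using mindeg[of "hd as"] by simp
    qed
    obtain w where w: "adj y w" "w \<notin> insert c (set as)" using n by (auto simp: nb_def)
    have yb: "y \<notin> set bs" "y \<noteq> c" using y dist by auto
    have toB: "z \<notin> set bs" if "adj x z" "x \<notin> insert c (set bs)" for x z
      using B[of z] that sym by (auto simp: nb_def)
    \<comment> \<open>A longest excursion from \<open>y\<close> off the path is used: the neighbours
      of its last vertex are confined to \<open>c\<close>, \<open>y\<close> and the excursion, so it
      has at least \<open>d - 1\<close> vertices.\<close>
    define P where "P = (\<lambda>ws. path ws \<and> ws \<noteq> [] \<and> adj y (hd ws) \<and> set ws \<inter> (insert c (set as) \<union> set bs) = {})"
    have "P [w]" using w toB[OF w(1)] yb adjV2[OF w(1)] by (auto simp: P_def path_Cons)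
    then obtain ws where ws: "P ws" and mx: "\<And>us. P us \<Longrightarrow> length us \<le> length ws"
      using max_list_ex[of P "[w]"] unfolding P_def by metis
    have pw: "path ws" "ws \<noteq> []" "adj y (hd ws)" "set ws \<inter> (insert c (set as) \<union> set bs) = {}"
      using ws by (auto simp: P_def)
    define q where "q = length ws"
    have q0: "1 \<le> q" using pw(2) by (cases ws) (auto simp: q_def)
    let ?l = "last ws"
    have lw: "?l \<in> set ws" using pw(2) by simp
    then have lo: "?l \<notin> insert c (set as)" "?l \<notin> set bs" using pw(4) by auto
    have "nb ?l \<subseteq> {c, y} \<union> (set ws - {?l})"
    proof
      fix z assume "z \<in> nb ?l"
      then have z: "adj ?l z" by (simp add: nb_def)
      have zb: "z \<notin> set bs" using toB[OF z] lo by auto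
      show "z \<in> {c, y} \<union> (set ws - {?l})"
      proof (cases "z \<in> insert c (set as)")
        case True
        then show ?thesis using others[of z] sym[OF z] lo by (auto simp: nb_def)
      next
        case False
        have "z \<in> set ws"
        proof (rule ccontr)
          assume "z \<notin> set ws"
          then have "P (ws @ [z])"
            using pw z zb False adjV2[OF z] by (auto simp: P_def path_append path_Cons)
          from mx[OF this] show False by simp
        qed
        then show ?thesis using adj_neq[OF z] by auto
      qed
    qed
    then have "card (nb ?l) \<le> card ({c, y} \<union> (set ws - {?l}))" by (intro card_mono) auto
    also have "\<dots> \<le> 2 + (q - 1)"
    proof -
      have "card {c, y} \<le> 2" by (simp add: card_insert_if)
      moreover have "card (set ws - {?l}) = q - 1"
        using lw path_distinct[OF pw(1)] by (simp add: distinct_card q_def)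
      ultimately show ?thesis using card_Un_le[of "{c, y}" "set ws - {?l}"] by linarith
    qed
    finally have dq: "d \<le> q + 1" using mindeg[of ?l] path_subset[OF pw(1)] lw q0 by fastforce
    \<comment> \<open>From \<open>ws\<close> through \<open>y\<close> there are two ways along
      \<open>as\<close> to \<open>c\<close>: back to \<open>hd as\<close> and over its edge to
      \<open>c\<close>, or forward. The lengths give \<open>j + q \<le> d\<close> and
      \<open>q \<le> j\<close>; with \<open>d \<le> q + 1\<close> and positive \<open>q\<close> and
      \<open>j\<close>, only \<open>d = 2\<close> remains.\<close>
    have tk: "take (j + 1) as = take j as @ [y]" "drop j as = y # drop (j + 1) as"
      using j len by (auto simp: take_Suc_conv_app_nth Cons_nth_drop_Suc)
    have "path ((take (j + 1) as @ drop (j + 1) as) @ c # bs)"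
      "path ((take j as @ drop j as) @ c # bs)"
      using path by (simp_all only: append_take_drop_id)
    then have "path (take (j + 1) as @ (drop (j + 1) as @ c # bs))"
      "path (take j as @ (drop j as @ c # bs))" by (simp_all only: append_assoc)
    moreover have "path (c # bs)" using path path_append by blast
    ultimately have ps: "path (take (j + 1) as)" "path (drop j as @ c # bs)" "path (c # bs)"
      using path_append by blast+
    have dt: "set (take (j + 1) as) \<subseteq> set as" "set (drop j as) \<subseteq> set as"
      by (auto dest: in_set_takeD in_set_dropD)
    have "path (rev (take (j + 1) as) @ c # bs)"
      unfolding path_append path_rev using ps dt dist ne ac by (auto simp: last_rev)
    moreover have "hd (rev (take (j + 1) as) @ c # bs) = y" unfolding tk by simp
    ultimately have "path (rev ws @ rev (take (j + 1) as) @ c # bs)"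
      unfolding path_append[of "rev ws"] path_rev
      using pw dt sym by (auto simp: last_rev)
    from maxp[OF this] have l1: "j + q \<le> d" using p len j by (simp add: q_def)
    have "hd (drop j as @ c # bs) = y" by (simp add: tk)
    then have "path (rev ws @ drop j as @ c # bs)"
      unfolding path_append[of "rev ws"] path_rev
      using ps pw dt sym by (auto simp: last_rev)
    from maxp[OF this] have "q \<le> j" using p len j by (simp add: q_def)
    then have "d = 2" using l1 dq q0 j0 by linarith
    then show False using cy(1) no_cyc[of cy] by simp
  qed
  define W where "W = V - {c} - set as - set bs"
  have "cliques d W {c}"
  proof (rule hanging_cliques)
    show "nb x \<subseteq> insert c W" if "x \<in> W" for x
      using nb_outside[of x "{c}" "set as" "set bs"] that A B unfolding W_def by auto
    show "length ws \<le> d" if "path (c # ws)" "set ws \<subseteq> W" for ws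
    proof -
      have "path (as @ c # ws)" using that pac unfolding path_append by (auto simp: W_def)
      from maxp[OF this] show ?thesis using p len by simp
    qed
  qed (use sV in \<open>auto simp: W_def\<close>)
  moreover have "cliques d (set bs) {c}"
    using B dist sV len by (intro cliques_single) (auto simp: distinct_card)
  ultimately have "cliques d (W \<union> set bs) {c}" by (intro cliques_Un)
  moreover have "W \<union> set bs = V - range cy" using sV dist cy(2) by (auto simp: W_def)
  ultimately show ?thesis using that[of cy] cy by simp
qed

text \<open>\<open>neg\<close> says that the head of a longest path never sees the vertex at index
  \<open>d + 1\<close>. So each end is confined to the \<open>d + 1\<close> vertices on its side,
  and both end segments are cliques, hanging at the two middle vertices \<open>c\<close> and
  \<open>e\<close>.\<close>

lemma two_windmills:
  assumes p: "p = 2 * d + 2" and d: "1 \<le> d" and xs: "path xs" "length xs = p"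
    and neg: "\<And>as c bs. path (as @ c # bs) \<Longrightarrow> length as = d + 1 \<Longrightarrow> length bs = d \<Longrightarrow> \<not> adj (hd as) c"
  obtains c e U1 U2 where "adj c e" "V = {c, e} \<union> U1 \<union> U2" "U1 \<inter> U2 = {}" "U1 \<noteq> {}" "U2 \<noteq> {}"
    "c \<notin> U2" "e \<notin> U1" "cliques d U1 {c}" "cliques d U2 {e}"
proof -
  have side: "nb y = set as \<union> {c} - {y}"
    if path: "path (as @ c # e # bs)" and len: "length as = d" "length bs = d" and y: "y \<in> set as" for as bs c e y
  proof (rule rotation_clique[OF path len(1) _ y])
    fix as' assume a: "path (as' @ c # e # bs)" "set as' = set as"
    then have l: "length as' = d" using path len(1) by (metis distinct_append distinct_card path_distinct)
    then have "nb (hd (as' @ [c, e])) \<subseteq> set (as' @ [c, e]) - {hd (as' @ [c, e])}"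
      using hd_nb_front[of "as' @ [c, e]" bs] a len p by simp
    moreover have ne: "as' \<noteq> []" using a(2) y by auto
    moreover have "\<not> adj (hd as') e"
      using neg[of "as' @ [c]" e bs] a l len ne by simp
    ultimately show "nb (hd as') \<subseteq> insert c (set as)" using a(2) by (auto simp: nb_def)
  qed
  have "d < length xs" using p xs(2) by simp
  from list_split_at[OF this] obtain as c cs
    where s1: "xs = as @ c # cs" "length as = d" "length cs = length xs - d - 1" by blast
  then have s1: "xs = as @ c # cs" "length as = d" "length cs = d + 1" using p xs(2) by simp_all
  then obtain e bs where s2: "cs = e # bs" "length bs = d" by (cases cs) auto
  have path: "path (as @ c # e # bs)" using xs s1 s2 by simp
  then have dist: "distinct (as @ c # e # bs)" using path_distinct by blast
  have A: "nb y = set as \<union> {c} - {y}" if "y \<in> set as" for y using side path s1 s2 that by blast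
  have "path (rev (as @ c # e # bs))" using path by (simp only: path_rev)
  then have rpath: "path (rev bs @ e # c # rev as)" by simp
  then have B: "nb y = set bs \<union> {e} - {y}" if "y \<in> set bs" for y
    using side[of "rev bs" e c "rev as" y] s1 s2 that by simp
  have sV: "set as \<subseteq> V" "set bs \<subseteq> V" "c \<in> V" "e \<in> V" using path_subset[OF path] by auto
  have ce: "adj c e" using path by (simp add: path_append path_Cons)
  define W where "W = V - {c, e} - set as - set bs"
  have Wnb: "nb x \<subseteq> {c, e} \<union> W" if "x \<in> W" for x
    using nb_outside[of x "{c, e}" "set as" "set bs"] that A B unfolding W_def by auto
  \<comment> \<open>The vertices left off the path are divided by whether they can be reached from
    \<open>c\<close> inside \<open>W\<close>; the others can then only hang at
    \<open>e\<close>.\<close>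
  define Wc where "Wc = {x \<in> W. \<exists>ws. path (c # ws) \<and> ws \<noteq> [] \<and> set ws \<subseteq> W \<and> last ws = x}"
  have Wc_nb: "nb x \<subseteq> insert c Wc" if x: "x \<in> Wc" for x
  proof
    fix z assume z: "z \<in> nb x"
    obtain ws where ws: "path (c # ws)" "ws \<noteq> []" "set ws \<subseteq> W" "last ws = x"
      using x by (auto simp: Wc_def)
    have adxz: "adj x z" using z by (simp add: nb_def)
    have ac: "path (as @ [c])" and eb: "path (e # bs)"
      using path path_append[of "as @ [c]" "e # bs"] by auto
    \<comment> \<open>Otherwise the edge from \<open>c\<close> to \<open>e\<close> could be replaced
      by a detour through \<open>ws\<close>, which gives a path longer than
      \<open>p\<close>.\<close>
    have "z \<noteq> e"
    proof
      assume ze: "z = e"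
      have "path (as @ c # ws)" using ac ws unfolding path_append by (auto simp: W_def)
      then have "path ((as @ c # ws) @ e # bs)"
        using eb ws ze adxz dist unfolding path_append[of "as @ c # ws"] by (auto simp: W_def)
      from maxp[OF this] show False using s1 s2 p ws(2) by (cases ws) auto
    qed
    then have zz: "z = c \<or> z \<in> W" using Wnb[of x] x z by (auto simp: Wc_def)
    have "z \<in> Wc" if zW: "z \<in> W"
    proof (cases "z \<in> set ws")
      case True
      then obtain us vs where "ws = us @ z # vs" by (meson split_list)
      then have "path ((c # us @ [z]) @ vs)" "set (us @ [z]) \<subseteq> W" using ws by auto
      then have "path (c # (us @ [z]))" "set (us @ [z]) \<subseteq> W" using path_append by (blast, simp)
      then show ?thesis using zW unfolding Wc_def
        by (intro CollectI conjI exI[of _ "us @ [z]"]) auto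
    next
      case False
      have "path ((c # ws) @ [z])" unfolding path_append
        using ws False zW adxz by (auto simp: path_Cons W_def)
      then show ?thesis using zW ws unfolding Wc_def
        by (intro CollectI conjI exI[of _ "ws @ [z]"]) auto
    qed
    then show "z \<in> insert c Wc" using zz by blast
  qed
  define We where "We = W - Wc"
  have We_nb: "nb x \<subseteq> insert e We" if x: "x \<in> We" for x
  proof
    fix z assume z: "z \<in> nb x"
    then have az: "adj x z" by (simp add: nb_def)
    have "z \<noteq> c"
    proof
      assume "z = c"
      then have "path (c # [x])" using sym[OF az] adjV[OF az] sV irr by (auto simp: path_Cons)
      then have "x \<in> Wc" using x unfolding Wc_def We_def
        by (intro CollectI conjI exI[of _ "[x]"]) auto
      then show False using x by (simp add: We_def)
    qed
    moreover have "z \<notin> Wc" using Wc_nb[of z] sym[OF az] x by (auto simp: nb_def We_def W_def)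
    ultimately show "z \<in> insert e We" using Wnb[of x] z x by (auto simp: We_def)
  qed
  have "cliques d Wc {c}"
  proof (rule hanging_cliques)
    \<comment> \<open>Approaching \<open>c\<close> from \<open>bs\<close> over \<open>e\<close> uses
      \<open>d + 2\<close> vertices, which leaves exactly \<open>d\<close> for \<open>ws\<close>;
      the approach through \<open>as\<close> would leave \<open>d + 1\<close>.\<close>
    show "length ws \<le> d" if "path (c # ws)" "set ws \<subseteq> Wc" for ws
    proof -
      have "path (rev bs @ [e])" using rpath path_append[of "rev bs @ [e]" "c # rev as"] by simp
      then have "path ((rev bs @ [e]) @ c # ws)"
        using that ce sym dist unfolding path_append[of "rev bs @ [e]"] by (auto simp: W_def Wc_def)
      from maxp[OF this] show ?thesis using s2 p by simp
    qed
  qed (use sV Wc_nb in \<open>auto simp: W_def Wc_def\<close>)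
  moreover have "cliques d We {e}"
  proof (rule hanging_cliques)
    show "length ws \<le> d" if "path (e # ws)" "set ws \<subseteq> We" for ws
    proof -
      have "path (as @ [c])" using path path_append[of "as @ [c]" "e # bs"] by simp
      then have "path ((as @ [c]) @ e # ws)"
        using that ce dist unfolding path_append[of "as @ [c]"] by (auto simp: W_def We_def)
      from maxp[OF this] show ?thesis using s1 p by simp
    qed
  qed (use sV We_nb in \<open>auto simp: W_def We_def\<close>)
  moreover have "cliques d (set as) {c}"
    using A dist sV s1 by (intro cliques_single) (auto simp: distinct_card)
  moreover have "cliques d (set bs) {e}"
    using B dist sV s2 by (intro cliques_single) (auto simp: distinct_card)
  ultimately have "cliques d (Wc \<union> set as) {c}" "cliques d (We \<union> set bs) {e}"
    by (auto intro: cliques_Un)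
  moreover have "V = {c, e} \<union> (Wc \<union> set as) \<union> (We \<union> set bs)"
    using sV by (auto simp: W_def We_def Wc_def)
  moreover have "(Wc \<union> set as) \<inter> (We \<union> set bs) = {}" "c \<notin> We \<union> set bs" "e \<notin> Wc \<union> set as"
    using dist by (auto simp: W_def We_def Wc_def)
  moreover have "Wc \<union> set as \<noteq> {}" "We \<union> set bs \<noteq> {}" using s1 s2 d by auto
  ultimately show ?thesis using that[OF ce] by blast
qed

end

section \<open>Rerouting a cycle and counting translates along it\<close>

context longest begin

text \<open>The segment strictly between \<open>c i\<close> and \<open>c (i + s)\<close> is replaced
  by \<open>ws\<close>; the new cycle keeps \<open>N - s + 1\<close> old vertices.\<close>

lemma cyc_insert:
  assumes c: "cyc N c" and ws: "path ws" "ws \<noteq> []" "set ws \<inter> range c = {}"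
    and ad: "adj (c i) (hd ws)" "adj (last ws) (c (i + int s))" and s: "1 \<le> s" "s \<le> N"
    and len: "M = N - s + 1 + length ws" "3 \<le> M"
  obtains c' where "cyc M c'"
proof -
  define xs where "xs = map c [i + int s..i + int N] @ ws"
  have ne: "i + int s \<le> i + int N" using s by simp
  have "path (map c [i + int s..i + int N])" by (rule cyc_path[OF c]) (use s in simp)
  moreover have "last (map c [i + int s..i + int N]) = c i"
    using ne cyc_period[OF c] by simp
  ultimately have "path xs" unfolding xs_def path_append using ws ad(1) by auto
  moreover have "length xs = M" using s len by (simp add: xs_def)
  moreover have "adj (last xs) (hd xs)"
    using ad(2) ws(2) ne by (simp add: xs_def hd_append del: map_upto_Nil)
  ultimately show ?thesis using cyc_of_path[of xs] len(2) that by metis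
qed

lemma cyc_cong_shift:
  assumes "cyc N c" "c i = c j"
  shows "c (i + s) = c (j + s)"
proof -
  have "int N dvd (i - j)" using assms by (simp add: cyc_def mod_eq_dvd_iff)
  then have "(i + s) mod int N = (j + s) mod int N" by (simp add: mod_eq_dvd_iff)
  then show ?thesis using assms(1) by (simp add: cyc_def)
qed

text \<open>The translate of a vertex set by \<open>s\<close> steps along the cycle. The counting
  arguments compare disjoint translates inside one cycle.\<close>

definition shift :: "(int \<Rightarrow> 'a) \<Rightarrow> int \<Rightarrow> 'a set \<Rightarrow> 'a set" where
  "shift c s A = {c (i + s) | i. c i \<in> A}"

lemma shift_mem:
  assumes "cyc N c"
  shows "c j \<in> shift c s A \<longleftrightarrow> c (j - s) \<in> A"
proof
  assume "c j \<in> shift c s A"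
  then obtain i where i: "c j = c (i + s)" "c i \<in> A" by (auto simp: shift_def)
  then show "c (j - s) \<in> A" using cyc_cong_shift[OF assms i(1), of "- s"] by simp
next
  assume "c (j - s) \<in> A"
  moreover have "c j = c ((j - s) + s)" by simp
  ultimately show "c j \<in> shift c s A" unfolding shift_def by blast
qed

lemma shift_range: "shift c s A \<subseteq> range c"
  by (auto simp: shift_def)

lemma shift_card:
  assumes c: "cyc N c" and A: "A \<subseteq> range c"
  shows "card (shift c s A) = card A"
proof -
  define I where "I = {i \<in> {0..<int N}. c i \<in> A}"
  have inj: "inj_on c I" "inj_on (\<lambda>i. c (i + s)) I"
    by (rule inj_onI; use cyc_eq[OF c] cyc_eq[OF cyc_shift[OF c, of s]] in \<open>force simp: I_def\<close>)+
  have "A = c ` I"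
  proof
    show "A \<subseteq> c ` I"
    proof
      fix v assume v: "v \<in> A"
      then obtain i where "v = c i" "0 \<le> i" "i < 0 + int N"
        using cyc_obtain_index[OF c] A by (metis subsetD)
      then show "v \<in> c ` I" using v by (auto simp: I_def)
    qed
  qed (auto simp: I_def)
  moreover have "shift c s A = (\<lambda>i. c (i + s)) ` I"
  proof
    show "shift c s A \<subseteq> (\<lambda>i. c (i + s)) ` I"
    proof
      fix v assume "v \<in> shift c s A"
      then obtain i where i: "v = c (i + s)" "c i \<in> A" by (auto simp: shift_def)
      obtain j where j: "c i = c j" "0 \<le> j" "j < 0 + int N"
        using cyc_obtain_index[OF c, of "c i" 0] by blast
      then have "v = c (j + s)" using i cyc_cong_shift[OF c j(1)] by simp
      then show "v \<in> (\<lambda>i. c (i + s)) ` I" using i j by (auto simp: I_def)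
    qed
  qed (auto simp: I_def shift_def)
  ultimately show ?thesis using inj by (simp add: card_image)
qed

lemma shift_disjoint:
  assumes "cyc N c" "\<And>i. c i \<in> A \<Longrightarrow> c (i - s) \<notin> B"
  shows "A \<inter> shift c s B = {}"
proof -
  have False if v: "v \<in> A" "v \<in> shift c s B" for v
  proof -
    obtain j where "v = c j" using v(2) by (auto simp: shift_def)
    then show False using v shift_mem[OF assms(1)] assms(2) by blast
  qed
  then show ?thesis by blast
qed

text \<open>Rerouting the cycle through \<open>u\<close> and the chord \<open>c i c j\<close> lengthens it by one.\<close>

lemma chord_reroute:
  assumes c: "cyc N c" and no: "\<And>c'. \<not> cyc (N + 1) c'" and u: "u \<in> V" "u \<notin> range c"
    and ad: "adj (c i) (c j)" "adj u (c (i - 1))" "adj u (c (j - 1))"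
  shows False
proof -
  obtain j' where j': "c j = c j'" "i \<le> j'" "j' < i + int N"
    using cyc_obtain_index[OF c, of "c j" i] by blast
  have "j' \<noteq> i" using ad(1) j'(1) irr by metis
  then have ij: "i < j'" using j'(2) by simp
  have uj: "adj u (c (j' - 1))" using ad(3) cyc_cong_shift[OF c j'(1), of "- 1"] by simp
  define xs where "xs = map c [i..j' - 1] @ u # rev (map c [j' - int N..i - 1])"
  have p: "path (map c [i..j' - 1])" "path (map c [j' - int N..i - 1])"
    by (rule cyc_path[OF c]; use j' in simp)+
  have "set (map c [i..j' - 1]) \<inter> set (map c [j' - int N..i - 1]) = {}"
    using cyc_eq[OF c] by fastforce
  moreover have "hd (rev (map c [j' - int N..i - 1])) = c (i - 1)"
    using j'(3) by (simp add: hd_rev)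
  moreover have "last (map c [i..j' - 1]) = c (j' - 1)" using ij by simp
  moreover have un: "u \<notin> c ` A" for A using u(2) by blast
  ultimately have "path xs" unfolding xs_def path_append path_Cons path_rev
    using p u ad(2) sym[OF uj] ij j'(3) by auto
  moreover have "length xs = N + 1" using ij j'(3) by (simp add: xs_def)
  moreover have "adj (last xs) (hd xs)"
  proof -
    have "last xs = c (j' - int N)" using j'(3) by (simp add: xs_def last_rev)
    moreover have "c (j' - int N) = c j'" using cyc_period[OF c, of "j' - int N"] by simp
    moreover have "hd xs = c i" using ij by (simp add: xs_def hd_append)
    ultimately show ?thesis using sym[OF ad(1)] j'(1) by simp
  qed
  ultimately show False using cyc_of_path[of xs] no cyc_ge3[OF c] by (metis trans_le_add1)
qed

text \<open>\<open>S\<close> meets every edge except possibly one, and an exception is allowed only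
  if \<open>e\<close> holds. This is the \<open>K_2\<close> beside the edgeless part of the join for
  odd \<open>k\<close>.\<close>

definition near_bipartite :: "bool \<Rightarrow> bool" where
  "near_bipartite e \<longleftrightarrow> (\<exists>S\<subseteq>V. card S = d \<and>
     (\<exists>a b. \<forall>x y. adj x y \<longrightarrow> x \<notin> S \<longrightarrow> y \<notin> S \<longrightarrow> e \<and> {x, y} = {a, b}))"

lemma near_bipartite_mono: "near_bipartite e \<Longrightarrow> (e \<Longrightarrow> e') \<Longrightarrow> near_bipartite e'"
  unfolding near_bipartite_def by (elim exE conjE) (rule exI, intro conjI, assumption+, blast)

lemma outsider_ex:
  assumes "cyc N c"
  obtains u where "u \<in> V - range c"
  using outside_ex[OF cyc_finite[OF assms]] cyc_card[OF assms] cyc_lt[OF assms] by fastforce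

text \<open>By \<open>H\<close> the set \<open>S\<close> of all neighbours of outside vertices is
  disjoint from its translate by one, so \<open>2 * card S \<le> N \<le> 2 * d + 1\<close>, and the
  degree bound makes \<open>S\<close> the neighbourhood of every outside vertex. Rerouting then
  excludes all edges outside \<open>S\<close> except one joining consecutive cycle vertices.\<close>

lemma alternating_cycle:
  assumes c: "cyc N c" and N: "2 * d \<le> N" "N \<le> 2 * d + 1"
    and no: "\<And>c'. \<not> cyc (N + 1) c'"
    and out: "\<And>u. u \<in> V - range c \<Longrightarrow> nb u \<subseteq> range c"
    and H: "\<And>u w i. u \<in> V - range c \<Longrightarrow> w \<in> V - range c \<Longrightarrow> adj u (c i) \<Longrightarrow> \<not> adj w (c (i + 1))"
  shows "near_bipartite (N = 2 * d + 1)"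
proof -
  define S where "S = (\<Union>u\<in>V - range c. nb u)"
  obtain u where u: "u \<in> V - range c" by (rule outsider_ex[OF c])
  have SC: "S \<subseteq> range c" using out by (auto simp: S_def)
  have SV: "S \<subseteq> V" using SC cyc_inV[OF c] by blast
  have fS: "finite S" using finite_subset[OF SC cyc_finite[OF c]] .
  have alt: "c (i + 1) \<notin> S" if "c i \<in> S" for i
    using that H by (auto simp: S_def nb_def)
  have dj: "S \<inter> shift c (- 1) S = {}"
    using alt by (intro shift_disjoint[OF c]) simp
  have cU: "card (S \<union> shift c (- 1) S) = 2 * card S"
    using dj fS shift_card[OF c SC, of "- 1"] finite_subset[OF shift_range cyc_finite[OF c]]
    by (simp add: card_Un_disjoint)
  have subU: "S \<union> shift c (- 1) S \<subseteq> range c" using SC shift_range by blast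
  have "card (S \<union> shift c (- 1) S) \<le> N"
    using card_mono[OF cyc_finite[OF c] subU] cyc_card[OF c] by simp
  then have "card S \<le> d" using cU N by simp
  then have nbS: "nb w = S" if "w \<in> V - range c" for w
    using mindeg[of w] that fS by (intro card_seteq) (auto simp: S_def)
  then have cS: "card S = d" using \<open>card S \<le> d\<close> mindeg[of u] u by auto
  \<comment> \<open>\<open>gap i\<close> marks a cycle edge with both ends outside \<open>S\<close>.
    Its first end avoids \<open>S\<close> and the backward translate of \<open>S\<close>, which
    together miss only \<open>N - 2 * d \<le> 1\<close> vertices; so a gap forces
    \<open>N = 2 * d + 1\<close> and occurs at one place only.\<close>
  define gap where "gap = (\<lambda>i. c i \<notin> S \<and> c (i + 1) \<notin> S)"
  have gmem: "c i \<in> range c - (S \<union> shift c (- 1) S)" if "gap i" for i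
    using that shift_mem[OF c, of i "- 1" S] by (auto simp: gap_def)
  have cG: "card (range c - (S \<union> shift c (- 1) S)) = N - 2 * d"
    using card_Diff_subset[OF finite_subset[OF subU cyc_finite[OF c]] subU] cU cS cyc_card[OF c] by simp
  have fG: "finite (range c - (S \<union> shift c (- 1) S))" using cyc_finite[OF c] by simp
  have gN: "N = 2 * d + 1" if "gap i" for i
  proof -
    have "card (range c - (S \<union> shift c (- 1) S)) \<noteq> 0" using gmem[OF that] fG by (metis card_0_eq empty_iff)
    then show ?thesis using cG N by linarith
  qed
  have guniq: "c i = c j" if "gap i" "gap j" for i j
  proof -
    have "card (range c - (S \<union> shift c (- 1) S)) \<le> 1" using cG N by linarith
    then have "card (range c - (S \<union> shift c (- 1) S)) \<le> Suc 0" by (simp only: One_nat_def)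
    then have "\<forall>v \<in> range c - (S \<union> shift c (- 1) S). \<forall>w \<in> range c - (S \<union> shift c (- 1) S). v = w"
      by (simp only: card_le_Suc0_iff_eq[OF fG])
    from bspec[OF bspec[OF this gmem[OF that(1)]] gmem[OF that(2)]] show ?thesis .
  qed
  have uS: "adj u v \<longleftrightarrow> v \<in> S" for v using nbS[OF u] by (auto simp: nb_def)
  have one: "c (i - 1) \<in> S \<or> c (i + 1) \<in> S" if "c i \<notin> S" for i
  proof (rule ccontr)
    assume "\<not> ?thesis"
    then have "gap (i - 1)" "gap i" using that by (auto simp: gap_def)
    then have "c (i - 1) = c i" using guniq by blast
    then show False using cyc_adj[OF c, of "i - 1"] irr by simp
  qed
  \<comment> \<open>As the predecessor of \<open>c i\<close> is in \<open>S\<close>, rerouting keeps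
    the predecessor of \<open>c j\<close> out of \<open>S\<close>, so a gap ends at
    \<open>c j\<close> and its successor is in \<open>S\<close>. Rerouting the reversed cycle makes
    a gap start at \<open>c i\<close>. Uniqueness identifies the two gaps.\<close>
  have key: "\<exists>g. gap g \<and> {c i, c j} = {c g, c (g + 1)}"
    if "adj (c i) (c j)" "c i \<notin> S" "c j \<notin> S" "c (i - 1) \<in> S" for i j
  proof -
    have "c (j - 1) \<notin> S" using chord_reroute[OF c no _ _ that(1)] u that(4) uS by auto
    then have j: "gap (j - 1)" "c (j + 1) \<in> S" using one[OF that(3)] that(3) by (auto simp: gap_def)
    have "adj (c (- (- i))) (c (- (- j)))" using that(1) by simp
    moreover have "range (\<lambda>i. c (- i)) = range c" using range_reflect[of c 0] by simp
    ultimately have "c (i + 1) \<notin> S"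
      using chord_reroute[OF cyc_reflect[OF c, of 0] no, of u "- i" "- j"] u j(2) uS
      by (auto simp: add.commute)
    then have i: "gap i" using that(2) by (simp add: gap_def)
    then have "c i = c (j - 1)" using guniq j(1) by blast
    then have "c (i + 1) = c j" using cyc_cong_shift[OF c, of i "j - 1" 1] by simp
    then show ?thesis using i by auto
  qed
  have edge: "\<exists>g. gap g \<and> {x, y} = {c g, c (g + 1)}" if "adj x y" "x \<notin> S" "y \<notin> S" for x y
  proof -
    have "x \<in> range c" using nbS[of x] that adjV[OF that(1)] by (auto simp: nb_def)
    moreover have "y \<in> range c" using nbS[of y] that adjV2[OF that(1)] sym by (auto simp: nb_def)
    ultimately obtain i j where ij: "x = c i" "y = c j" by blast
    show ?thesis
    proof (cases "c (i - 1) \<in> S \<or> c (j - 1) \<in> S")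
      case True
      then show ?thesis using key[of i j] key[of j i] that sym ij by (metis insert_commute)
    next
      case False
      \<comment> \<open>If neither predecessor is in \<open>S\<close>, both are the start of the
        unique gap, and the two ends of the edge would coincide.\<close>
      then have "gap (i - 1)" "gap (j - 1)" using that ij by (auto simp: gap_def)
      then have "c (i - 1) = c (j - 1)" using guniq by blast
      then have "c i = c j" using cyc_cong_shift[OF c, of "i - 1" "j - 1" 1] by simp
      then show ?thesis using that(1) ij irr by metis
    qed
  qed
  define g where "g = (SOME g. gap g)"
  have "N = 2 * d + 1 \<and> {x, y} = {c g, c (g + 1)}" if xy: "adj x y" "x \<notin> S" "y \<notin> S" for x y
  proof -
    obtain h where h: "gap h" "{x, y} = {c h, c (h + 1)}" using edge[OF xy] by blast
    then have "gap g" unfolding g_def by (metis someI)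
    then have "c h = c g" using guniq h(1) by blast
    then show ?thesis using h gN[OF h(1)] cyc_cong_shift[OF c, of h g 1] by simp
  qed
  then show ?thesis unfolding near_bipartite_def using SV cS by blast
qed

lemma component_path:
  assumes c: "cyc N c" and x: "x \<in> V - range c"
  obtains ws i where "path ws" "ws \<noteq> []" "set ws \<inter> range c = {}" "last ws = x" "adj (c i) (hd ws)"
proof -
  have "range c \<inter> V \<noteq> {}" using cyc_inV[OF c] by blast
  from reach[OF x this] show ?thesis using that by blast
qed

lemma hanging_path_bound:
  assumes c: "cyc N c" and "path ws" "set ws \<inter> range c = {}" "ws \<noteq> []" "adj (hd ws) (c i)"
  shows "N + length ws \<le> p"
  using cyc_ends_path[OF c assms(2,3), of i "[]"] sym[OF assms(5)] by simp

text \<open>With \<open>p = N + 1\<close> only one vertex fits off the cycle. An edge off the cycle,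
  or two outside vertices at consecutive cycle vertices, would give a path on \<open>N + 2\<close>
  vertices; one outside vertex seeing both would give a cycle on \<open>p\<close> vertices.\<close>

lemma cycle_almost_longest:
  assumes c: "cyc N c" and N: "2 * d \<le> N" "N \<le> 2 * d + 1" and p: "p = N + 1"
  shows "near_bipartite (N = 2 * d + 1)"
proof (rule alternating_cycle[OF c N])
  show "\<not> cyc (N + 1) c'" for c' using cyc_lt p by blast
  show "nb u \<subseteq> range c" if u: "u \<in> V - range c" for u
  proof (rule ccontr)
    assume "\<not> nb u \<subseteq> range c"
    then obtain z where z: "adj u z" "z \<notin> range c" by (auto simp: nb_def)
    obtain ws i where ws: "path ws" "ws \<noteq> []" "set ws \<inter> range c = {}" "last ws = u" "adj (c i) (hd ws)"
      by (rule component_path[OF c u])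
    have "length ws \<le> 1" using hanging_path_bound[OF c ws(1,3,2) sym[OF ws(5)]] p by simp
    then have "ws = [u]" using ws(2,4) by (cases ws) auto
    moreover have "path [u, z]" using u z adjV2[OF z(1)] adj_neq[OF z(1)] by (simp add: path_Cons)
    ultimately show False using hanging_path_bound[OF c, of "[u, z]" i] ws(5) sym u z p by simp
  qed
  show "\<not> adj w (c (i + 1))" if uw: "u \<in> V - range c" "w \<in> V - range c" "adj u (c i)" for u w i
  proof
    assume a: "adj w (c (i + 1))"
    show False
    proof (cases "u = w")
      case True
      have "path [u]" using uw by (simp add: path_Cons)
      then obtain c' where "cyc (N + 1) c'"
        using cyc_insert[OF c, of "[u]" i 1 "N + 1"] a sym[OF uw(3)] True uw cyc_ge3[OF c] by auto
      then show False using cyc_lt p by blast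
    next
      case False
      then have "N + length [u] + length [w] \<le> p"
        using uw a sym by (intro cyc_ends_path[OF c, of _ i]) (auto simp: path_Cons)
      then show False using p by simp
    qed
  qed
qed

end

section \<open>Cycles with two vertices fewer than a longest path\<close>

text \<open>The excluded cycle of length \<open>2 * d + 1\<close> would be one shorter than
  \<open>p\<close>, a case already settled by \<open>cycle_almost_longest\<close>.\<close>

locale short_cycle = longest +
  fixes c :: "int \<Rightarrow> 'a"
  assumes c: "cyc (2 * d) c" and p: "p = 2 * d + 2"
    and no_longer: "\<And>c'. \<not> cyc (2 * d + 1) c'"
begin

abbreviation "outside \<equiv> V - range c"

lemma d2: "2 \<le> d"
  using cyc_ge3[OF c] by simp

lemma no_longer2: "\<not> cyc (2 * d + 2) c'"
  using cyc_lt[of "2 * d + 2"] p by blast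

lemma not_range: "u \<in> outside \<Longrightarrow> u \<noteq> c i" "u \<in> outside \<Longrightarrow> c i \<noteq> u" "u \<in> outside \<Longrightarrow> u \<in> V"
  by auto

text \<open>Mirror images of an argument are obtained by reinterpreting the locale with the index
  reversed, and rotated ones likewise by \<open>shifted\<close>.\<close>

lemma reflected: "short_cycle V adj d p (\<lambda>i. c (s - i))"
  by unfold_locales (use cyc_reflect[OF c] p no_longer in auto)

lemma shifted: "short_cycle V adj d p (\<lambda>i. c (i + s))"
  by unfold_locales (use cyc_shift[OF c] p no_longer in auto)

lemma range_shift: "range (\<lambda>i. c (i + s)) = range c"
proof -
  have "c i = c ((i - s) + s)" for i by simp
  then show ?thesis by blast
qed

text \<open>A vertex \<open>x\<close> without neighbours on the cycle would hang behind some
  \<open>a\<close>. As \<open>d \<ge> 2\<close>, it has another neighbour \<open>b\<close>, and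
  \<open>a\<close>, \<open>x\<close>, \<open>b\<close> are three vertices attached to a cycle that
  leaves room for two.\<close>

lemma attached:
  assumes x: "x \<in> outside"
  obtains i where "adj x (c i)"
proof (rule ccontr)
  assume "\<not> thesis"
  then have na: "\<And>i. \<not> adj x (c i)" using that by blast
  obtain ws i where ws: "path ws" "ws \<noteq> []" "set ws \<inter> range c = {}" "last ws = x" "adj (c i) (hd ws)"
    by (rule component_path[OF c x])
  have l: "length ws \<le> 2" using hanging_path_bound[OF c ws(1,3,2) sym[OF ws(5)]] p by simp
  have "ws \<noteq> [x]" using ws(5) na sym by (metis list.sel(1))
  then obtain a where a: "ws = [a, x]" using ws(2,4) l by (cases ws; cases "tl ws") auto
  have "\<not> nb x \<subseteq> {a}"
    using mindeg[of x] x d2 card_mono[of "{a}" "nb x"] by auto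
  then obtain b where b: "adj x b" "b \<noteq> a" by (auto simp: nb_def)
  have "path ([a, x] @ [b])"
    using ws(1) a b adjV2[OF b(1)] adj_neq[OF b(1)] by (simp add: path_append path_Cons)
  moreover have "b \<notin> range c" using b(1) na by auto
  ultimately have "2 * d + length ([a, x] @ [b]) \<le> p"
    using ws a by (intro hanging_path_bound[OF c, of _ i]) (auto intro: sym)
  then show False using p by simp
qed

text \<open>The path \<open>y\<close>, \<open>x\<close>, \<open>z\<close> attached at
  \<open>y\<close> would be three vertices off the cycle. Hence components off the cycle have order
  one or two.\<close>

lemma partner_unique:
  assumes "x \<in> outside" "y \<in> outside" "z \<in> outside" "adj x y" "adj x z"
  shows "y = z"
proof (rule ccontr)
  assume n: "y \<noteq> z"
  obtain i where i: "adj y (c i)" by (rule attached[OF assms(2)])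
  have "path [y, x, z]" using assms n sym adj_neq by (auto simp: path_Cons)
  then have "2 * d + length [y, x, z] \<le> p"
    using assms i by (intro hanging_path_bound[OF c, of _ i]) auto
  then show False using p by simp
qed

lemma single_not_consecutive:
  assumes "u \<in> outside" "adj u (c i)"
  shows "\<not> adj u (c (i + 1))"
proof
  assume a: "adj u (c (i + 1))"
  have "path [u]" using assms by (simp add: path_Cons)
  then show False
    using cyc_insert[OF c, of "[u]" i 1 "2 * d + 1"] a sym[OF assms(2)] assms(1) no_longer d2 by auto
qed

text \<open>Among \<open>2 * d\<close> cycle vertices, \<open>d\<close> pairwise non-consecutive
  ones must be every second vertex.\<close>

lemma single_alternates:
  assumes u: "u \<in> outside" "nb u \<subseteq> range c"
  shows "adj u (c (i + 1)) \<longleftrightarrow> \<not> adj u (c i)"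
proof
  show "\<not> adj u (c i)" if "adj u (c (i + 1))" using single_not_consecutive[OF u(1)] that by blast
  assume n: "\<not> adj u (c i)"
  have dj: "nb u \<inter> shift c 1 (nb u) = {}"
  proof (rule shift_disjoint[OF c])
    fix j assume "c j \<in> nb u"
    then show "c (j - 1) \<notin> nb u" using single_not_consecutive[OF u(1), of "j - 1"] by (auto simp: nb_def)
  qed
  have fs: "finite (shift c 1 (nb u))" using finite_subset[OF shift_range cyc_finite[OF c]] .
  have "card (nb u \<union> shift c 1 (nb u)) = 2 * card (nb u)"
    using dj fs shift_card[OF c u(2)] by (simp add: card_Un_disjoint)
  then have "card (range c) \<le> card (nb u \<union> shift c 1 (nb u))"
    using mindeg[of u] u cyc_card[OF c] by auto
  moreover have "nb u \<union> shift c 1 (nb u) \<subseteq> range c" using u(2) shift_range by blast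
  ultimately have "nb u \<union> shift c 1 (nb u) = range c"
    using cyc_finite[OF c] by (intro card_seteq) auto
  moreover have "c (i + 1) \<notin> shift c 1 (nb u)" using shift_mem[OF c, of "i + 1" 1] n by (simp add: nb_def)
  ultimately have "c (i + 1) \<in> nb u" by blast
  then show "adj u (c (i + 1))" by (simp add: nb_def)
qed

text \<open>With \<open>u\<close> and \<open>w\<close> of opposite parity the cycle can be traversed
  in the order \<open>i\<close>, \<open>i + 2\<close>, \<open>i + 1\<close>, \<open>i + 3\<close>
  and onwards, picking up \<open>u\<close> and \<open>w\<close>; with \<open>z\<close> in front this
  gives \<open>2 * d + 3\<close> vertices.\<close>

lemma three_singles:
  assumes o: "u \<in> outside" "w \<in> outside" "z \<in> outside" and ne: "u \<noteq> w" "u \<noteq> z" "w \<noteq> z"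
    and ad: "adj u (c i)" "adj w (c (i + 1))" "adj z (c i)" "adj u (c (i + 2))" "adj w (c (i + 3))"
  shows False
proof -
  define m where "m = map c [i + 3..i + 2 * int d - 1]"
  have le: "i + 3 \<le> i + 2 * int d - 1" using d2 by simp
  have m: "path m" "m \<noteq> []" "hd m = c (i + 3)" "length m = 2 * d - 3"
    unfolding m_def using cyc_path[OF c] le by auto
  have nm: "c i \<notin> set m" "c (i + 1) \<notin> set m" "c (i + 2) \<notin> set m"
    using cyc_eq[OF c] by (auto simp: m_def)
  have neq: "c i \<noteq> c (i + 1)" "c i \<noteq> c (i + 2)" "c (i + 2) \<noteq> c (i + 1)"
    using d2 cyc_eq[OF c] by auto
  have om: "u \<notin> set m" "w \<notin> set m" "z \<notin> set m" using o by (auto simp: m_def)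
  have "adj (c (i + 2)) (c (i + 1))" by (rule cyc_adj'[OF c]) simp
  then have "path ([z, c i, u, c (i + 2), c (i + 1), w] @ m)"
    unfolding path_append
    using ad ne sym[OF ad(1)] sym[OF ad(2)] m nm neq om not_range[OF o(1)] not_range[OF o(2)]
      not_range[OF o(3)] cyc_inV[OF c]
    by (simp add: path_Cons)
  from maxp[OF this] show False using p m(4) d2 by simp
qed

text \<open>Each outside vertex sees every second cycle vertex, so two of them with opposite parity
  must be excluded. As \<open>p = 2 * d + 2\<close>, a third outside vertex exists, and either
  parity of it gives a path that is too long.\<close>

lemma all_single:
  assumes out: "\<And>u. u \<in> outside \<Longrightarrow> nb u \<subseteq> range c"
  shows "near_bipartite False"
proof -
  have "near_bipartite (2 * d = 2 * d + 1)"
  proof (rule alternating_cycle[OF c _ _ no_longer out])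
    show "\<not> adj w (c (i + 1))" if uw: "u \<in> outside" "w \<in> outside" "adj u (c i)" for u w i
    proof
      assume a: "adj w (c (i + 1))"
      have ne: "u \<noteq> w" using single_not_consecutive[OF uw(1,3)] a by blast
      have "card (insert u (insert w (range c))) \<le> p"
        using uw ne p cyc_card[OF c] cyc_finite[OF c] by (simp add: card_insert_if)
      then obtain z where z: "z \<in> V - insert u (insert w (range c))"
        using outside_ex[of "insert u (insert w (range c))"] cyc_finite[OF c] by auto
      then have zo: "z \<in> outside" "z \<noteq> u" "z \<noteq> w" by auto
      have u2: "adj u (c (i + 2))" "\<not> adj u (c (i - 1))" "adj u (c (i - 2))"
        using single_alternates[OF uw(1) out[OF uw(1)], of "i + 1"]
          single_alternates[OF uw(1) out[OF uw(1)], of i]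
          single_alternates[OF uw(1) out[OF uw(1)], of "i - 1"]
          single_alternates[OF uw(1) out[OF uw(1)], of "i - 2"] uw(3) by (auto simp: add.commute)
      have w2: "adj w (c (i + 3))" "adj w (c (i - 1))"
        using single_alternates[OF uw(2) out[OF uw(2)], of "i + 2"]
          single_alternates[OF uw(2) out[OF uw(2)], of "i + 1"]
          single_alternates[OF uw(2) out[OF uw(2)], of i]
          single_alternates[OF uw(2) out[OF uw(2)], of "i - 1"] a by (auto simp: add.commute)
      consider "adj z (c i)" | "adj z (c (i + 1))"
        using single_alternates[OF zo(1) out[OF zo(1)]] by blast
      then show False
      proof cases
        case 1
        then show False using three_singles[of u w z i] uw zo ne a u2 w2 by auto
      next
        case 2
        \<comment> \<open>This reflection exchanges \<open>c i\<close> and \<open>c (i + 1)\<close>,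
          and with them the roles of \<open>u\<close> and \<open>w\<close>.\<close>
        interpret r: short_cycle V adj d p "\<lambda>j. c (2 * i + 1 - j)" by (rule reflected)
        have rr: "range (\<lambda>j. c (2 * i + 1 - j)) = range c" by (rule range_reflect)
        show False
          using r.three_singles[of w u z i, unfolded rr] uw zo ne a u2 w2 2
          by (auto simp: add.commute algebra_simps)
      qed
    qed
  qed (use d2 in auto)
  then show ?thesis by (rule near_bipartite_mono) simp
qed

text \<open>Passing through \<open>x\<close> and \<open>y\<close> instead of a cycle segment with
  one or no inner vertex would give a cycle of length \<open>2 * d + 1\<close> or
  \<open>2 * d + 2\<close>, respectively.\<close>

lemma partner_gap:
  assumes o: "x \<in> outside" "y \<in> outside" and xy: "adj x y" "adj x (c i)"
  shows "\<not> adj y (c (i + 1))" "\<not> adj y (c (i + 2))" "\<not> adj x (c (i + 1))"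
    "\<not> adj y (c (i - 1))" "\<not> adj y (c (i - 2))" "\<not> adj x (c (i - 1))"
proof -
  have pxy: "path [x, y]" "path [y, x]" using o xy sym adj_neq by (auto simp: path_Cons)
  have no3: False
    if vw: "path [v, w]" "v \<in> outside" "w \<in> outside" "adj v (c j)" "adj w (c (j + int s))"
      and s: "1 \<le> s" "s \<le> 2" for v w j s
  proof -
    have M: "3 \<le> 2 * d - s + 1 + length [v, w]" "s \<le> 2 * d" using s d2 by auto
    have "set [v, w] \<inter> range c = {}" using vw(2,3) by auto
    then obtain c' where "cyc (2 * d - s + 1 + length [v, w]) c'"
      using cyc_insert[OF c vw(1), of j s] vw(5) sym[OF vw(4)] s M by auto
    moreover have "2 * d - s + 1 + length [v, w] = 2 * d + 2 \<or> 2 * d - s + 1 + length [v, w] = 2 * d + 1"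
      using s d2 by auto
    ultimately show False using no_longer no_longer2 by metis
  qed
  show "\<not> adj y (c (i + 1))" "\<not> adj y (c (i + 2))"
    using no3[OF pxy(1) o xy(2), of 1] no3[OF pxy(1) o xy(2), of 2] by auto
  show "\<not> adj y (c (i - 1))" "\<not> adj y (c (i - 2))"
    using no3[OF pxy(2) o(2,1), of "i - 1" 1] no3[OF pxy(2) o(2,1), of "i - 2" 2] xy(2) by auto
  show "\<not> adj x (c (i + 1))" "\<not> adj x (c (i - 1))"
    using single_not_consecutive[OF o(1), of i] single_not_consecutive[OF o(1), of "i - 1"] xy(2) by auto
qed

lemma pair_card:
  assumes o: "x \<in> outside" "y \<in> outside" and xy: "adj x y"
  shows "nb x = insert y (nb x \<inter> range c)" "d - 1 \<le> card (nb x \<inter> range c)"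
proof -
  show e: "nb x = insert y (nb x \<inter> range c)"
    using partner_unique[OF o _ xy] xy adjV2[of x] by (auto simp: nb_def)
  have "card (nb x) \<le> Suc (card (nb x \<inter> range c))" by (subst e) (rule card_insert_le_m1, auto)
  then show "d - 1 \<le> card (nb x \<inter> range c)" using mindeg[of x] o by auto
qed

text \<open>Besides \<open>Y - 1\<close>, the translate \<open>Y + 2\<close> also avoids
  \<open>X\<close> and \<open>X + 1\<close>. For \<open>d = 3\<close> the count is sharp, so either
  translate fills what \<open>X\<close> and \<open>X + 1\<close> leave of the six cycle
  vertices.\<close>

lemma pair_count:
  assumes o: "x \<in> outside" "y \<in> outside" and xy: "adj x y"
  defines "X \<equiv> nb x \<inter> range c" and "Y \<equiv> nb y \<inter> range c"
  shows "d \<le> 3"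
    and "d = 3 \<Longrightarrow> X \<union> shift c 1 X \<union> shift c 2 Y = range c"
    and "d = 3 \<Longrightarrow> X \<union> shift c 1 X \<union> shift c (- 1) Y = range c"
    and "\<And>j. c j \<in> shift c (- 1) Y \<Longrightarrow> c j \<notin> X \<union> shift c 1 X"
    and "\<And>j. c j \<in> shift c 2 Y \<Longrightarrow> c j \<notin> X \<union> shift c 1 X"
proof -
  have sub: "X \<subseteq> range c" "Y \<subseteq> range c" by (auto simp: X_def Y_def)
  have fin': "finite X" "finite Y" "finite (shift c s A)" for s A
    using finite_subset[OF shift_range cyc_finite[OF c]] by (auto simp: X_def Y_def)
  have gx: "c j \<in> X \<Longrightarrow> c (j + 1) \<notin> X \<and> c (j - 1) \<notin> X \<and> c (j + 1) \<notin> Y \<and> c (j + 2) \<notin> Y \<and> c (j - 1) \<notin> Y \<and> c (j - 2) \<notin> Y" for j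
    using partner_gap[OF o xy, of j] by (auto simp: X_def Y_def nb_def)
  have dj: "X \<inter> shift c 1 X = {}" using gx by (intro shift_disjoint[OF c]) blast
  show d1: "c j \<notin> X \<union> shift c 1 X" if "c j \<in> shift c (- 1) Y" for j
    using that gx[of j] gx[of "j - 1"] shift_mem[OF c] by (auto simp: add.commute)
  show d2': "c j \<notin> X \<union> shift c 1 X" if "c j \<in> shift c 2 Y" for j
    using that gx[of j] gx[of "j - 1"] shift_mem[OF c] by (auto simp: add.commute)
  have cX: "d - 1 \<le> card X" "d - 1 \<le> card Y"
    using pair_card(2)[OF o xy] pair_card(2)[OF o(2,1) sym[OF xy]] by (auto simp: X_def Y_def)
  have dj1: "(X \<union> shift c 1 X) \<inter> shift c (- 1) Y = {}" "(X \<union> shift c 1 X) \<inter> shift c 2 Y = {}"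
    using d1 d2' shift_range by blast+
  have cnt: "card (X \<union> shift c 1 X \<union> shift c (- 1) Y) = 2 * card X + card Y"
    "card (X \<union> shift c 1 X \<union> shift c 2 Y) = 2 * card X + card Y"
    using dj dj1 fin' shift_card[OF c sub(1)] shift_card[OF c sub(2)] by (simp_all add: card_Un_disjoint)
  have sr: "X \<union> shift c 1 X \<union> shift c (- 1) Y \<subseteq> range c" "X \<union> shift c 1 X \<union> shift c 2 Y \<subseteq> range c"
    using sub shift_range by blast+
  have "2 * card X + card Y \<le> 2 * d"
    using card_mono[OF cyc_finite[OF c] sr(1)] cnt(1) cyc_card[OF c] by simp
  then show "d \<le> 3" using cX d2 by linarith
  show "X \<union> shift c 1 X \<union> shift c 2 Y = range c" if "d = 3"
    using sr cnt cyc_card[OF c] cyc_finite[OF c] cX that by (intro card_seteq) auto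
  show "X \<union> shift c 1 X \<union> shift c (- 1) Y = range c" if "d = 3"
    using sr cnt cyc_card[OF c] cyc_finite[OF c] cX that by (intro card_seteq) auto
qed

text \<open>\<open>Y - 1\<close> and \<open>Y + 2\<close> are both the complement of
  \<open>X\<close> and \<open>X + 1\<close>, so \<open>Y\<close> is invariant under a shift by
  three.\<close>

lemma pair_periodic:
  assumes o: "x \<in> outside" "y \<in> outside" and xy: "adj x y" and d: "d = 3"
  shows "adj y (c (i + 3)) \<longleftrightarrow> adj y (c i)"
proof -
  note pc = pair_count[OF o xy]
  let ?Z = "(nb x \<inter> range c) \<union> shift c 1 (nb x \<inter> range c)"
  have "c (i + 2) \<in> shift c 2 (nb y \<inter> range c) \<longleftrightarrow> c (i + 2) \<notin> ?Z"
    using pc(2)[OF d] pc(5) by blast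
  moreover have "c (i + 2) \<in> shift c (- 1) (nb y \<inter> range c) \<longleftrightarrow> c (i + 2) \<notin> ?Z"
    using pc(3)[OF d] pc(4) by blast
  ultimately show ?thesis using shift_mem[OF c] by (simp add: nb_def add.commute)
qed

text \<open>On a 4-cycle distinct vertices are at distance one or two, which
  \<open>partner_gap\<close> forbids, so both ends attach to the same single vertex.\<close>

lemma pair_attachment2:
  assumes o: "x \<in> outside" "y \<in> outside" and xy: "adj x y" and d: "d = 2"
  obtains a where "nb x = {y, c a}" "nb y = {x, c a}" "0 \<le> a" "a < 4"
proof -
  have one: "nb x = {y, c a}"
    if o: "x \<in> outside" "y \<in> outside" and xy: "adj x y" and a: "adj y (c a)" for x y a
  proof -
    have "nb x \<inter> range c \<subseteq> {c a}"
    proof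
      fix v assume v: "v \<in> nb x \<inter> range c"
      then obtain j where j: "v = c j" "a \<le> j" "j < a + int (2 * d)"
        using cyc_obtain_index[OF c] by blast
      then have "j = a \<or> j = a + 1 \<or> j = a + 2 \<or> j = a - 1 + int (2 * d)" using d by auto
      then have "v = c a \<or> v = c (a + 1) \<or> v = c (a + 2) \<or> v = c (a - 1)"
        using j(1) cyc_period[OF c, of "a - 1"] by metis
      moreover have "adj x v" using v by (simp add: nb_def)
      ultimately show "v \<in> {c a}" using partner_gap[OF o(2,1) sym[OF xy] a] by blast
    qed
    moreover have "nb x \<inter> range c \<noteq> {}" using pair_card(2)[OF o xy] d by auto
    ultimately have e: "nb x \<inter> range c = {c a}" by (metis subset_singletonD)
    show ?thesis using pair_card(1)[OF o xy] unfolding e .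
  qed
  obtain i where i: "adj y (c i)" by (rule attached[OF o(2)])
  obtain a where a: "c i = c a" "0 \<le> a" "a < 0 + int (2 * d)"
    using cyc_obtain_index[OF c, of "c i" 0] by blast
  have ya: "adj y (c a)" using i a(1) by simp
  have x: "nb x = {y, c a}" by (rule one[OF o xy ya])
  then have "adj x (c a)" by (auto simp: nb_def)
  then have "nb y = {x, c a}" by (rule one[OF o(2,1) sym[OF xy]])
  then show ?thesis using that x a d by simp
qed

text \<open>Every vertex of a 6-cycle other than the two antipodal attachments of \<open>y\<close>
  is within distance two of one of them, so \<open>x\<close>, which needs two attachments, has the
  same ones.\<close>

lemma pair_attachment3:
  assumes o: "x \<in> outside" "y \<in> outside" and xy: "adj x y" and d: "d = 3"
  obtains a where "nb x = {y, c a, c (a + 3)}" "nb y = {x, c a, c (a + 3)}" "0 \<le> a" "a < 6"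
proof -
  have one: "nb x = {y, c a, c (a + 3)}"
    if o: "x \<in> outside" "y \<in> outside" and xy: "adj x y" and a: "adj y (c a)" for x y a
  proof -
    have a3: "adj y (c (a + 3))" using pair_periodic[OF o xy d, of a] a by blast
    have sub: "nb x \<inter> range c \<subseteq> {c a, c (a + 3)}"
    proof
      fix v assume v: "v \<in> nb x \<inter> range c"
      then obtain j where j: "v = c j" "a \<le> j" "j < a + int (2 * d)"
        using cyc_obtain_index[OF c] by blast
      then have "j = a \<or> j = a + 1 \<or> j = a + 2 \<or> j = a + 3 \<or> j = a + 3 + 1 \<or> j = a + 3 + 2" using d by auto
      moreover have "adj x (c j)" using v j(1) by (simp add: nb_def)
      ultimately show "v \<in> {c a, c (a + 3)}"
        using partner_gap[OF o(2,1) sym[OF xy] a] partner_gap[OF o(2,1) sym[OF xy] a3] j(1)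
        by blast
    qed
    have "2 \<le> card (nb x \<inter> range c)" using pair_card(2)[OF o xy] d by auto
    moreover have "card {c a, c (a + 3)} \<le> 2" by (simp add: card_insert_if)
    ultimately have e: "nb x \<inter> range c = {c a, c (a + 3)}" using sub by (intro card_seteq) auto
    show ?thesis using pair_card(1)[OF o xy] unfolding e .
  qed
  obtain i where i: "adj y (c i)" by (rule attached[OF o(2)])
  obtain a where a: "c i = c a" "0 \<le> a" "a < 0 + int (2 * d)"
    using cyc_obtain_index[OF c, of "c i" 0] by blast
  have ya: "adj y (c a)" using i a(1) by simp
  have x: "nb x = {y, c a, c (a + 3)}" by (rule one[OF o xy ya])
  then have "adj x (c a)" by (auto simp: nb_def)
  then have "nb y = {x, c a, c (a + 3)}" by (rule one[OF o(2,1) sym[OF xy]])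
  then show ?thesis using that x a d by simp
qed

text \<open>Two pairs hung at consecutive vertices would extend the opened cycle by four
  vertices.\<close>

lemma consecutive_pairs:
  assumes "u \<in> outside" "v \<in> outside" "x \<in> outside" "y \<in> outside"
    and "distinct [u, v, x, y]" "adj u v" "adj x y" "adj x (c i)"
  shows "\<not> adj u (c (i + 1))" "\<not> adj u (c (i - 1))"
proof -
  have ps: "path [x, y]" "path [u, v]" using assms by (auto simp: path_Cons)
  have "2 * d + length [x, y] + length [u, v] \<le> p" if "adj u (c (i + 1))"
    using assms ps that sym by (intro cyc_ends_path[OF c, of _ i]) auto
  then show "\<not> adj u (c (i + 1))" using p by auto
  have "2 * d + length [u, v] + length [x, y] \<le> p" if "adj u (c (i - 1))"
    using assms ps that sym by (intro cyc_ends_path[OF c, of _ "i - 1"]) auto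
  then show "\<not> adj u (c (i - 1))" using p by auto
qed

lemma single_and_pair3:
  assumes d: "d = 3" and o: "x \<in> outside" "y \<in> outside" "u \<in> outside"
    and ne: "x \<noteq> u" "y \<noteq> u" and ad: "adj x y" "adj y (c 3)" "adj u (c 2)" "adj u (c 4)"
  shows False
proof -
  have a: "adj (c 3) (c 2)" "adj (c 4) (c 5)" "adj (c 5) (c 6)" "adj (c 6) (c 7)"
    by (rule cyc_adj'[OF c]; simp)+
  \<comment> \<open>\<open>c 6\<close> and \<open>c 7\<close> are \<open>c 0\<close> and
    \<open>c 1\<close>, so this takes the whole cycle and three outside vertices, nine where eight
    are allowed.\<close>
  have "path [x, y, c 3, c 2, u, c 4, c 5, c 6, c 7]"
    using ad ne a sym[OF ad(3)] adj_neq[OF ad(1)] d cyc_inV[OF c]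
      not_range[OF o(1)] not_range[OF o(2)] not_range[OF o(3)]
    by (simp add: path_Cons cyc_eq[OF c])
  from maxp[OF this] show False using p d by simp
qed

text \<open>A chord from \<open>c 1\<close> to \<open>c 4\<close> or \<open>c 5\<close> would give a
  path on nine vertices that starts in one pair and ends in the other. Degree three then forces all
  remaining candidates to be neighbours.\<close>

lemma cycle_nb3:
  assumes d: "d = 3" and O: "\<And>u. u \<in> outside \<Longrightarrow> \<exists>v\<in>outside. nb u = {v, c 0, c 3}"
    and o: "x \<in> outside" "y \<in> outside" "z \<in> outside" "w \<in> outside"
    and ne: "distinct [x, y, z, w]" and ad: "adj x y" "adj z w"
  shows "nb (c 1) = {c 0, c 2, c 3}"
proof -
  have a: "adj (c 6) (c 5)" "adj (c 5) (c 4)" "adj (c 4) (c 3)" "adj (c 1) (c 2)" "adj (c 2) (c 3)" "adj (c 0) (c 1)"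
    by (rule cyc_adj'[OF c]; simp)+
  have c60: "c 6 = c 0" using cyc_period[OF c, of 0] d by simp
  have y0: "adj y (c 0)" and z3: "adj z (c 3)"
    using O[OF o(2)] O[OF o(3)] by (auto simp: nb_def)
  have n4: "\<not> adj (c 1) (c 4)"
  proof
    assume "adj (c 1) (c 4)"
    then have "path [x, y, c 6, c 5, c 4, c 1, c 2, c 3, z]"
      using ad ne a y0 sym[OF z3] sym d cyc_inV[OF c] c60
        not_range[OF o(1)] not_range[OF o(2)] not_range[OF o(3)]
      by (simp add: path_Cons cyc_eq[OF c])
    from maxp[OF this] show False using p d by simp
  qed
  have n5: "\<not> adj (c 1) (c 5)"
  proof
    assume "adj (c 1) (c 5)"
    then have "path [x, y, c 0, c 1, c 5, c 4, c 3, z, w]"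
      using ad ne a y0 sym[OF z3] d cyc_inV[OF c]
        not_range[OF o(1)] not_range[OF o(2)] not_range[OF o(3)] not_range[OF o(4)]
      by (simp add: path_Cons cyc_eq[OF c])
    from maxp[OF this] show False using p d by simp
  qed
  have "nb (c 1) \<subseteq> {c 0, c 2, c 3}"
  proof
    fix t assume "t \<in> nb (c 1)"
    then have t: "adj (c 1) t" by (simp add: nb_def)
    have "t \<in> range c"
    proof (rule ccontr)
      assume "t \<notin> range c"
      then have "t \<in> outside" using adjV2[OF t] by simp
      then obtain v where v: "v \<in> outside" "nb t = {v, c 0, c 3}" using O by blast
      have "c 1 \<in> nb t" using sym[OF t] by (simp add: nb_def)
      then show False using v not_range[OF v(1)] d by (simp add: cyc_eq[OF c])
    qed
    then obtain j where j: "t = c j" "0 \<le> j" "j < 0 + int (2 * d)" using cyc_obtain_index[OF c] by blast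
    then have "j = 0 \<or> j = 1 \<or> j = 2 \<or> j = 3 \<or> j = 4 \<or> j = 5" using d by auto
    then show "t \<in> {c 0, c 2, c 3}" using j(1) t n4 n5 irr by auto
  qed
  moreover have "card {c 0, c 2, c 3} \<le> 3" by (simp add: card_insert_if)
  ultimately show ?thesis
    using mindeg[OF cyc_inV[OF c], of 1] d by (intro card_seteq) auto
qed

text \<open>A single vertex sees, according to its parity, both cycle neighbours of
  \<open>c 3\<close> or of \<open>c 0\<close>, where the pair hangs. Another pair attaches at
  antipodal vertices, not next to \<open>c 0\<close>, so \<open>c 0\<close> and \<open>c 3\<close>
  remain.\<close>

lemma outside_structure3:
  assumes d: "d = 3" and o: "x \<in> outside" "y \<in> outside" and xy: "adj x y"
    and nx: "nb x = {y, c 0, c 3}" "nb y = {x, c 0, c 3}" and u: "u \<in> outside"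
  shows "\<exists>v\<in>outside. nb u = {v, c 0, c 3}"
proof (cases "nb u \<subseteq> range c")
  case True
  then have ne: "x \<noteq> u" "y \<noteq> u" using nx o by auto
  note alt = single_alternates[OF u True]
  have y0: "adj y (c 0)" "adj y (c 3)" using nx by (auto simp: nb_def)
  have False
  proof (cases "adj u (c 0)")
    case True
    then have "adj u (c 2)" "adj u (c 4)" using alt[of 0] alt[of 1] alt[of 2] alt[of 3] by auto
    then show False using single_and_pair3[OF d o u ne xy y0(2)] by blast
  next
    case False
    then have u13: "adj u (c 1)" "adj u (c (- 1))" using alt[of 0] alt[of "- 1"] by auto
    interpret r: short_cycle V adj d p "\<lambda>j. c (3 - j)" by (rule reflected)
    have rr: "range (\<lambda>j. c (3 - j)) = range c" by (rule range_reflect)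
    show False using r.single_and_pair3[OF d, of x y u, unfolded rr] o u ne xy y0(1) u13 by simp
  qed
  then show ?thesis ..
next
  case False
  then obtain v where v: "adj u v" "v \<notin> range c" by (auto simp: nb_def)
  then have vo: "v \<in> outside" using adjV2 by blast
  show ?thesis
  proof (cases "u = x \<or> u = y")
    case True
    then show ?thesis using nx o by blast
  next
    case ne: False
    have vxy: "v \<noteq> x" "v \<noteq> y"
      using partner_unique[OF o(1,2) u xy] partner_unique[OF o(2,1) u sym[OF xy]] sym[OF v(1)] ne by auto
    have dis: "distinct [u, v, x, y]" using ne vxy adj_neq[OF v(1)] adj_neq[OF xy] by auto
    have x0: "adj x (c 0)" using nx by (auto simp: nb_def)
    have n: "\<not> adj u (c 1)" "\<not> adj u (c (- 1))"
      using consecutive_pairs[OF u vo o dis v(1) xy x0] by auto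
    obtain b where b: "nb u = {v, c b, c (b + 3)}" "0 \<le> b" "b < 6"
      using pair_attachment3[OF u vo v(1) d] by metis
    have ub: "adj u (c b)" "adj u (c (b + 3))" using b(1) by (auto simp: nb_def)
    have per: "c 6 = c 0" "c 7 = c 1" "c 5 = c (- 1)"
      using cyc_period[OF c, of 0] cyc_period[OF c, of 1] cyc_period[OF c, of "- 1"] d by auto
    have "b = 0 \<or> b = 1 \<or> b = 2 \<or> b = 3 \<or> b = 4 \<or> b = 5" using b by auto
    then have "b = 0 \<or> b = 3" using ub n per by auto
    then have e: "{c b, c (b + 3)} = {c 0, c 3}"
      by (elim disjE) (simp_all add: per(1) insert_commute)
    have "nb u = {v, c 0, c 3}" using b(1) unfolding e .
    then show ?thesis using vo by blast
  qed
qed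

lemma matching_join3:
  assumes d: "d = 3" and o: "x \<in> outside" "y \<in> outside" and xy: "adj x y"
    and nx: "nb x = {y, c 0, c 3}" "nb y = {x, c 0, c 3}"
  shows "cliques 2 (V - {c 0, c 3}) {c 0, c 3}"
proof -
  have O: "\<exists>v\<in>outside. nb u = {v, c 0, c 3}" if "u \<in> outside" for u
    by (rule outside_structure3[OF d o xy nx that])
  \<comment> \<open>Eight vertices are in use and \<open>p = 8\<close>, so another outside vertex
    exists; its pair is the second one that \<open>cycle_nb3\<close> needs.\<close>
  have "card (insert x (insert y (range c))) \<le> p"
    using o p cyc_card[OF c] cyc_finite[OF c] adj_neq[OF xy] by (simp add: card_insert_if)
  then obtain z where z: "z \<in> V - insert x (insert y (range c))"
    using outside_ex[of "insert x (insert y (range c))"] cyc_finite[OF c] by auto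
  then have zo: "z \<in> outside" by auto
  obtain w where w: "w \<in> outside" "nb z = {w, c 0, c 3}" using O[OF zo] by blast
  have zw: "adj z w" using w(2) by (auto simp: nb_def)
  have "w \<noteq> x" "w \<noteq> y"
    using partner_unique[OF o zo xy] partner_unique[OF o(2,1) zo sym[OF xy]] sym[OF zw] z by auto
  then have dis: "distinct [x, y, z, w]" using z adj_neq[OF zw] adj_neq[OF xy] by auto
  have c6: "c 6 = c 0" "c (- 3) = c 3" "c (- 1) = c 5" "c (- 2) = c 4" "c 7 = c 1"
    using cyc_period[OF c, of 0] cyc_period[OF c, of "- 3"] cyc_period[OF c, of "- 1"]
      cyc_period[OF c, of "- 2"] cyc_period[OF c, of 1] d by auto
  note hyp = o zo w(1) dis xy zw
  have n1: "nb (c 1) = {c 0, c 2, c 3}" by (rule cycle_nb3[OF d O hyp])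
  \<comment> \<open>The two reflections and the half turn used from here on preserve
    \<open>{c 0, c 3}\<close> and carry \<open>c 1\<close> to the three other vertices.\<close>
  have n2: "nb (c 2) = {c 3, c 1, c 0}"
  proof -
    interpret r: short_cycle V adj d p "\<lambda>j. c (3 - j)" by (rule reflected)
    show ?thesis
      using r.cycle_nb3[OF d, unfolded range_reflect, OF _ hyp] O by (simp add: insert_commute)
  qed
  have n5: "nb (c 5) = {c 0, c 4, c 3}"
  proof -
    interpret r: short_cycle V adj d p "\<lambda>j. c (0 - j)" by (rule reflected)
    show ?thesis
      using r.cycle_nb3[OF d, unfolded range_reflect, OF _ hyp] O c6 by (simp add: insert_commute)
  qed
  have n4: "nb (c 4) = {c 3, c 5, c 0}"
  proof -
    interpret r: short_cycle V adj d p "\<lambda>j. c (j + 3)" by (rule shifted)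
    show ?thesis
      using r.cycle_nb3[OF d, unfolded range_shift, OF _ hyp] O c6 by (simp add: insert_commute)
  qed
  have "\<exists>D\<subseteq>V - {c 0, c 3}. t \<in> D \<and> card D = 2 \<and> (\<forall>y\<in>D. nb y = D \<union> {c 0, c 3} - {y})"
    if t: "t \<in> V - {c 0, c 3}" for t
  proof (cases "t \<in> range c")
    case True
    then obtain j where j: "t = c j" "0 \<le> j" "j < 0 + int (2 * d)" using cyc_obtain_index[OF c] by blast
    then have "j = 0 \<or> j = 1 \<or> j = 2 \<or> j = 3 \<or> j = 4 \<or> j = 5" using d by auto
    then consider "t \<in> {c 1, c 2}" | "t \<in> {c 4, c 5}" using j(1) t by auto
    then show ?thesis
    proof cases
      case 1
      have "c 1 \<noteq> c 2" "c 1 \<noteq> c 0" "c 1 \<noteq> c 3" "c 2 \<noteq> c 0" "c 2 \<noteq> c 3" using d by (simp_all add: cyc_eq[OF c])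
      then show ?thesis using 1 n1 n2 cyc_inV[OF c] by (intro exI[of _ "{c 1, c 2}"]) auto
    next
      case 2
      have "c 4 \<noteq> c 5" "c 4 \<noteq> c 0" "c 4 \<noteq> c 3" "c 5 \<noteq> c 0" "c 5 \<noteq> c 3" using d by (simp_all add: cyc_eq[OF c])
      then show ?thesis using 2 n4 n5 cyc_inV[OF c] by (intro exI[of _ "{c 4, c 5}"]) auto
    qed
  next
    case False
    then have to: "t \<in> outside" using t by blast
    obtain v where v: "v \<in> outside" "nb t = {v, c 0, c 3}" using O[OF to] by blast
    obtain t' where t': "t' \<in> outside" "nb v = {t', c 0, c 3}" using O[OF v(1)] by blast
    have tv: "adj t v" using v(2) by (auto simp: nb_def)
    have "adj v t'" using t'(2) by (auto simp: nb_def)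
    then have "t' = t" using partner_unique[OF v(1) to t'(1) sym[OF tv]] by simp
    then show ?thesis
      using v t' to adj_neq[OF tv] not_range[OF to] not_range[OF v(1)]
      by (intro exI[of _ "{t, v}"]) auto
  qed
  then show ?thesis using cyc_inV[OF c] by (simp add: cliques_def)
qed

text \<open>Here \<open>p = 6\<close>. A single vertex of odd parity, or a second pair at
  \<open>c 2\<close>, would allow a path on seven vertices starting with \<open>x\<close>,
  \<open>y\<close>, \<open>c 0\<close>.\<close>

lemma outside_structure2:
  assumes d: "d = 2" and o: "x \<in> outside" "y \<in> outside" and xy: "adj x y"
    and nx: "nb x = {y, c 0}" "nb y = {x, c 0}" and u: "u \<in> outside"
  shows "nb u = {c 0, c 2} \<or> (\<exists>v\<in>outside. nb u = {v, c 0})"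
proof (cases "nb u \<subseteq> range c")
  case True
  then have ne: "x \<noteq> u" "y \<noteq> u" using nx o by auto
  note alt = single_alternates[OF u True]
  have y0: "adj y (c 0)" using nx by (auto simp: nb_def)
  have u0: "adj u (c 0)"
  proof (rule ccontr)
    assume "\<not> adj u (c 0)"
    then have u1: "adj u (c 1)" "adj u (c 3)" using alt[of 0] alt[of 1] alt[of 2] by auto
    have "adj (c 0) (c 1)" "adj (c 3) (c 2)" by (rule cyc_adj'[OF c]; simp)+
    then have "path [x, y, c 0, c 1, u, c 3, c 2]"
      using xy y0 ne u1 sym[OF u1(1)] adj_neq[OF xy] d cyc_inV[OF c]
        not_range[OF o(1)] not_range[OF o(2)] not_range[OF u]
      by (simp add: path_Cons cyc_eq[OF c])
    from maxp[OF this] show False using p d by simp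
  qed
  then have u1: "\<not> adj u (c 1)" "adj u (c 2)" "\<not> adj u (c 3)" using alt[of 0] alt[of 1] alt[of 2] by auto
  have "nb u \<subseteq> {c 0, c 2}"
  proof
    fix t assume t: "t \<in> nb u"
    then have "t \<in> range c" using True by (rule rev_subsetD)
    then obtain j where j: "t = c j" "0 \<le> j" "j < 0 + int (2 * d)"
      using cyc_obtain_index[OF c] by blast
    then have "j = 0 \<or> j = 1 \<or> j = 2 \<or> j = 3" using d by auto
    then show "t \<in> {c 0, c 2}" using j(1) t u1 by (auto simp: nb_def)
  qed
  then show ?thesis using u0 u1 by (auto simp: nb_def)
next
  case False
  then obtain v where v: "adj u v" "v \<notin> range c" by (auto simp: nb_def)
  then have vo: "v \<in> outside" using adjV2 by blast
  show ?thesis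
  proof (cases "u = x \<or> u = y")
    case True
    then show ?thesis using nx o by blast
  next
    case ne: False
    have vxy: "v \<noteq> x" "v \<noteq> y"
      using partner_unique[OF o(1,2) u xy] partner_unique[OF o(2,1) u sym[OF xy]] sym[OF v(1)] ne by auto
    have dis: "distinct [u, v, x, y]" using ne vxy adj_neq[OF v(1)] adj_neq[OF xy] by auto
    have x0: "adj x (c 0)" and y0: "adj y (c 0)" using nx by (auto simp: nb_def)
    have n: "\<not> adj u (c 1)" "\<not> adj u (c (- 1))"
      using consecutive_pairs[OF u vo o dis v(1) xy x0] by auto
    have n2: "\<not> adj u (c 2)"
    proof
      assume u2: "adj u (c 2)"
      have dis': "distinct [x, y, u, v]" using dis by auto
      have "adj (c 0) (c 1)" "adj (c 1) (c 2)" by (rule cyc_adj'[OF c]; simp)+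
      then have "path [x, y, c 0, c 1, c 2, u, v]"
        using xy y0 dis' v(1) sym[OF u2] d cyc_inV[OF c]
          not_range[OF o(1)] not_range[OF o(2)] not_range[OF u] not_range[OF vo]
        by (simp add: path_Cons cyc_eq[OF c])
      from maxp[OF this] show False using p d by simp
    qed
    obtain b where b: "nb u = {v, c b}" "0 \<le> b" "b < 4"
      using pair_attachment2[OF u vo v(1) d] by metis
    have ub: "adj u (c b)" using b(1) by (auto simp: nb_def)
    have per: "c 3 = c (- 1)" using cyc_period[OF c, of "- 1"] d by auto
    have "b = 0 \<or> b = 1 \<or> b = 2 \<or> b = 3" using b by auto
    then have "b = 0" using ub n n2 per by auto
    then show ?thesis using b(1) vo by blast
  qed
qed

text \<open>If \<open>c 1\<close> and \<open>c 3\<close> are adjacent, no single vertex can exist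
  and the 4-cycle spans a block of order \<open>d + 2\<close>. If not, \<open>c 1\<close> and
  \<open>c 3\<close> have the same neighbourhood as single vertices and join them in
  \<open>T\<close>.\<close>

lemma pairs_and_singles2:
  assumes d: "d = 2" and o: "x \<in> outside" "y \<in> outside" and xy: "adj x y"
    and nx: "nb x = {y, c 0}" "nb y = {x, c 0}"
  shows "cliques d (V - range c) {c 0} \<or>
    (\<exists>T U. V = {c 0, c 2} \<union> T \<union> U \<and> c 0 \<notin> T \<union> U \<and> c 2 \<notin> T \<union> U \<and> T \<inter> U = {} \<and>
      2 \<le> card T \<and> U \<noteq> {} \<and> (\<forall>t\<in>T. nb t = {c 0, c 2}) \<and> cliques d U {c 0})"
proof -
  note O = outside_structure2[OF d o xy nx]
  have y0: "adj y (c 0)" using nx by (auto simp: nb_def)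
  define T where "T = {u \<in> outside. nb u = {c 0, c 2}}"
  define U where "U = outside - T"
  have cdist: "c 0 \<noteq> c 1" "c 0 \<noteq> c 2" "c 0 \<noteq> c 3" "c 1 \<noteq> c 2" "c 1 \<noteq> c 3" "c 2 \<noteq> c 3"
    using d by (simp_all add: cyc_eq[OF c])
  have rc: "range c = {c 0, c 1, c 2, c 3}"
  proof -
    have "{0..<0 + int (2 * d)} = {0, 1, 2, 3}" using d by auto
    then show ?thesis using cyc_range[OF c, of 0] by simp
  qed
  have cl: "cliques d U {c 0}"
    unfolding cliques_def
  proof (intro conjI ballI)
    show "U \<subseteq> V - {c 0}" by (auto simp: U_def)
    fix t assume t: "t \<in> U"
    then have to: "t \<in> outside" by (simp add: U_def)
    obtain v where v: "v \<in> outside" "nb t = {v, c 0}" using O[OF to] t to by (auto simp: U_def T_def)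
    have tv: "adj t v" using v(2) by (auto simp: nb_def)
    have "t \<in> nb v" using sym[OF tv] by (simp add: nb_def)
    then have "nb v \<noteq> {c 0, c 2}" using not_range[OF to] by auto
    then obtain t' where t': "t' \<in> outside" "nb v = {t', c 0}" using O[OF v(1)] by auto
    have "adj v t'" using t'(2) by (auto simp: nb_def)
    then have "t' = t" using partner_unique[OF v(1) to t'(1) sym[OF tv]] by simp
    moreover have "v \<in> U" using v(1) \<open>nb v \<noteq> {c 0, c 2}\<close> by (simp add: U_def T_def)
    ultimately show "\<exists>D\<subseteq>U. t \<in> D \<and> card D = d \<and> (\<forall>y\<in>D. nb y = D \<union> {c 0} - {y})"
      using v t t' to adj_neq[OF tv] not_range[OF to] not_range[OF v(1)] d
      by (intro exI[of _ "{t, v}"]) auto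
  qed
  have "nb x \<noteq> {c 0, c 2}" using nx(1) not_range[OF o(2)] by (metis insertCI insertE singletonD)
  then have xU: "x \<in> U" using o by (simp add: U_def T_def)
  have "nb y \<noteq> {c 0, c 2}" using nx(2) not_range[OF o(1)] by (metis insertCI insertE singletonD)
  then have yU: "y \<in> U" using o by (simp add: U_def T_def)
  have nT: "nb t = {c 0, c 2}" if "t \<in> T" for t using that by (simp add: T_def)
  have adj4: "adj (c 1) (c 0)" "adj (c 1) (c 2)" "adj (c 2) (c 1)" "adj (c 3) (c 2)" "adj (c 3) (c 4)"
    by (rule cyc_adj'[OF c]; simp)+
  have c4: "c 4 = c 0" using cyc_period[OF c, of 0] d by simp
  show ?thesis
  proof (cases "adj (c 1) (c 3)")
    case True
    have "T = {}"
    proof (rule ccontr)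
      assume "T \<noteq> {}"
      then obtain u where uT: "u \<in> T" by blast
      then have u: "u \<in> outside" "adj u (c 0)" "adj u (c 2)" using nT[OF uT] by (auto simp: T_def nb_def)
      have "x \<noteq> u" "y \<noteq> u" using uT xU yU by (auto simp: U_def)
      then have "path [x, y, c 0, u, c 2, c 1, c 3]"
        using xy y0 u sym[OF u(2)] adj4 True cdist adj_neq[OF xy] cyc_inV[OF c]
          not_range[OF o(1)] not_range[OF o(2)] not_range[OF u(1)]
        by (simp add: path_Cons)
      from maxp[OF this] show False using p d by simp
    qed
    then show ?thesis using cl by (simp add: U_def)
  next
    case False
    have inner: "nb (c j) \<subseteq> {c 0, c 2}" if j: "c j = c 1 \<or> c j = c 3" for j
    proof
      fix t assume "t \<in> nb (c j)"
      then have t: "adj (c j) t" by (simp add: nb_def)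
      have ct: "c j \<in> nb t" using sym[OF t] by (simp add: nb_def)
      have "t \<in> range c"
      proof (rule ccontr)
        assume "t \<notin> range c"
        then have "t \<in> outside" using adjV2[OF t] by simp
        from O[OF this] show False using ct j cdist by auto
      qed
      then show "t \<in> {c 0, c 2}" using rc t j False sym irr by auto
    qed
    have n13: "nb (c 1) = {c 0, c 2}" "nb (c 3) = {c 0, c 2}"
      using inner[of 1] inner[of 3] adj4 c4 by (auto simp: nb_def)
    let ?T = "{c 1, c 3} \<union> T"
    have "T \<inter> range c = {}" by (auto simp: T_def)
    then have "{c 1, c 3} \<inter> T = {}" by auto
    moreover have "finite T" by (rule finite_subset[OF _ fin]) (auto simp: T_def)
    ultimately have "2 \<le> card ?T" using cdist by (simp add: card_Un_disjoint)
    moreover have "V = {c 0, c 2} \<union> ?T \<union> U"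
      using rc cyc_inV[OF c] by (auto simp: T_def U_def)
    moreover have "c 0 \<notin> ?T \<union> U" "c 2 \<notin> ?T \<union> U" "?T \<inter> U = {}"
      using cdist by (auto simp: T_def U_def)
    moreover have "U \<noteq> {}" using xU by blast
    moreover have "\<forall>t\<in>?T. nb t = {c 0, c 2}" using n13 nT by blast
    ultimately show ?thesis using cl by blast
  qed
qed

end

section \<open>The structures that can occur\<close>

context longest begin

text \<open>The spanning cycle leaves the chords of the block free and later supplies the absence of
  a cut vertex.\<close>

definition large_block :: bool where
  "large_block \<longleftrightarrow> (\<exists>cy c. cyc (d + 2) cy \<and> c \<in> range cy \<and> cliques d (V - range cy) {c})"

definition linked_windmills :: bool where
  "linked_windmills \<longleftrightarrow> (\<exists>c e U1 U2. adj c e \<and> V = {c, e} \<union> U1 \<union> U2 \<and> U1 \<inter> U2 = {} \<and>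
     U1 \<noteq> {} \<and> U2 \<noteq> {} \<and> c \<notin> U2 \<and> e \<notin> U1 \<and> cliques d U1 {c} \<and> cliques d U2 {e})"

text \<open>\<open>a\<close> is the centre of the cliques and \<open>b\<close> that of the star with
  leaves \<open>T\<close>. The pair \<open>a\<close>, \<open>b\<close> may or may not be an edge,
  which separates \<open>G5\<close> from \<open>G4\<close>.\<close>

definition bipartite_block :: bool where
  "bipartite_block \<longleftrightarrow> (\<exists>a b T U. a \<noteq> b \<and> V = {a, b} \<union> T \<union> U \<and> a \<notin> T \<union> U \<and> b \<notin> T \<union> U \<and> T \<inter> U = {} \<and>
      2 \<le> card T \<and> U \<noteq> {} \<and> (\<forall>t\<in>T. nb t = {a, b}) \<and> cliques d U {a})"

definition matching_join :: bool where
  "matching_join \<longleftrightarrow> (\<exists>a\<in>V. \<exists>b\<in>V. a \<noteq> b \<and> cliques 2 (V - {a, b}) {a, b})"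

end

lemma (in short_cycle) short_cycle_structure:
  "near_bipartite False \<or> d = 2 \<and> (large_block \<or> bipartite_block) \<or> d = 3 \<and> matching_join"
proof (cases "\<forall>u\<in>outside. nb u \<subseteq> range c")
  case True
  then show ?thesis using all_single by blast
next
  case False
  then obtain x y where x: "x \<in> outside" and y: "adj x y" "y \<notin> range c" by (auto simp: nb_def)
  have yo: "y \<in> outside" using y adjV2 by blast
  have "d = 2 \<or> d = 3" using pair_count(1)[OF x yo y(1)] d2 by linarith
  then show ?thesis
  proof
    assume d: "d = 2"
    obtain a where a: "nb x = {y, c a}" "nb y = {x, c a}"
      using pair_attachment2[OF x yo y(1) d] by metis
    interpret s: short_cycle V adj d p "\<lambda>j. c (j + a)" by (rule shifted)
    have cl: "cliques d (V - range c) {c a} \<or>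
      (\<exists>T U. V = {c a, c (2 + a)} \<union> T \<union> U \<and> c a \<notin> T \<union> U \<and> c (2 + a) \<notin> T \<union> U \<and> T \<inter> U = {} \<and>
      2 \<le> card T \<and> U \<noteq> {} \<and> (\<forall>t\<in>T. nb t = {c a, c (2 + a)}) \<and> cliques d U {c a})"
      using s.pairs_and_singles2[OF d, unfolded range_shift, OF x yo y(1)] a by simp
    have "c a \<noteq> c (2 + a)" using d by (simp add: cyc_eq[OF c])
    \<comment> \<open>For \<open>d = 2\<close> the lengths \<open>2 * d\<close> and
      \<open>d + 2\<close> agree, so the 4-cycle spans the large block.\<close>
    moreover have "cyc (d + 2) c" using c d by simp
    ultimately have "large_block \<or> bipartite_block"
      using cl unfolding large_block_def bipartite_block_def by blast
    then show ?thesis using d by blast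
  next
    assume d: "d = 3"
    obtain a where a: "nb x = {y, c a, c (a + 3)}" "nb y = {x, c a, c (a + 3)}"
      using pair_attachment3[OF x yo y(1) d] by metis
    interpret s: short_cycle V adj d p "\<lambda>j. c (j + a)" by (rule shifted)
    have "cliques 2 (V - {c a, c (a + 3)}) {c a, c (a + 3)}"
      using s.matching_join3[OF d, unfolded range_shift, OF x yo y(1)] a by (simp add: add.commute)
    moreover have "c a \<noteq> c (a + 3)" using d by (simp add: cyc_eq[OF c])
    ultimately show ?thesis using d cyc_inV[OF c] unfolding matching_join_def by blast
  qed
qed

lemma (in longest) longest_path_structure:
  assumes d: "1 \<le> d" and xs: "path xs" "length xs = p" and p: "p \<le> 2 * d + 2"
  shows "near_bipartite (p = 2 * d + 2) \<or> (\<exists>c\<in>V. cliques d (V - {c}) {c}) \<or>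
    p = 2 * d + 2 \<and> (linked_windmills \<or> large_block \<or> d = 2 \<and> bipartite_block \<or> d = 3 \<and> matching_join)"
proof (cases "\<exists>N c. cyc N c \<and> 2 * d \<le> N")
  case True
  then obtain N c where c: "cyc N c" "2 * d \<le> N" by blast
  have N: "N < p" by (rule cyc_lt[OF c(1)])
  show ?thesis
  proof (cases "p = N + 1")
    case True
    then have "near_bipartite (N = 2 * d + 1)"
      using c p by (intro cycle_almost_longest[OF c(1)]) auto
    then have "near_bipartite (p = 2 * d + 2)" by (rule near_bipartite_mono) (use True in simp)
    then show ?thesis ..
  next
    case False
    \<comment> \<open>From \<open>2 * d \<le> N < p \<le> 2 * d + 2\<close> and
      \<open>p \<noteq> N + 1\<close> only this pair is left.\<close>
    then have eq: "N = 2 * d" "p = 2 * d + 2" using N c p by auto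
    show ?thesis
    proof (cases "\<exists>c'. cyc (2 * d + 1) c'")
      case True
      then obtain c' where "cyc (2 * d + 1) c'" by blast
      then have "near_bipartite (2 * d + 1 = 2 * d + 1)"
        using eq by (intro cycle_almost_longest) auto
      then show ?thesis using eq by simp
    next
      case False
      interpret s: short_cycle V adj d p c
        by unfold_locales (use c eq False in auto)
      show ?thesis using s.short_cycle_structure near_bipartite_mono[of False "p = 2 * d + 2"] eq by auto
    qed
  qed
next
  case False
  then have no: "\<not> cyc N c" if "2 * d \<le> N" for N c using that by blast
  \<comment> \<open>Without cycles of length at least \<open>2 * d\<close>, \<open>crossing\<close>
    rules out crossings in every longest path.\<close>
  interpret n: noncrossing V adj d p
  proof
    show "\<not> adj (last xs) (xs ! i)"
      if "path xs" "length xs = p" "i < j" "j < p" "adj (hd xs) (xs ! j)" for xs i j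
      using crossing[OF that] no by metis
  qed
  have "p = 2 * d + 1 \<or> p = 2 * d + 2" using p p_lower[OF xs] by linarith
  then show ?thesis
  proof
    assume "p = 2 * d + 1"
    from n.windmill[OF this d xs] show ?thesis by metis
  next
    assume p2: "p = 2 * d + 2"
    show ?thesis
    proof (cases "\<exists>as c bs. path (as @ c # bs) \<and> length as = d + 1 \<and> length bs = d \<and> adj (hd as) c")
      case True
      then obtain as c bs where "path (as @ c # bs)" "length as = d + 1" "length bs = d" "adj (hd as) c"
        by blast
      then have large_block
        using n.windmill_with_large_block[OF p2 d] no[OF order_refl] unfolding large_block_def by metis
      then show ?thesis using p2 by blast
    next
      case False
      then have "\<And>as c bs. path (as @ c # bs) \<Longrightarrow> length as = d + 1 \<Longrightarrow> length bs = d \<Longrightarrow> \<not> adj (hd as) c"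
        by blast
      then obtain c e U1 U2 where "adj c e" "V = {c, e} \<union> U1 \<union> U2" "U1 \<inter> U2 = {}" "U1 \<noteq> {}"
        "U2 \<noteq> {}" "c \<notin> U2" "e \<notin> U1" "cliques d U1 {c}" "cliques d U2 {e}"
        using n.two_windmills[OF p2 d xs] by blast
      then have linked_windmills unfolding linked_windmills_def by blast
      then show ?thesis using p2 by blast
    qed
  qed
qed

section \<open>Coordinates on a disjoint union of cliques\<close>

context longest begin

lemma cliques_adj_outside:
  "cliques s U K \<Longrightarrow> x \<in> U \<Longrightarrow> z \<notin> U \<Longrightarrow> adj x z \<longleftrightarrow> z \<in> K"
proof -
  assume a: "cliques s U K" "x \<in> U" "z \<notin> U"
  then obtain D where D: "D \<subseteq> U" "x \<in> D" "\<forall>y\<in>D. nb y = D \<union> K - {y}"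
    unfolding cliques_def by meson
  from D(3) D(2) have "nb x = D \<union> K - {x}" by (rule bspec)
  moreover have "z \<notin> D" "z \<noteq> x" using a D(1) by auto
  ultimately have "z \<in> nb x \<longleftrightarrow> z \<in> K" by simp
  then show ?thesis by (simp add: nb_def)
qed

lemma cliques_finite: "cliques s U K \<Longrightarrow> finite U"
  by (rule finite_subset[OF _ fin]) (auto simp: cliques_def)

text \<open>Each vertex gets the number of its clique and its position there; the induction removes
  one clique at a time.\<close>

lemma cliques_index:
  assumes "cliques s U K"
  shows "\<exists>(t::nat) g. bij_betw g U ({0..<t} \<times> {0..<s}) \<and>
    (\<forall>x\<in>U. \<forall>y\<in>U. adj x y \<longleftrightarrow> x \<noteq> y \<and> fst (g x) = fst (g y))"
  using assms
proof (induction "card U" arbitrary: U rule: less_induct)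
  case less
  note fU = cliques_finite[OF less.prems]
  show ?case
  proof (cases "U = {}")
    case True
    then show ?thesis by (intro exI[of _ 0]) (auto simp: bij_betw_def)
  next
    case False
    then obtain x where "x \<in> U" by blast
    then obtain D where D: "D \<subseteq> U" "x \<in> D" "card D = s" "\<forall>y\<in>D. nb y = D \<union> K - {y}"
      using less.prems unfolding cliques_def by meson
    note D = D(1-3) bspec[OF D(4)]
    have UK: "U \<inter> K = {}" "U \<subseteq> V" using less.prems by (auto simp: cliques_def)
    have fD: "finite D" using finite_subset[OF D(1) fU] .
    have "cliques s (U - D) K"
      unfolding cliques_def
    proof (intro conjI ballI)
      show "U - D \<subseteq> V - K" using UK by blast
      fix y assume y: "y \<in> U - D"
      then have "y \<in> U" by blast
      then obtain D' where D': "D' \<subseteq> U" "y \<in> D'" "card D' = s" "\<forall>y\<in>D'. nb y = D' \<union> K - {y}"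
        using less.prems unfolding cliques_def by meson
      note nbD' = bspec[OF D'(4)]
      \<comment> \<open>A common vertex \<open>z\<close> would have its neighbourhood determined by
        both cliques, which forces \<open>y\<close> into \<open>D\<close>.\<close>
      have "D' \<inter> D = {}"
      proof (rule ccontr)
        assume "D' \<inter> D \<noteq> {}"
        then obtain z where z: "z \<in> D" "z \<in> D'" by blast
        have "D \<union> K - {z} = D' \<union> K - {z}" using D(4)[OF z(1)] nbD'[OF z(2)] by simp
        moreover have "y \<noteq> z" "y \<notin> K" using y z UK by auto
        ultimately have "y \<in> D" using D'(2) by blast
        then show False using y by simp
      qed
      then have "D' \<subseteq> U - D" using D'(1) by blast
      then show "\<exists>E\<subseteq>U - D. y \<in> E \<and> card E = s \<and> (\<forall>y\<in>E. nb y = E \<union> K - {y})"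
        using D' by (intro exI[of _ D'] conjI)
    qed
    moreover have "card (U - D) < card U" using D(1,2) fU by (intro psubset_card_mono) auto
    ultimately obtain t :: nat and g where tg: "bij_betw g (U - D) ({0..<t} \<times> {0..<s}) \<and>
      (\<forall>x\<in>U - D. \<forall>y\<in>U - D. adj x y \<longleftrightarrow> x \<noteq> y \<and> fst (g x) = fst (g y))"
      using less.hyps by meson
    note g = conjunct1[OF tg] bspec[OF bspec[OF conjunct2[OF tg]]]
    obtain h where h: "bij_betw h D {0..<s}" using ex_bij_betw_finite_nat[OF fD] D(3) by blast
    have "bij_betw (\<lambda>x. (t, h x)) D ({t} \<times> {0..<s})"
      using h unfolding bij_betw_def inj_on_def by auto
    moreover have "{t} \<times> {0..<s} \<inter> {0..<t} \<times> {0..<s} = {}" by auto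
    ultimately have "bij_betw (\<lambda>x. if x \<in> D then (t, h x) else g x) (D \<union> (U - D)) ({t} \<times> {0..<s} \<union> {0..<t} \<times> {0..<s})"
      using g(1) by (intro bij_betw_disjoint_Un) auto
    moreover have "D \<union> (U - D) = U" using D(1) by blast
    moreover have "{t} \<times> {0..<s} \<union> {0..<t} \<times> {0..<s} = {0..<Suc t} \<times> {0..<s}" by auto
    ultimately have bij: "bij_betw (\<lambda>x. if x \<in> D then (t, h x) else g x) U ({0..<Suc t} \<times> {0..<s})"
      by simp
    have gt: "fst (g y) \<noteq> t" if "y \<in> U - D" for y
      using bij_betwE[OF g(1)] that by (auto simp: mem_Times_iff)
    have cross: "\<not> adj x y" "\<not> adj y x" if "x \<in> D" "y \<in> U - D" for x y
    proof -
      have "y \<notin> nb x" using D(4)[OF that(1)] that UK by blast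
      then show "\<not> adj x y" by (simp add: nb_def)
      then show "\<not> adj y x" using sym by blast
    qed
    have inner: "adj x y \<longleftrightarrow> x \<noteq> y" if "x \<in> D" "y \<in> D" for x y
      using D(4)[OF that(1)] that by (auto simp: nb_def set_eq_iff)
    show ?thesis
      by (intro exI[of _ "Suc t"] exI[of _ "\<lambda>x. if x \<in> D then (t, h x) else g x"] conjI bij)
        (use gt cross inner g(2) in auto)
  qed
qed

lemma cliques_clique:
  assumes "cliques s U K" "x \<in> U"
  obtains D where "x \<in> D" "D \<subseteq> U" "card D = s" "D \<inter> K = {}" "finite D"
    "\<And>y z. y \<in> D \<Longrightarrow> z \<in> D \<union> K \<Longrightarrow> y \<noteq> z \<Longrightarrow> adj y z"
proof -
  obtain D where D: "D \<subseteq> U" "x \<in> D" "card D = s" "\<forall>y\<in>D. nb y = D \<union> K - {y}"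
    using assms unfolding cliques_def by blast
  moreover have "D \<inter> K = {}" using D(1) assms(1) by (auto simp: cliques_def)
  moreover have "finite D" using finite_subset[OF D(1) cliques_finite[OF assms(1)]] .
  moreover have "adj y z" if "y \<in> D" "z \<in> D \<union> K" "y \<noteq> z" for y z
  proof -
    have "z \<in> nb y" using that D(4) by simp
    then show ?thesis by (simp add: nb_def)
  qed
  ultimately show ?thesis using that by blast
qed

end

section \<open>Isomorphisms with the named graphs\<close>

text \<open>This is \<open>G1\<close> with the clique order detached from \<open>k\<close>, since
  the locale knows only \<open>d\<close>.\<close>

definition windmill :: "nat \<Rightarrow> nat \<Rightarrow> (nat + nat \<times> nat) graph" where
  "windmill s t = join (complete_graph 1) (copies t (complete_graph s))"

lemma edge_complete: "{u, v} \<in> edges (complete_graph m) \<longleftrightarrow> u < m \<and> v < m \<and> u \<noteq> v"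
  by (auto simp: complete_graph_def doubleton_eq_iff)

lemma edge_empty: "e \<notin> edges (empty_graph m)"
  by (simp add: empty_graph_def)

lemma inj_image_doubleton: "inj f \<Longrightarrow> {f u, f v} = f ` e \<longleftrightarrow> e = {u, v}"
  by (metis image_empty image_insert inj_image_eq_iff)

lemma Inl_image_doubleton: "{Inl u, Inl v} = Inl ` e \<longleftrightarrow> e = {u, v}"
  by (rule inj_image_doubleton) simp

lemma Inr_image_doubleton: "{Inr u, Inr v} = Inr ` e \<longleftrightarrow> e = {u, v}"
  by (rule inj_image_doubleton) simp

lemma edge_disj_union:
  "{Inl u, Inl v} \<in> edges (disj_union G H) \<longleftrightarrow> {u, v} \<in> edges G"
  "{Inr x, Inr y} \<in> edges (disj_union G H) \<longleftrightarrow> {x, y} \<in> edges H"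
  "{Inl u, Inr x} \<notin> edges (disj_union G H)"
  "{Inr x, Inl u} \<notin> edges (disj_union G H)"
  by (auto simp: disj_union_def image_iff Inl_image_doubleton Inr_image_doubleton)

lemma verts_disj_union: "verts (disj_union G H) = Inl ` verts G \<union> Inr ` verts H"
  by (simp add: disj_union_def)

lemma verts_join: "verts (join G H) = Inl ` verts G \<union> Inr ` verts H"
  by (simp add: join_def disj_union_def)

lemma edge_join:
  "{Inl u, Inl v} \<in> edges (join G H) \<longleftrightarrow> {u, v} \<in> edges G"
  "{Inr x, Inr y} \<in> edges (join G H) \<longleftrightarrow> {x, y} \<in> edges H"
  "{Inl u, Inr x} \<in> edges (join G H) \<longleftrightarrow> u \<in> verts G \<and> x \<in> verts H"
  "{Inr x, Inl u} \<in> edges (join G H) \<longleftrightarrow> u \<in> verts G \<and> x \<in> verts H"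
  using edge_disj_union[where G = G and H = H] by (auto simp: join_def doubleton_eq_iff)

lemma edge_copies:
  "{(i, a), (j, b)} \<in> edges (copies t G) \<longleftrightarrow> i = j \<and> i < t \<and> {a, b} \<in> edges G"
proof
  assume "{(i, a), (j, b)} \<in> edges (copies t G)"
  then obtain l e where le: "{(i, a), (j, b)} = (\<lambda>x. (l, x)) ` e" "l < t" "e \<in> edges G"
    by (auto simp: copies_def)
  then have "(i, a) \<in> (\<lambda>x. (l, x)) ` e" "(j, b) \<in> (\<lambda>x. (l, x)) ` e" by blast+
  then have ij: "i = l" "j = l" by auto
  have "inj (\<lambda>x. (l, x))" by (simp add: inj_def)
  then have "e = {a, b}" using le(1) ij inj_image_doubleton[of "\<lambda>x. (l, x)" a b e] by simp
  then show "i = j \<and> i < t \<and> {a, b} \<in> edges G" using le ij by simp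
next
  assume a: "i = j \<and> i < t \<and> {a, b} \<in> edges G"
  then have "{(i, a), (j, b)} = (\<lambda>x. (i, x)) ` {a, b}" by simp
  then show "{(i, a), (j, b)} \<in> edges (copies t G)" using a unfolding copies_def
    by (simp only: snd_conv mem_Collect_eq) blast
qed

lemma verts_windmill: "verts (windmill s t) = insert (Inl 0) (Inr ` ({0..<t} \<times> {0..<s}))"
  by (auto simp: windmill_def verts_join complete_graph_def copies_def)

lemma edge_windmill:
  "{Inl u, Inl v} \<notin> edges (windmill s t)"
  "{Inr x, Inr y} \<in> edges (windmill s t) \<longleftrightarrow>
    x \<in> {0..<t} \<times> {0..<s} \<and> y \<in> {0..<t} \<times> {0..<s} \<and> x \<noteq> y \<and> fst x = fst y"
  "{Inl u, Inr x} \<in> edges (windmill s t) \<longleftrightarrow> u = 0 \<and> x \<in> {0..<t} \<times> {0..<s}"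
  "{Inr x, Inl u} \<in> edges (windmill s t) \<longleftrightarrow> u = 0 \<and> x \<in> {0..<t} \<times> {0..<s}"
proof -
  show "{Inl u, Inl v} \<notin> edges (windmill s t)"
    by (auto simp: windmill_def edge_join edge_complete)
  show "{Inr x, Inr y} \<in> edges (windmill s t) \<longleftrightarrow>
    x \<in> {0..<t} \<times> {0..<s} \<and> y \<in> {0..<t} \<times> {0..<s} \<and> x \<noteq> y \<and> fst x = fst y"
    by (cases x; cases y) (auto simp: windmill_def edge_join edge_copies edge_complete)
qed (auto simp: windmill_def edge_join copies_def complete_graph_def)

lemma G1_windmill: "G1 k t = windmill (delta k) t"
  by (simp add: G1_def windmill_def)

lemma bij_betw_inj_image: "bij_betw g A B \<Longrightarrow> inj h \<Longrightarrow> bij_betw (\<lambda>x. h (g x)) A (h ` B)"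
  unfolding bij_betw_def by (auto simp: inj_on_def inj_def)

text \<open>The bijection is kept explicit, with the centre at \<open>Inl 0\<close>, so that
  windmills can be glued to each other or to a star.\<close>

definition (in longest) windmill_bij :: "nat \<Rightarrow> 'a set \<Rightarrow> 'a \<Rightarrow> ('a \<Rightarrow> nat + nat \<times> nat) \<Rightarrow> nat \<Rightarrow> bool" where
  "windmill_bij s U c f t \<longleftrightarrow> bij_betw f (insert c U) (verts (windmill s t)) \<and> f c = Inl 0 \<and>
    (\<forall>x\<in>U. f x \<noteq> Inl 0) \<and> card U = t * s \<and>
    (\<forall>x\<in>insert c U. \<forall>y\<in>insert c U. adj x y \<longleftrightarrow> {f x, f y} \<in> edges (windmill s t))"

lemma (in longest) windmill_bijD:
  assumes "windmill_bij s U c f t"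
  shows "bij_betw f (insert c U) (verts (windmill s t))" "f c = Inl 0"
    "\<And>x. x \<in> U \<Longrightarrow> f x \<noteq> Inl 0" "card U = t * s"
    "\<And>x y. x \<in> insert c U \<Longrightarrow> y \<in> insert c U \<Longrightarrow> adj x y \<longleftrightarrow> {f x, f y} \<in> edges (windmill s t)"
  using assms unfolding windmill_bij_def by blast+

lemma (in longest) windmill_map:
  assumes "cliques s U {c}"
  shows "\<exists>f t. windmill_bij s U c f t"
proof -
  obtain t :: nat and g where g: "bij_betw g U ({0..<t} \<times> {0..<s})"
    "\<forall>x\<in>U. \<forall>y\<in>U. adj x y \<longleftrightarrow> x \<noteq> y \<and> fst (g x) = fst (g y)"
    using cliques_index[OF assms] by blast
  have cU: "c \<notin> U" using assms by (auto simp: cliques_def)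
  define f where "f = (\<lambda>x. if x \<in> U then Inr (g x) else Inl 0 :: nat + nat \<times> nat)"
  have "bij_betw (\<lambda>x. Inr (g x)) U (Inr ` ({0..<t} \<times> {0..<s}))"
    by (rule bij_betw_inj_image[OF g(1)]) simp
  moreover have "bij_betw (\<lambda>x. Inl 0) {c} {Inl 0}" by (simp add: bij_betw_def)
  ultimately have "bij_betw f (U \<union> {c}) (Inr ` ({0..<t} \<times> {0..<s}) \<union> {Inl 0})"
    unfolding f_def using cU by (intro bij_betw_disjoint_Un) auto
  then have bij: "bij_betw f (insert c U) (verts (windmill s t))" by (simp add: verts_windmill)
  have gm: "g x \<in> {0..<t} \<times> {0..<s}" if "x \<in> U" for x using bij_betwE[OF g(1)] that by blast
  have inj: "g x = g y \<longleftrightarrow> x = y" if "x \<in> U" "y \<in> U" for x y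
    using that bij_betw_imp_inj_on[OF g(1)] by (auto simp: inj_on_def)
  have ac: "adj x c" "adj c x" if "x \<in> U" for x
    using cliques_adj_outside[OF assms that cU] sym by auto
  have fx: "f x = Inr (g x)" if "x \<in> U" for x using that by (simp add: f_def)
  have fc: "f c = Inl 0" using cU by (simp add: f_def)
  have "adj x y \<longleftrightarrow> {f x, f y} \<in> edges (windmill s t)" if xy: "x \<in> insert c U" "y \<in> insert c U" for x y
  proof -
    consider "x \<in> U" "y \<in> U" | "x \<in> U" "y = c" | "x = c" "y \<in> U" | "x = c" "y = c" using xy by blast
    then show ?thesis
    proof cases
      case 1
      then show ?thesis using bspec[OF bspec[OF g(2)] 1(2)] gm[OF 1(1)] gm[OF 1(2)] inj[OF 1]
        by (simp only: fx edge_windmill) blast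
    next
      case 2
      then show ?thesis using ac(1)[OF 2(1)] gm[OF 2(1)] by (simp only: fx fc edge_windmill) simp
    next
      case 3
      then show ?thesis using ac(2)[OF 3(2)] gm[OF 3(2)] by (simp only: fx fc edge_windmill) simp
    next
      case 4
      have "\<not> adj c c" by (rule irr)
      then show ?thesis by (simp only: 4 fc edge_windmill)
    qed
  qed
  moreover have "card U = t * s" using bij_betw_same_card[OF g(1)] by simp
  moreover have "f x \<noteq> Inl 0" if "x \<in> U" for x using fx[OF that] by simp
  ultimately show ?thesis unfolding windmill_bij_def using bij fc by blast
qed

section \<open>Recognising the named graphs\<close>

context longest begin

text \<open>Isomorphism for the graph given by \<open>V\<close> and \<open>adj\<close>, since the
  locale has no pair of vertex and edge sets; \<open>embeds\<close> is the analogue for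
  subgraphs.\<close>

definition models :: "'b graph \<Rightarrow> bool" where
  "models H \<longleftrightarrow> (\<exists>f. bij_betw f V (verts H) \<and> (\<forall>x\<in>V. \<forall>y\<in>V. adj x y \<longleftrightarrow> {f x, f y} \<in> edges H))"

definition embeds :: "'b graph \<Rightarrow> bool" where
  "embeds H \<longleftrightarrow> (\<exists>f. inj_on f V \<and> f ` V \<subseteq> verts H \<and> (\<forall>x y. adj x y \<longrightarrow> {f x, f y} \<in> edges H))"

definition has_clique :: "nat \<Rightarrow> bool" where
  "has_clique r \<longleftrightarrow> (\<exists>Q\<subseteq>V. card Q = r \<and> (\<forall>x\<in>Q. \<forall>y\<in>Q. x \<noteq> y \<longrightarrow> adj x y))"

lemma glue_models:
  assumes V: "V = A \<union> B" "A \<inter> B = {}"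
    and f: "bij_betw f A (verts F)" "bij_betw g B (verts G)" and H: "verts H = Inl ` verts F \<union> Inr ` verts G"
    and AA: "\<And>x y. x \<in> A \<Longrightarrow> y \<in> A \<Longrightarrow> adj x y \<longleftrightarrow> {Inl (f x), Inl (f y)} \<in> edges H"
    and BB: "\<And>x y. x \<in> B \<Longrightarrow> y \<in> B \<Longrightarrow> adj x y \<longleftrightarrow> {Inr (g x), Inr (g y)} \<in> edges H"
    and AB: "\<And>x y. x \<in> A \<Longrightarrow> y \<in> B \<Longrightarrow> adj x y \<longleftrightarrow> {Inl (f x), Inr (g y)} \<in> edges H"
  shows "models H"
proof -
  define h where "h = (\<lambda>x. if x \<in> A then Inl (f x) else Inr (g x))"
  have bij: "bij_betw h V (verts H)"
    unfolding h_def V(1) H using V(2) bij_betw_inj_image[OF f(1), of Inl] bij_betw_inj_image[OF f(2), of Inr]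
    by (intro bij_betw_disjoint_Un) auto
  have l: "h x = Inl (f x)" if "x \<in> A" for x unfolding h_def if_P[OF that] ..
  have r: "h x = Inr (g x)" if "x \<in> B" for x
  proof -
    have "x \<notin> A" using that V(2) by blast
    then show ?thesis unfolding h_def by (rule if_not_P)
  qed
  have "adj x y \<longleftrightarrow> {h x, h y} \<in> edges H" if xy: "x \<in> V" "y \<in> V" for x y
  proof -
    consider "x \<in> A" "y \<in> A" | "x \<in> B" "y \<in> B" | "x \<in> A" "y \<in> B" | "x \<in> B" "y \<in> A"
      using xy V(1) by blast
    then show ?thesis
    proof cases
      case 4
      show ?thesis using AB[OF 4(2,1)] unfolding r[OF 4(1)] l[OF 4(2)] adj_commute[of x y]
        by (simp only: insert_commute)
    qed (simp_all only: l r AA BB AB)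
  qed
  then show ?thesis unfolding models_def using bij by blast
qed

text \<open>One clique of \<open>U\<close> together with a clique \<open>L\<close> inside
  \<open>K\<close>; all lower bounds on \<open>m\<close> come from here.\<close>

lemma cliques_has_clique:
  assumes "cliques s U K" "U \<noteq> {}" "L \<subseteq> K \<inter> V" "\<And>x y. x \<in> L \<Longrightarrow> y \<in> L \<Longrightarrow> x \<noteq> y \<Longrightarrow> adj x y"
  shows "has_clique (s + card L)"
proof -
  obtain x where "x \<in> U" using assms(2) by blast
  then obtain D where D: "D \<subseteq> U" "card D = s" "D \<inter> K = {}" "finite D"
    "\<And>y z. y \<in> D \<Longrightarrow> z \<in> D \<union> K \<Longrightarrow> y \<noteq> z \<Longrightarrow> adj y z"
    using cliques_clique[OF assms(1)] by metis
  have "finite L" using assms(3) finite_subset[OF _ fin] by blast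
  moreover have "D \<inter> L = {}" using D(3) assms(3) by blast
  ultimately have "card (D \<union> L) = s + card L" using D(2,4) by (simp add: card_Un_disjoint)
  moreover have "D \<union> L \<subseteq> V" using D(1) assms(1,3) by (auto simp: cliques_def)
  moreover have "adj y z" if yz: "y \<in> D \<union> L" "z \<in> D \<union> L" "y \<noteq> z" for y z
  proof -
    consider "y \<in> D" | "z \<in> D" | "y \<in> L" "z \<in> L" using yz by blast
    then show ?thesis
    proof cases
      case 1
      then show ?thesis using D(5) yz assms(3) by (metis Un_iff le_inf_iff subsetD)
    next
      case 2
      then have "adj z y" using D(5) yz assms(3) by (metis Un_iff le_inf_iff subsetD)
      then show ?thesis by (rule sym)
    next
      case 3
      then show ?thesis using assms(4) yz(3) by blast
    qed
  qed
  ultimately show ?thesis unfolding has_clique_def by blast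
qed

lemma windmill_models:
  assumes c: "c \<in> V" and cl: "cliques d (V - {c}) {c}"
  obtains t where "models (windmill d t)" "card V = 1 + t * d"
proof -
  from windmill_map[OF cl] obtain f t where "windmill_bij d (V - {c}) c f t" by blast
  note f = windmill_bijD[OF this]
  have V: "insert c (V - {c}) = V" using c by blast
  have "models (windmill d t)" unfolding models_def using f(1,5) unfolding V by blast
  moreover have "card V = 1 + t * d" using f(4) c fin by (metis card_Suc_Diff1 plus_1_eq_Suc)
  ultimately show ?thesis by (rule that)
qed

lemma linked_windmills_models:
  assumes linked_windmills
  obtains t1 t2 where "1 \<le> t1" "1 \<le> t2" "card V = (1 + t1 * d) + (1 + t2 * d)"
    "models (add_edges (disj_union (windmill d t1) (windmill d t2)) {{Inl (Inl 0), Inr (Inl 0)}})"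
proof -
  obtain c e U1 U2 where u: "adj c e" "V = {c, e} \<union> U1 \<union> U2" "U1 \<inter> U2 = {}" "U1 \<noteq> {}" "U2 \<noteq> {}"
    "c \<notin> U2" "e \<notin> U1" and cl: "cliques d U1 {c}" "cliques d U2 {e}"
    using assms unfolding linked_windmills_def by blast
  from windmill_map[OF cl(1)] obtain f1 t1 where "windmill_bij d U1 c f1 t1" by blast
  note f1 = windmill_bijD[OF this]
  from windmill_map[OF cl(2)] obtain f2 t2 where "windmill_bij d U2 e f2 t2" by blast
  note f2 = windmill_bijD[OF this]
  have ce: "c \<noteq> e" by (rule adj_neq[OF u(1)])
  have cU: "c \<notin> U1" "e \<notin> U2" using cl by (auto simp: cliques_def)
  have fU: "finite U1" "finite U2" using cl cliques_finite by blast+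
  have dj: "insert c U1 \<inter> insert e U2 = {}" using u(3,6,7) ce by auto
  have V: "insert c U1 \<union> insert e U2 = V" using u(2) by auto
  let ?H = "add_edges (disj_union (windmill d t1) (windmill d t2)) {{Inl (Inl 0), Inr (Inl 0)}}"
  have eH: "{Inl x, Inl y} \<in> edges ?H \<longleftrightarrow> {x, y} \<in> edges (windmill d t1)"
    "{Inr x', Inr y'} \<in> edges ?H \<longleftrightarrow> {x', y'} \<in> edges (windmill d t2)"
    "{Inl x, Inr x'} \<in> edges ?H \<longleftrightarrow> x = Inl 0 \<and> x' = Inl 0" for x y x' y'
    by (auto simp: add_edges_def edge_disj_union doubleton_eq_iff)
  \<comment> \<open>Outside itself \<open>U1\<close> sees only \<open>c\<close> and
    \<open>U2\<close> only \<open>e\<close>, so the edge from \<open>c\<close> to \<open>e\<close>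
    is the only one across.\<close>
  have cross: "adj x y \<longleftrightarrow> f1 x = Inl 0 \<and> f2 y = Inl 0" if x: "x \<in> insert c U1" and y: "y \<in> insert e U2" for x y
  proof -
    have "f1 x = Inl 0 \<longleftrightarrow> x = c" using x f1(2,3) cU by auto
    moreover have "f2 y = Inl 0 \<longleftrightarrow> y = e" using y f2(2,3) cU by auto
    moreover have "adj x y \<longleftrightarrow> x = c \<and> y = e"
    proof (cases "x = c")
      case True
      have "\<not> adj y c" if "y \<in> U2" using cliques_adj_outside[OF cl(2) that u(6)] ce by simp
      then show ?thesis using True y u(1) adj_commute[of c y] by auto
    next
      case False
      then have "x \<in> U1" using x by simp
      moreover have "y \<notin> U1" using y u(3,7) by auto
      ultimately have "adj x y \<longleftrightarrow> y \<in> {c}" by (rule cliques_adj_outside[OF cl(1)])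
      then show ?thesis using False y ce u(6) by auto
    qed
    ultimately show ?thesis by simp
  qed
  have "models ?H"
  proof (rule glue_models[OF V[symmetric] dj f1(1) f2(1)])
    show "verts ?H = Inl ` verts (windmill d t1) \<union> Inr ` verts (windmill d t2)"
      by (simp add: add_edges_def verts_disj_union)
  qed (simp_all only: eH f1(5) f2(5) cross)
  moreover have "1 \<le> t1" "1 \<le> t2" using u(4,5) f1(4) f2(4) fU by (cases t1; cases t2; auto)+
  moreover have "card V = (1 + t1 * d) + (1 + t2 * d)"
  proof -
    have "card V = card (insert c U1) + card (insert e U2)"
      unfolding V[symmetric] using dj fU by (intro card_Un_disjoint) auto
    then show ?thesis using cU fU f1(4) f2(4) by simp
  qed
  ultimately show ?thesis using that by blast
qed

lemma bipartite_block_models: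
  assumes bipartite_block and d: "d = 2"
  obtains t s where "1 \<le> t" "2 \<le> s" "card V = 2 + s + 2 * t" "models (G4 t s) \<or> models (G5 t s)"
proof -
  obtain a b T U where u: "a \<noteq> b" "V = {a, b} \<union> T \<union> U" "a \<notin> T \<union> U" "b \<notin> T \<union> U" "T \<inter> U = {}"
    "2 \<le> card T" "U \<noteq> {}" "\<forall>t\<in>T. nb t = {a, b}" and cl: "cliques d U {a}"
    using assms(1) unfolding bipartite_block_def by blast
  from windmill_map[OF cl] obtain f1 t where "windmill_bij d U a f1 t" by blast
  note f1 = windmill_bijD[OF this]
  have fT: "finite T" "finite U" using u(2) fin by auto
  define s where "s = card T"
  obtain h where h: "bij_betw h T {0..<s}" using ex_bij_betw_finite_nat[OF fT(1)] by (auto simp: s_def)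
  define f2 where "f2 = (\<lambda>x. if x \<in> T then Inr (h x) else (Inl 0 :: nat + nat))"
  have "bij_betw f2 (T \<union> {b}) (Inr ` {0..<s} \<union> {Inl 0})"
    unfolding f2_def using bij_betw_inj_image[OF h, of Inr] u(4)
    by (intro bij_betw_disjoint_Un) (auto simp: bij_betw_def)
  moreover have "verts (star s) = Inr ` {0..<s} \<union> {Inl 0}"
    by (auto simp: star_def verts_join complete_graph_def empty_graph_def)
  ultimately have f2: "bij_betw f2 (T \<union> {b}) (verts (star s))" by simp
  \<comment> \<open>Only the pair \<open>a\<close>, \<open>b\<close> is undetermined, and the
    conditional selects \<open>G5\<close> or \<open>G4\<close> accordingly.\<close>
  define H where "H = add_edges (disj_union (windmill d t) (star s))
    ({{Inl (Inl 0), Inr (Inr j)} | j. j < s} \<union> (if adj a b then {{Inl (Inl 0), Inr (Inl 0)}} else {}))"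
  have HH: "H = (if adj a b then G5 t s else G4 t s)"
    using d by (simp add: H_def G4_def G5_def G1_windmill delta_def)
  have dj: "insert a U \<inter> (T \<union> {b}) = {}" using u(1,3,4,5) by auto
  have V: "insert a U \<union> (T \<union> {b}) = V" using u(2) by auto
  have star: "{Inl x, Inl y} \<notin> edges (star s)" "{Inr i, Inr j} \<notin> edges (star s)"
    "{Inl x, Inr i} \<in> edges (star s) \<longleftrightarrow> x = 0 \<and> i < s"
    "{Inr i, Inl x} \<in> edges (star s) \<longleftrightarrow> x = 0 \<and> i < s" for x y i j
    by (auto simp: star_def edge_join edge_complete edge_empty) (auto simp: complete_graph_def empty_graph_def)
  have eH: "{Inl x, Inl y} \<in> edges H \<longleftrightarrow> {x, y} \<in> edges (windmill d t)"
    "{Inr x', Inr y'} \<in> edges H \<longleftrightarrow> {x', y'} \<in> edges (star s)"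
    "{Inl x, Inr x'} \<in> edges H \<longleftrightarrow> x = Inl 0 \<and> ((\<exists>j<s. x' = Inr j) \<or> adj a b \<and> x' = Inl 0)" for x y x' y'
    by (auto simp: H_def add_edges_def edge_disj_union doubleton_eq_iff)
  have hs: "h x < s" if "x \<in> T" for x using bij_betwE[OF h] that by auto
  have fT2: "f2 x = Inr (h x)" if "x \<in> T" for x using that by (simp add: f2_def)
  have fb: "f2 b = Inl 0" using u(4) by (simp add: f2_def)
  have aT: "adj x y \<longleftrightarrow> y = a \<or> y = b" if "x \<in> T" for x y
    using bspec[OF u(8) that] by (auto simp: nb_def set_eq_iff)
  have T2: "adj x y \<longleftrightarrow> {f2 x, f2 y} \<in> edges (star s)" if xy: "x \<in> T \<union> {b}" "y \<in> T \<union> {b}" for x y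
  proof -
    consider "x \<in> T" "y \<in> T" | "x \<in> T" "y = b" | "x = b" "y \<in> T" | "x = b" "y = b" using xy by blast
    then show ?thesis
    proof cases
      case 1
      then have "y \<noteq> a" "y \<noteq> b" using u(3,4) by auto
      then show ?thesis using aT[OF 1(1)] by (simp add: fT2[OF 1(1)] fT2[OF 1(2)] star)
    next
      case 2
      then show ?thesis using aT[OF 2(1)] hs[OF 2(1)] by (simp add: fT2[OF 2(1)] fb star)
    next
      case 3
      then show ?thesis using aT[OF 3(2)] hs[OF 3(2)] adj_commute[of b y] by (simp add: fT2[OF 3(2)] fb star)
    next
      case 4
      have "\<not> adj b b" by (rule irr)
      then show ?thesis by (simp only: 4 fb star)
    qed
  qed
  have cross: "adj x y \<longleftrightarrow> f1 x = Inl 0 \<and> ((\<exists>j<s. f2 y = Inr j) \<or> adj a b \<and> f2 y = Inl 0)"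
    if x: "x \<in> insert a U" and y: "y \<in> T \<union> {b}" for x y
  proof (cases "x = a")
    case True
    show ?thesis
    proof (cases "y = b")
      case True
      then show ?thesis using \<open>x = a\<close> f1(2) fb by simp
    next
      case False
      then have yT: "y \<in> T" using y by simp
      then show ?thesis using \<open>x = a\<close> f1(2) fT2[OF yT] hs[OF yT] aT[OF yT, of a] adj_commute[of a y] by simp
    qed
  next
    case False
    then have xU: "x \<in> U" using x by simp
    moreover have "y \<notin> U" using y u(4,5) by auto
    ultimately have "adj x y \<longleftrightarrow> y \<in> {a}" by (rule cliques_adj_outside[OF cl])
    moreover have "y \<noteq> a" using y u(1,3) by auto
    ultimately show ?thesis using f1(3)[OF xU] by simp
  qed
  have "models H"
  proof (rule glue_models[OF V[symmetric] dj f1(1) f2])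
    show "verts H = Inl ` verts (windmill d t) \<union> Inr ` verts (star s)"
      by (simp add: H_def add_edges_def verts_disj_union)
  qed (simp_all only: eH f1(5) T2 cross)
  then have "models (G4 t s) \<or> models (G5 t s)" using HH by (cases "adj a b") auto
  moreover have "1 \<le> t" using u(7) f1(4) fT by (cases t) auto
  moreover have "card V = 2 + s + 2 * t"
  proof -
    have "card V = card (insert a U) + card (T \<union> {b})"
      unfolding V[symmetric] using dj fT by (intro card_Un_disjoint) auto
    then show ?thesis using fT f1(4) u(3,4) d by (simp add: s_def)
  qed
  ultimately show ?thesis using that u(6) by (simp add: s_def)
qed

lemma matching_join_models:
  assumes ab: "a \<in> V" "b \<in> V" "a \<noteq> b" and cl: "cliques 2 (V - {a, b}) {a, b}"
  obtains t where "card V = 2 + 2 * t"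
    "models (join (if adj a b then complete_graph 2 else empty_graph 2) (copies t (complete_graph 2)))"
proof -
  let ?U = "V - {a, b}"
  let ?K = "if adj a b then complete_graph 2 else empty_graph 2"
  obtain t :: nat and g where g: "bij_betw g ?U ({0..<t} \<times> {0..<2::nat})"
    "\<forall>x\<in>?U. \<forall>y\<in>?U. adj x y \<longleftrightarrow> x \<noteq> y \<and> fst (g x) = fst (g y)"
    using cliques_index[OF cl] by blast
  let ?H = "join ?K (copies t (complete_graph 2))"
  define k where "k = (\<lambda>x. if x = a then 0 else (1::nat))"
  have k: "bij_betw k {a, b} (verts ?K)"
    using ab(3) by (auto simp: k_def bij_betw_def complete_graph_def empty_graph_def)
  have g': "bij_betw g ?U (verts (copies t (complete_graph 2)))"
    using g(1) by (simp add: copies_def complete_graph_def)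
  have V: "V = {a, b} \<union> ?U" "{a, b} \<inter> ?U = {}" using ab by auto
  have kab: "k a = 0" "k b = 1" using ab(3) by (auto simp: k_def)
  have gm: "g x \<in> {0..<t} \<times> {0..<2}" if "x \<in> ?U" for x using bij_betwE[OF g(1)] that by blast
  have inj: "g x = g y \<longleftrightarrow> x = y" if "x \<in> ?U" "y \<in> ?U" for x y
    using that bij_betw_imp_inj_on[OF g(1)] unfolding inj_on_def by blast
  have eH: "{Inr x, Inr y} \<in> edges ?H \<longleftrightarrow> x \<in> {0..<t} \<times> {0..<2} \<and> y \<in> {0..<t} \<times> {0..<2} \<and> x \<noteq> y \<and> fst x = fst y"
    "{Inl i, Inr x} \<in> edges ?H \<longleftrightarrow> i < 2 \<and> x \<in> {0..<t} \<times> {0..<2}"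
    "{Inl i, Inl j} \<in> edges ?H \<longleftrightarrow> adj a b \<and> i < 2 \<and> j < 2 \<and> i \<noteq> j" for x y i j
    by (cases x; cases y; auto simp: edge_join edge_copies edge_complete edge_empty)
      (auto simp: edge_join complete_graph_def empty_graph_def copies_def doubleton_eq_iff)
  have out: "adj y x" if "x \<in> ?U" "y \<in> {a, b}" for x y
    using cliques_adj_outside[OF cl that(1), of y] that(2) sym by auto
  have "models ?H"
  proof (rule glue_models[OF V k g' verts_join])
    fix x y
    show "adj x y \<longleftrightarrow> {Inr (g x), Inr (g y)} \<in> edges ?H" if xy: "x \<in> ?U" "y \<in> ?U"
      unfolding eH using bspec[OF bspec[OF g(2) xy(1)] xy(2)] gm[OF xy(1)] gm[OF xy(2)] inj[OF xy] by blast
    show "adj x y \<longleftrightarrow> {Inl (k x), Inr (g y)} \<in> edges ?H" if xy: "x \<in> {a, b}" "y \<in> ?U"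
    proof -
      have "k x < 2" using xy(1) by (simp add: k_def)
      then show ?thesis unfolding eH using gm[OF xy(2)] out[OF xy(2,1)] by blast
    qed
    show "adj x y \<longleftrightarrow> {Inl (k x), Inl (k y)} \<in> edges ?H" if xy: "x \<in> {a, b}" "y \<in> {a, b}"
    proof -
      have n: "\<not> adj a a" "\<not> adj b b" "adj b a \<longleftrightarrow> adj a b" using irr adj_commute by auto
      from xy consider "x = a" "y = a" | "x = a" "y = b" | "x = b" "y = a" | "x = b" "y = b" by blast
      then show ?thesis by cases (simp_all only: kab eH n, simp_all)
    qed
  qed
  moreover have "card V = 2 + 2 * t"
  proof -
    have "card V = card ?U + card {a, b}"
      using card_Un_disjoint[of "{a, b}" ?U] fin V by auto
    then show ?thesis using bij_betw_same_card[OF g(1)] ab(3) by simp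
  qed
  ultimately show ?thesis using that by blast
qed

end

section \<open>Complete subgraphs, Hamiltonian blocks and the graphs \<open>G3\<close>\<close>

lemma complete_subgraph_clique:
  assumes "subgraph_of (complete_graph m) H"
  obtains Q where "Q \<subseteq> verts H" "card Q = m" "\<And>x y. x \<in> Q \<Longrightarrow> y \<in> Q \<Longrightarrow> x \<noteq> y \<Longrightarrow> {x, y} \<in> edges H"
proof -
  obtain f where f: "inj_on f {0..<m}" "f ` {0..<m} \<subseteq> verts H" "\<And>e. e \<in> edges (complete_graph m) \<Longrightarrow> f ` e \<in> edges H"
    using assms by (auto simp: subgraph_of_def complete_graph_def)
  have ed: "{f i, f j} \<in> edges H" if "i < m" "j < m" "i \<noteq> j" for i j
    using f(3)[of "{i, j}"] that by (simp add: edge_complete)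
  have "{x, y} \<in> edges H" if xy: "x \<in> f ` {0..<m}" "y \<in> f ` {0..<m}" "x \<noteq> y" for x y
  proof -
    obtain i j where "i < m" "j < m" "x = f i" "y = f j" using xy(1,2) by auto
    then show ?thesis using ed xy(3) by metis
  qed
  moreover have "card (f ` {0..<m}) = m" using f(1) by (simp add: card_image)
  ultimately show ?thesis using that[of "f ` {0..<m}"] f(2) by blast
qed

lemma clique_complete_subgraph:
  assumes "finite Q" "Q \<subseteq> verts H" "m \<le> card Q" "\<And>x y. x \<in> Q \<Longrightarrow> y \<in> Q \<Longrightarrow> x \<noteq> y \<Longrightarrow> {x, y} \<in> edges H"
  shows "subgraph_of (complete_graph m) H"
proof -
  obtain h where h: "bij_betw h {0..<card Q} Q" using ex_bij_betw_nat_finite[OF assms(1)] by blast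
  have inj: "inj_on h {0..<m}" by (rule inj_on_subset[OF bij_betw_imp_inj_on[OF h]]) (use assms(3) in auto)
  have hQ: "h i \<in> Q" if "i < m" for i using bij_betwE[OF h] that assms(3) by auto
  have "h ` e \<in> edges H" if e: "e \<in> edges (complete_graph m)" for e
  proof -
    obtain i j where ij: "e = {i, j}" "i < m" "j < m" "i \<noteq> j"
      using e unfolding complete_graph_def snd_conv by blast
    then have "h i \<noteq> h j" using inj by (auto simp: inj_on_def)
    then show ?thesis using assms(4)[OF hQ[OF ij(2)] hQ[OF ij(3)]] ij(1) by simp
  qed
  moreover have "h ` {0..<m} \<subseteq> verts H" using hQ assms(2) by auto
  moreover have "verts (complete_graph m) = {0..<m}" by (simp add: complete_graph_def)
  ultimately show ?thesis unfolding subgraph_of_def using inj by (intro exI[of _ h]) simp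
qed

lemma consecutive_rtrancl:
  assumes "i \<le> j" "\<And>l::int. i \<le> l \<Longrightarrow> l < j \<Longrightarrow> (c l, c (l + 1)) \<in> R"
  shows "(c i, c j) \<in> R\<^sup>*"
  using assms
proof (induction j rule: int_ge_induct)
  case (step j)
  then have "(c i, c j) \<in> R\<^sup>*" "(c j, c (j + 1)) \<in> R" by auto
  then show ?case by (rule rtrancl_into_rtrancl)
qed simp

text \<open>Removing \<open>c s\<close> leaves the vertices with indices from \<open>s + 1\<close>
  to \<open>s + N - 1\<close>, still linked consecutively, so no vertex of a Hamiltonian cycle is a
  cut vertex.\<close>

lemma Hamiltonian_connected:
  fixes c :: "int \<Rightarrow> 'b"
  assumes V: "verts H = range c" and N: "0 < N"
    and per: "\<And>i j. c i = c j \<longleftrightarrow> i mod int N = j mod int N"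
    and adj: "\<And>i. {c i, c (i + 1)} \<in> edges H"
  shows "connected_graph H" "no_cut_vertex H"
proof -
  have flip: "(y, x) \<in> (adj_rel F)\<^sup>*" if "(x, y) \<in> (adj_rel F)\<^sup>*" for F :: "'b graph" and x y
  proof -
    have "(adj_rel F)\<inverse> = adj_rel F" by (auto simp: adj_rel_def insert_commute)
    then show ?thesis using that rtrancl_converseI by metis
  qed
  have link: "(c i, c j) \<in> (adj_rel F)\<^sup>*"
    if F: "\<And>l. a \<le> l \<Longrightarrow> l < b \<Longrightarrow> {c l, c (l + 1)} \<in> edges F"
      and ij: "a \<le> i" "i \<le> b" "a \<le> j" "j \<le> b" for F :: "'b graph" and a b i j
  proof -
    have up: "(c i, c j) \<in> (adj_rel F)\<^sup>*" if "a \<le> i" "i \<le> j" "j \<le> b" for i j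
      using that F by (intro consecutive_rtrancl) (auto simp: adj_rel_def)
    show ?thesis using up[of i j] up[of j i] flip ij by (cases "i \<le> j") auto
  qed
  show "connected_graph H"
    unfolding connected_graph_def V
  proof (intro ballI)
    fix u v assume "u \<in> range c" "v \<in> range c"
    then obtain i j where "u = c i" "v = c j" by blast
    then show "(u, v) \<in> (adj_rel H)\<^sup>*"
      using link[where F = H, of "min i j" "max i j" i j] adj by auto
  qed
  show "no_cut_vertex H"
    unfolding no_cut_vertex_def V
  proof
    fix v assume "v \<in> range c"
    then obtain s where s: "v = c s" by blast
    have window: "\<exists>i. u = c i \<and> s + 1 \<le> i \<and> i \<le> s + int N - 1" if u: "u \<in> range c - {v}" for u
    proof -
      obtain i where i: "u = c i" using u by blast
      define j where "j = s + (i - s) mod int N"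
      have "(i - s) mod int N \<noteq> 0"
        using u i s per[of i s] by (auto simp: mod_eq_dvd_iff dvd_eq_mod_eq_0)
      moreover have "0 \<le> (i - s) mod int N" "(i - s) mod int N < int N" using N by auto
      moreover have "c j = c i" unfolding per j_def by (simp add: mod_simps)
      ultimately show ?thesis using i by (intro exI[of _ j]) (auto simp: j_def)
    qed
    have keep: "{c l, c (l + 1)} \<in> edges (delete_vertex H v)" if "s + 1 \<le> l" "l < s + int N - 1" for l
    proof -
      have "\<not> int N dvd (l - s)" "\<not> int N dvd (l + 1 - s)"
        using that zdvd_imp_le[of "int N" "l - s"] zdvd_imp_le[of "int N" "l + 1 - s"] by auto
      then have "c l \<noteq> v" "c (l + 1) \<noteq> v" by (auto simp: s per mod_eq_dvd_iff)
      then show ?thesis using adj by (auto simp: delete_vertex_def)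
    qed
    show "connected_graph (delete_vertex H v)"
      unfolding connected_graph_def
    proof (intro ballI)
      fix u w assume "u \<in> verts (delete_vertex H v)" "w \<in> verts (delete_vertex H v)"
      then have "u \<in> range c - {v}" "w \<in> range c - {v}" by (auto simp: delete_vertex_def V)
      then obtain i j where "u = c i" "s + 1 \<le> i" "i \<le> s + int N - 1" "w = c j" "s + 1 \<le> j" "j \<le> s + int N - 1"
        using window by meson
      then show "(u, w) \<in> (adj_rel (delete_vertex H v))\<^sup>*"
        using link[where F = "delete_vertex H v", of "s + 1" "s + int N - 1" i j] keep by blast
    qed
  qed
qed

lemma iso_min_degree:
  assumes f: "bij_betw f (verts G) (verts H)"
    and e: "\<forall>u\<in>verts G. \<forall>v\<in>verts G. {u, v} \<in> edges G \<longleftrightarrow> {f u, f v} \<in> edges H"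
  shows "min_degree H = min_degree G"
proof -
  have "degree H (f v) = degree G v" if v: "v \<in> verts G" for v
  proof -
    have "{u \<in> verts H. {u, f v} \<in> edges H} = f ` {u \<in> verts G. {u, v} \<in> edges G}"
    proof
      show "{u \<in> verts H. {u, f v} \<in> edges H} \<subseteq> f ` {u \<in> verts G. {u, v} \<in> edges G}"
      proof
        fix w assume w: "w \<in> {u \<in> verts H. {u, f v} \<in> edges H}"
        then obtain u where "u \<in> verts G" "w = f u" using bij_betw_imp_surj_on[OF f] by auto
        then show "w \<in> f ` {u \<in> verts G. {u, v} \<in> edges G}" using e v w by auto
      qed
    qed (use e v bij_betwE[OF f] in auto)
    moreover have "inj_on f {u \<in> verts G. {u, v} \<in> edges G}"
      by (rule inj_on_subset[OF bij_betw_imp_inj_on[OF f]]) auto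
    ultimately show ?thesis by (simp add: degree_def card_image)
  qed
  then have "degree H ` (f ` verts G) = degree G ` verts G" by (force simp: image_image)
  then show ?thesis using bij_betw_imp_surj_on[OF f] by (simp add: min_degree_def)
qed

text \<open>The new block occupies copy 0, enlarged to \<open>delta k + 1\<close> positions, so the
  untouched copies are numbered from 1.\<close>

lemma verts_G3:
  "verts (G3_graph k t EB) =
    G3_block_verts k \<union> Inr ` ({1..<t} \<times> {0..<delta k})"
  by (auto simp: G3_graph_def Let_def G1_windmill verts_windmill G3_block_verts_def)

lemma edge_G3_old:
  assumes "i \<in> {1..<t} \<times> {0..<delta k}" "j \<in> {1..<t} \<times> {0..<delta k}"
    and EB: "\<And>e. e \<in> EB \<Longrightarrow> e \<subseteq> G3_block_verts k"
  shows "{Inr i, Inr j} \<in> edges (G3_graph k t EB) \<longleftrightarrow> i \<noteq> j \<and> fst i = fst j"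
proof -
  have "Inr i \<notin> G3_block_verts k" using assms(1) by (auto simp: G3_block_verts_def)
  then have "{Inr i, Inr j} \<notin> EB" using EB by blast
  then show ?thesis using assms(1,2)
    by (cases i; cases j) (auto simp: G3_graph_def Let_def G1_windmill verts_windmill edge_windmill)
qed

lemma edge_G3_cross:
  assumes "i \<in> {1..<t} \<times> {0..<delta k}" "b \<in> G3_block_verts k"
    and EB: "\<And>e. e \<in> EB \<Longrightarrow> e \<subseteq> G3_block_verts k"
  shows "{Inr i, b} \<in> edges (G3_graph k t EB) \<longleftrightarrow> b = Inl 0"
proof -
  have "Inr i \<notin> G3_block_verts k" using assms(1) by (auto simp: G3_block_verts_def)
  then have "{Inr i, b} \<notin> EB" using EB by blast
  then show ?thesis using assms(1,2)
    by (cases i) (auto simp: G3_graph_def Let_def G1_windmill verts_windmill edge_windmill G3_block_verts_def)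
qed

lemma edge_G3_block:
  assumes "a \<in> G3_block_verts k" "b \<in> G3_block_verts k"
  shows "{a, b} \<in> edges (G3_graph k t EB) \<longleftrightarrow> {a, b} \<in> EB"
  using assms edge_windmill(1)[of 0 0 "delta k" t]
  by (auto simp: G3_graph_def Let_def G1_windmill verts_windmill edge_windmill G3_block_verts_def)

section \<open>Large blocks and embeddings into joins\<close>

context longest begin

text \<open>The edges of the block, transported along \<open>fb\<close>, become \<open>EB\<close>.
  Its freeness from \<open>K_m\<close> is prepared without fixing \<open>m\<close>: every complete
  subgraph of the block yields a clique of the whole graph.\<close>

lemma large_block_models:
  assumes large_block and dk: "delta k = d"
  obtains t EB where "1 \<le> t" "card V = 2 + t * d" "has_clique (d + 1)"
    "graph (G3_block_verts k, EB)" "connected_graph (G3_block_verts k, EB)" "no_cut_vertex (G3_block_verts k, EB)"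
    "\<forall>m. subgraph_of (complete_graph m) (G3_block_verts k, EB) \<longrightarrow> has_clique m"
    "models (G3_graph k t EB)"
proof -
  obtain cy c where cy: "cyc (d + 2) cy" "c \<in> range cy" and cl: "cliques d (V - range cy) {c}"
    using assms(1) unfolding large_block_def by blast
  define B where "B = range cy"
  let ?U = "V - B"
  have cl: "cliques d ?U {c}" using cl by (simp add: B_def)
  have BV: "B \<subseteq> V" using cyc_inV[OF cy(1)] by (auto simp: B_def)
  have fB: "finite B" and cB: "card B = d + 2" using cyc_finite[OF cy(1)] cyc_card[OF cy(1)] by (auto simp: B_def)
  have cin: "c \<in> B" using cy(2) by (simp add: B_def)
  obtain t0 :: nat and g where g: "bij_betw g ?U ({0..<t0} \<times> {0..<d})"
    "\<forall>x\<in>?U. \<forall>y\<in>?U. adj x y \<longleftrightarrow> x \<noteq> y \<and> fst (g x) = fst (g y)"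
    using cliques_index[OF cl] by blast
  \<comment> \<open>The block stands for one more clique with an extra vertex:
    \<open>card V = (d + 2) + t0 * d = 2 + t * d\<close>.\<close>
  define t where "t = t0 + 1"
  have cBc: "card (B - {c}) = d + 1" using cB cin fB by simp
  obtain h where h: "bij_betw h (B - {c}) {0..<d + 1}"
    using ex_bij_betw_finite_nat[of "B - {c}"] fB cBc by auto
  define fb where "fb = (\<lambda>x. if x \<in> B - {c} then Inr (0, h x) else (Inl 0 :: nat + nat \<times> nat))"
  \<comment> \<open>\<open>Suc\<close> makes room for copy 0, which the block occupies.\<close>
  define gu where "gu = (\<lambda>x. (Suc (fst (g x)), snd (g x)))"
  define f where "f = (\<lambda>x. if x \<in> B then fb x else Inr (gu x))"
  have "bij_betw fb ((B - {c}) \<union> {c}) ((\<lambda>j. Inr (0, j)) ` {0..<d + 1} \<union> {Inl 0})"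
    unfolding fb_def using bij_betw_inj_image[OF h, of "\<lambda>j. Inr (0, j)"]
    by (intro bij_betw_disjoint_Un) (auto simp: bij_betw_def inj_def)
  moreover have "(B - {c}) \<union> {c} = B" using cin by blast
  moreover have "(\<lambda>j. Inr (0, j)) ` {0..<d + 1} \<union> {Inl 0} = G3_block_verts k"
    by (auto simp: G3_block_verts_def dk)
  ultimately have bb: "bij_betw fb B (G3_block_verts k)" by simp
  have "bij_betw gu ?U ((\<lambda>z. (Suc (fst z), snd z)) ` ({0..<t0} \<times> {0..<d}))"
    unfolding gu_def using bij_betw_inj_image[OF g(1), of "\<lambda>z. (Suc (fst z), snd z)"]
    by (auto simp: inj_def prod_eq_iff)
  moreover have "(\<lambda>z. (Suc (fst z), snd z)) ` ({0..<t0} \<times> {0..<d}) = {1..<t} \<times> {0..<delta k}"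
  proof
    show "{1..<t} \<times> {0..<delta k} \<subseteq> (\<lambda>z. (Suc (fst z), snd z)) ` ({0..<t0} \<times> {0..<d})"
    proof
      fix z assume z: "z \<in> {1..<t} \<times> {0..<delta k}"
      then have "(fst z - 1, snd z) \<in> {0..<t0} \<times> {0..<d}" by (auto simp: t_def dk)
      moreover have "z = (Suc (fst (fst z - 1, snd z)), snd (fst z - 1, snd z))" using z by auto
      ultimately show "z \<in> (\<lambda>z. (Suc (fst z), snd z)) ` ({0..<t0} \<times> {0..<d})" by blast
    qed
  qed (auto simp: t_def dk)
  ultimately have gb: "bij_betw gu ?U ({1..<t} \<times> {0..<delta k})" by simp
  have "bij_betw f (B \<union> ?U) (G3_block_verts k \<union> Inr ` ({1..<t} \<times> {0..<delta k}))"
    unfolding f_def using bb bij_betw_inj_image[OF gb, of Inr]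
    by (intro bij_betw_disjoint_Un) (auto simp: G3_block_verts_def)
  moreover have "B \<union> ?U = V" using BV by blast
  ultimately have bij: "bij_betw f V (verts (G3_graph k t EB))" for EB by (simp add: verts_G3)
  have ff: "f x = fb x" if "x \<in> B" for x unfolding f_def if_P[OF that] ..
  have fu: "f x = Inr (gu x)" if "x \<in> ?U" for x using that by (simp add: f_def)
  have fbm: "fb x \<in> G3_block_verts k" if "x \<in> B" for x using bij_betwE[OF bb] that by blast
  have fbi: "fb x = fb y \<longleftrightarrow> x = y" if "x \<in> B" "y \<in> B" for x y
    using bij_betw_imp_inj_on[OF bb] that unfolding inj_on_def by blast
  have gum: "gu x \<in> {1..<t} \<times> {0..<delta k}" if "x \<in> ?U" for x using bij_betwE[OF gb] that by blast
  have gui: "gu x = gu y \<longleftrightarrow> x = y" if "x \<in> ?U" "y \<in> ?U" for x y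
    using bij_betw_imp_inj_on[OF gb] that unfolding inj_on_def by blast
  define EB where "EB = {{fb x, fb y} | x y. x \<in> B \<and> y \<in> B \<and> adj x y}"
  have EBsub: "e \<subseteq> G3_block_verts k" if "e \<in> EB" for e using that fbm by (auto simp: EB_def)
  have EBadj: "{fb x, fb y} \<in> EB \<longleftrightarrow> adj x y" if xy: "x \<in> B" "y \<in> B" for x y
  proof
    assume "{fb x, fb y} \<in> EB"
    then obtain x' y' where "{fb x, fb y} = {fb x', fb y'}" "x' \<in> B" "y' \<in> B" "adj x' y'"
      by (auto simp: EB_def)
    then show "adj x y" using fbi xy sym by (auto simp: doubleton_eq_iff)
  qed (use xy in \<open>auto simp: EB_def\<close>)
  have fbl: "fb x = Inl 0 \<longleftrightarrow> x = c" if "x \<in> B" for x using that by (auto simp: fb_def)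
  have out: "adj x y \<longleftrightarrow> y = c" if "x \<in> ?U" "y \<in> B" for x y
    using cliques_adj_outside[OF cl that(1), of y] that(2) by blast
  have "adj x y \<longleftrightarrow> {f x, f y} \<in> edges (G3_graph k t EB)" if xy: "x \<in> V" "y \<in> V" for x y
  proof -
    consider "x \<in> B" "y \<in> B" | "x \<in> ?U" "y \<in> ?U" | "x \<in> ?U" "y \<in> B" | "x \<in> B" "y \<in> ?U"
      using xy by blast
    then show ?thesis
    proof cases
      case 1
      show ?thesis unfolding ff[OF 1(1)] ff[OF 1(2)] edge_G3_block[OF fbm[OF 1(1)] fbm[OF 1(2)]]
        using EBadj[OF 1] by blast
    next
      case 2
      have "{Inr (gu x), Inr (gu y)} \<in> edges (G3_graph k t EB) \<longleftrightarrow> gu x \<noteq> gu y \<and> fst (gu x) = fst (gu y)"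
        by (rule edge_G3_old[OF gum[OF 2(1)] gum[OF 2(2)] EBsub])
      moreover have "fst (gu x) = fst (gu y) \<longleftrightarrow> fst (g x) = fst (g y)" by (simp add: gu_def)
      ultimately show ?thesis unfolding fu[OF 2(1)] fu[OF 2(2)]
        using bspec[OF bspec[OF g(2) 2(1)] 2(2)] gui[OF 2] by blast
    next
      case 3
      have "{Inr (gu x), fb y} \<in> edges (G3_graph k t EB) \<longleftrightarrow> fb y = Inl 0"
        by (rule edge_G3_cross[OF gum[OF 3(1)] fbm[OF 3(2)] EBsub])
      then show ?thesis unfolding fu[OF 3(1)] ff[OF 3(2)]
        using out[OF 3] fbl[OF 3(2)] by blast
    next
      case 4
      have "{f x, f y} = {Inr (gu y), fb x}" using fu[OF 4(2)] ff[OF 4(1)] by auto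
      moreover have "{Inr (gu y), fb x} \<in> edges (G3_graph k t EB) \<longleftrightarrow> fb x = Inl 0"
        by (rule edge_G3_cross[OF gum[OF 4(2)] fbm[OF 4(1)] EBsub])
      ultimately show ?thesis using out[OF 4(2,1)] fbl[OF 4(1)] adj_commute[of x y] by metis
    qed
  qed
  then have "models (G3_graph k t EB)" unfolding models_def using bij by blast
  moreover have "graph (G3_block_verts k, EB)"
  proof -
    have "finite (G3_block_verts k)" using bb fB by (metis bij_betw_finite)
    moreover have "card e = 2" if e: "e \<in> EB" for e
    proof -
      obtain x y where xy: "e = {fb x, fb y}" "x \<in> B" "y \<in> B" "adj x y" using e by (auto simp: EB_def)
      then have "fb x \<noteq> fb y" using fbi[OF xy(2,3)] adj_neq[OF xy(4)] by blast
      then show ?thesis using xy(1) by simp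
    qed
    ultimately show ?thesis using EBsub by (simp add: graph_def)
  qed
  moreover have "connected_graph (G3_block_verts k, EB)" "no_cut_vertex (G3_block_verts k, EB)"
  proof -
    have v: "verts (G3_block_verts k, EB) = range (\<lambda>i. fb (cy i))"
      using bij_betw_imp_surj_on[OF bb] by (auto simp: B_def)
    have cB: "cy i \<in> B" for i by (simp add: B_def)
    have per: "fb (cy i) = fb (cy j) \<longleftrightarrow> i mod int (d + 2) = j mod int (d + 2)" for i j
      using fbi[OF cB cB] cy(1) by (simp add: cyc_def)
    have ed: "{fb (cy i), fb (cy (i + 1))} \<in> edges (G3_block_verts k, EB)" for i
      using EBadj[OF cB cB] cyc_adj[OF cy(1)] by simp
    show "connected_graph (G3_block_verts k, EB)" "no_cut_vertex (G3_block_verts k, EB)"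
      
      by (rule Hamiltonian_connected[where c = "\<lambda>i. fb (cy i)" and N = "d + 2", OF v _ per ed]; simp)+
  qed
  moreover have "has_clique m" if sub: "subgraph_of (complete_graph m) (G3_block_verts k, EB)" for m
  proof -
    obtain Q where Q: "Q \<subseteq> G3_block_verts k" "card Q = m" "\<And>x y. x \<in> Q \<Longrightarrow> y \<in> Q \<Longrightarrow> x \<noteq> y \<Longrightarrow> {x, y} \<in> EB"
      using complete_subgraph_clique[OF sub] by auto
    define R where "R = {x \<in> B. fb x \<in> Q}"
    have "fb ` R = Q" using Q(1) bij_betw_imp_surj_on[OF bb] by (auto simp: R_def)
    moreover have "inj_on fb R" by (rule inj_on_subset[OF bij_betw_imp_inj_on[OF bb]]) (auto simp: R_def)
    ultimately have "card R = m" using Q(2) by (metis card_image)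
    moreover have "adj x y" if "x \<in> R" "y \<in> R" "x \<noteq> y" for x y
      using that Q(3)[of "fb x" "fb y"] EBadj[of x y] fbi[of x y] by (auto simp: R_def)
    moreover have "R \<subseteq> V" using BV by (auto simp: R_def)
    ultimately show ?thesis unfolding has_clique_def by blast
  qed
  moreover have "card V = 2 + t * d"
  proof -
    have "card V = card B + card ?U"
      using card_Un_disjoint[of B ?U] fB fin \<open>B \<union> ?U = V\<close> by auto
    then show ?thesis using bij_betw_same_card[OF g(1)] cB by (simp add: t_def)
  qed
  moreover have "1 \<le> t" by (simp add: t_def)
  moreover have "has_clique (d + 1)"
  proof -
    have "?U \<noteq> {}" using outsider_ex[OF cy(1)] by (auto simp: B_def)
    from cliques_has_clique[OF cl this, of "{c}"] show ?thesis using cin BV by auto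
  qed
  ultimately show ?thesis using that by blast
qed

text \<open>\<open>EH\<close> will be the edge set induced on \<open>S\<close>. That it contains no
  \<open>K_{m-1}\<close> is prepared without \<open>m\<close>: a \<open>K_r\<close> in it must come
  with a clique of order \<open>r + 1\<close> in the whole graph.\<close>

definition embeds_in_join :: "'b graph \<Rightarrow> bool" where
  "embeds_in_join K \<longleftrightarrow> (\<exists>EH. graph ({0..<d}, EH) \<and>
     (\<forall>r. subgraph_of (complete_graph r) ({0..<d}, EH) \<longrightarrow> has_clique (Suc r)) \<and>
     embeds (join ({0..<d}, EH) K))"

text \<open>All neighbours of \<open>z\<close> lie in \<open>S\<close>, hence by degree
  \<open>z\<close> sees all of \<open>S\<close>, and adding \<open>z\<close> extends every clique of
  \<open>S\<close>.\<close>

lemma split_join: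
  assumes S: "S \<subseteq> V" "card S = d" and g: "bij_betw g (V - S) (verts K)"
    and gK: "\<And>x y. adj x y \<Longrightarrow> x \<notin> S \<Longrightarrow> y \<notin> S \<Longrightarrow> {g x, g y} \<in> edges K"
    and z: "z \<in> V - S" "nb z \<subseteq> S"
  shows "embeds_in_join K"
proof -
  have fS: "finite S" using finite_subset[OF S(1) fin] .
  obtain h where h: "bij_betw h S {0..<d}" using ex_bij_betw_finite_nat[OF fS] S(2) by blast
  have hi: "h x = h y \<longleftrightarrow> x = y" if "x \<in> S" "y \<in> S" for x y
    using bij_betw_imp_inj_on[OF h] that unfolding inj_on_def by blast
  have hm: "h x < d" if "x \<in> S" for x using bij_betwE[OF h] that by auto
  have gm: "g x \<in> verts K" if "x \<in> V" "x \<notin> S" for x using bij_betwE[OF g] that by blast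
  define EH where "EH = {{h x, h y} | x y. x \<in> S \<and> y \<in> S \<and> adj x y}"
  have EHadj: "{h x, h y} \<in> EH \<longleftrightarrow> adj x y" if xy: "x \<in> S" "y \<in> S" for x y
  proof
    assume "{h x, h y} \<in> EH"
    then obtain x' y' where "{h x, h y} = {h x', h y'}" "x' \<in> S" "y' \<in> S" "adj x' y'"
      by (auto simp: EH_def)
    then show "adj x y" using hi xy sym by (auto simp: doubleton_eq_iff)
  qed (use xy in \<open>auto simp: EH_def\<close>)
  have 1: "graph ({0..<d}, EH)"
  proof -
    have "card e = 2" if e: "e \<in> EH" for e
    proof -
      obtain x y where xy: "e = {h x, h y}" "x \<in> S" "y \<in> S" "adj x y" using e by (auto simp: EH_def)
      then have "h x \<noteq> h y" using hi[OF xy(2,3)] adj_neq[OF xy(4)] by blast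
      then show ?thesis using xy(1) by simp
    qed
    then show ?thesis using hm by (auto simp: graph_def EH_def)
  qed
  have nbz: "nb z = S" using z mindeg[of z] S(2) fS by (intro card_seteq) auto
  have 2: "has_clique (Suc r)" if r: "subgraph_of (complete_graph r) ({0..<d}, EH)" for r
  proof -
    obtain Q where Q: "Q \<subseteq> {0..<d}" "card Q = r" "\<And>x y. x \<in> Q \<Longrightarrow> y \<in> Q \<Longrightarrow> x \<noteq> y \<Longrightarrow> {x, y} \<in> EH"
      using complete_subgraph_clique[OF r] by auto
    define R where "R = {x \<in> S. h x \<in> Q}"
    have "h ` R = Q" using Q(1) bij_betw_imp_surj_on[OF h] by (auto simp: R_def)
    moreover have "inj_on h R" by (rule inj_on_subset[OF bij_betw_imp_inj_on[OF h]]) (auto simp: R_def)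
    ultimately have "card R = r" using Q(2) by (metis card_image)
    moreover have "z \<notin> R" "finite R" using z(1) fS by (auto simp: R_def)
    ultimately have "card (insert z R) = Suc r" by simp
    moreover have "adj x y" if "x \<in> R" "y \<in> R" "x \<noteq> y" for x y
      using that Q(3)[of "h x" "h y"] EHadj[of x y] hi[of x y] by (auto simp: R_def)
    moreover have "adj z x" "adj x z" if "x \<in> R" for x
      using that nbz sym by (auto simp: R_def nb_def)
    ultimately show ?thesis
      unfolding has_clique_def using S(1) z(1) by (intro exI[of _ "insert z R"]) (auto simp: R_def)
  qed
  define f where "f = (\<lambda>x. if x \<in> S then Inl (h x) else Inr (g x))"
  have "bij_betw f (S \<union> (V - S)) (Inl ` {0..<d} \<union> Inr ` verts K)"
    unfolding f_def using bij_betw_inj_image[OF h, of Inl] bij_betw_inj_image[OF g, of Inr]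
    by (intro bij_betw_disjoint_Un) auto
  moreover have "S \<union> (V - S) = V" using S(1) by blast
  ultimately have bij: "bij_betw f V (verts (join ({0..<d}, EH) K))" by (simp add: verts_join)
  have "{f x, f y} \<in> edges (join ({0..<d}, EH) K)" if a: "adj x y" for x y
    using a gK[OF a] EHadj[of x y] hm[of x] hm[of y] gm[of x] gm[of y] adjV[OF a] adjV2[OF a]
    by (cases "x \<in> S"; cases "y \<in> S") (simp_all add: f_def edge_join)
  then have 3: "embeds (join ({0..<d}, EH) K)"
    unfolding embeds_def using bij_betw_imp_inj_on[OF bij] bij_betw_imp_surj_on[OF bij] by blast
  show ?thesis unfolding embeds_in_join_def using 1 2 3 by blast
qed

lemma near_bipartite_join_empty:
  assumes "near_bipartite False" "d < card V"
  shows "embeds_in_join (empty_graph (card V - d))"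
proof -
  obtain S where S: "S \<subseteq> V" "card S = d" and n: "\<And>x y. adj x y \<Longrightarrow> x \<notin> S \<Longrightarrow> y \<notin> S \<Longrightarrow> False"
    using assms(1) unfolding near_bipartite_def by blast
  have fS: "finite S" using finite_subset[OF S(1) fin] .
  have cW: "card (V - S) = card V - d" using card_Diff_subset[OF fS S(1)] S(2) by simp
  then have "V - S \<noteq> {}" using assms(2) by (metis card.empty not_less_zero zero_less_diff)
  then obtain z where z: "z \<in> V - S" by blast
  have nz: "nb z \<subseteq> S" using n[of z] z by (auto simp: nb_def)
  obtain g where "bij_betw g (V - S) {0..<card V - d}"
    using ex_bij_betw_finite_nat[of "V - S"] fin cW by auto
  then have g: "bij_betw g (V - S) (verts (empty_graph (card V - d)))" by (simp add: empty_graph_def)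
  have gK: "{g x, g y} \<in> edges (empty_graph (card V - d))" if "adj x y" "x \<notin> S" "y \<notin> S" for x y
    using n[OF that] ..
  show ?thesis by (rule split_join[OF S g gK z nz])
qed

lemma near_bipartite_join_edge:
  assumes "near_bipartite e" "d + 2 < card V"
  shows "embeds_in_join (disj_union (empty_graph (card V - d - 2)) (complete_graph 2))"
proof -
  from assms(1) obtain S a b where S: "S \<subseteq> V" "card S = d"
    and nab: "\<forall>x y. adj x y \<longrightarrow> x \<notin> S \<longrightarrow> y \<notin> S \<longrightarrow> e \<and> {x, y} = {a, b}"
    unfolding near_bipartite_def by (elim exE conjE) (rule that; assumption)
  have n: "{x, y} = {a, b}" if "adj x y" "x \<notin> S" "y \<notin> S" for x y
    using nab that by (metis (no_types, lifting))
  have fS: "finite S" using finite_subset[OF S(1) fin] .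
  have cW: "card (V - S) = card V - d" using card_Diff_subset[OF fS S(1)] S(2) by simp
  obtain a' b' where ab: "a' \<in> V - S" "b' \<in> V - S" "a' \<noteq> b'"
    "\<And>x y. adj x y \<Longrightarrow> x \<notin> S \<Longrightarrow> y \<notin> S \<Longrightarrow> {x, y} = {a', b'}"
  proof (cases "\<exists>x y. adj x y \<and> x \<notin> S \<and> y \<notin> S")
    case True
    then obtain x y where xy: "adj x y" "x \<notin> S" "y \<notin> S" by blast
    have "{u, v} = {x, y}" if "adj u v" "u \<notin> S" "v \<notin> S" for u v
      using n[OF that] n[OF xy] by simp
    then show ?thesis using that[of x y] xy adjV[OF xy(1)] adjV2[OF xy(1)] adj_neq[OF xy(1)] by blast
  next
    case False
    \<comment> \<open>If no edge lies outside \<open>S\<close>, any two vertices there may serve as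
      the ends of the \<open>K_2\<close>.\<close>
    have "2 \<le> card (V - S)" using cW assms(2) by simp
    then obtain T where "T \<subseteq> V - S" "card T = 2" by (meson obtain_subset_with_card_n)
    then obtain x y where "x \<in> V - S" "y \<in> V - S" "x \<noteq> y" by (auto simp: card_2_iff)
    then show ?thesis using that[of x y] False by blast
  qed
  let ?W = "V - S - {a', b'}"
  have cW': "card ?W = card V - d - 2" using ab(1-3) fin cW by (simp add: card_Diff_subset)
  \<comment> \<open>The strict bound \<open>d + 2 < card V\<close> leaves a vertex outside
    \<open>S\<close> and off the \<open>K_2\<close>, which serves as \<open>z\<close> in
    \<open>split_join\<close>.\<close>
  have "?W \<noteq> {}" using cW' assms(2) by (metis card.empty diff_diff_left not_less_zero zero_less_diff)
  then obtain z where z: "z \<in> ?W" by blast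
  have nz: "nb z \<subseteq> S" using ab(4)[of z] z by (auto simp: nb_def doubleton_eq_iff)
  obtain h where h: "bij_betw h ?W {0..<card V - d - 2}"
    using ex_bij_betw_finite_nat[of ?W] fin cW' by auto
  let ?K = "disj_union (empty_graph (card V - d - 2)) (complete_graph 2)"
  define k where "k = (\<lambda>x. if x = a' then 0 else (1::nat))"
  define g where "g = (\<lambda>x. if x \<in> ?W then Inl (h x) else Inr (k x))"
  have "bij_betw k {a', b'} {0..<2}" using ab(3) by (auto simp: k_def bij_betw_def)
  then have "bij_betw g (?W \<union> {a', b'}) (Inl ` {0..<card V - d - 2} \<union> Inr ` {0..<2})"
    unfolding g_def using bij_betw_inj_image[OF h, of Inl] bij_betw_inj_image[of k "{a', b'}" "{0..<2}" Inr]
    by (intro bij_betw_disjoint_Un) auto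
  moreover have "?W \<union> {a', b'} = V - S" using ab(1,2) by blast
  moreover have "Inl ` {0..<card V - d - 2} \<union> Inr ` {0..<2} = verts ?K"
    by (simp add: verts_disj_union empty_graph_def complete_graph_def)
  ultimately have bij: "bij_betw g (V - S) (verts ?K)" by simp
  have gab: "g a' = Inr 0" "g b' = Inr 1" using ab(3) by (auto simp: g_def k_def)
  have eK: "{g a', g b'} \<in> edges ?K" unfolding gab edge_disj_union by (simp add: edge_complete)
  have gK: "{g x, g y} \<in> edges ?K" if "adj x y" "x \<notin> S" "y \<notin> S" for x y
  proof -
    have "{g x, g y} = g ` {x, y}" by simp
    also have "\<dots> = {g a', g b'}" unfolding ab(4)[OF that] by simp
    finally show ?thesis using eK by simp
  qed
  have zV: "z \<in> V - S" using z by blast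
  show ?thesis by (rule split_join[OF S bij gK zV nz])
qed

end

section \<open>The theorem\<close>

theorem theorem3p1:
  fixes G :: "'a graph" and k m n :: nat
  assumes "graph G"
    and "connected_graph G"
    and "\<not> subgraph_of (path_graph k) G"
    and "\<not> subgraph_of (complete_graph m) G"
    and "min_degree G \<ge> delta k"
    and "card (verts G) = n"
    and "n \<ge> k"
  shows
   "(\<exists>EH. graph ({0..<delta k}, EH) \<and>
         \<not> subgraph_of (complete_graph (m - 1)) ({0..<delta k}, EH) \<and>
         (if even k then subgraph_of G (join ({0..<delta k}, EH) (empty_graph (n - delta k)))
          else subgraph_of G (join ({0..<delta k}, EH)
                 (disj_union (empty_graph (n - delta k - 2)) (complete_graph 2)))))
    \<or> (m \<ge> delta k + 2 \<and>
         ((\<exists>t. 1 \<le> t \<and> n = 1 + t * delta k \<and> iso G (G1 k t))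
          \<or> (odd k \<and> (\<exists>t1 t2. 1 \<le> t1 \<and> 1 \<le> t2 \<and> n = (1 + t1 * delta k) + (1 + t2 * delta k)
                          \<and> iso G (G2 k t1 t2)))
          \<or> (odd k \<and> is_G3 n k m G)))
    \<or> (k = 7 \<and> m \<ge> 4 \<and>
         (\<exists>t n2. 1 \<le> t \<and> n2 \<ge> 4 \<and> n = (1 + 2 * t) + n2 - 1 \<and>
              (iso G (G4 t (n2 - 2)) \<or> iso G (G5 t (n2 - 2)))))
    \<or> (k = 9 \<and> m \<ge> 4 \<and> (\<exists>t. n = 2 + 2 * t \<and> iso G (join (empty_graph 2) (copies t (complete_graph 2)))))
    \<or> (k = 9 \<and> m \<ge> 5 \<and> (\<exists>t. n = 2 + 2 * t \<and> iso G (join (complete_graph 2) (copies t (complete_graph 2)))))"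
    (is "?join \<or> ?mills \<or> ?seven \<or> ?nine \<or> ?nine'")
proof -
  define V where "V = verts G"
  define adj where "adj = (\<lambda>u v. {u, v} \<in> edges G)"
  define d where "d = delta k"
  have edge: "\<exists>x y. e = {x, y} \<and> adj x y" if e: "e \<in> edges G" for e
  proof -
    obtain x y where "e = {x, y}" using e assms(1) by (auto simp: graph_def card_2_iff)
    then show ?thesis using e by (auto simp: adj_def)
  qed
  interpret sgraph V adj
  proof
    show "finite V" using assms(1) by (simp add: graph_def V_def)
    show "adj v u" if "adj u v" for u v using that by (simp add: adj_def insert_commute)
    show "\<not> adj u u" for u
    proof
      assume "adj u u"
      then have "card {u, u} = 2" using assms(1) by (auto simp: graph_def adj_def)
      then show False by simp
    qed
    show "u \<in> V" if "adj u v" for u v using that assms(1) by (auto simp: graph_def adj_def V_def)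
  qed
  have short: "length xs < k" if xs: "path xs" for xs
  proof (rule ccontr)
    assume "\<not> length xs < k"
    then have le: "k \<le> length xs" by simp
    have "inj_on ((!) xs) {0..<k}"
      using path_distinct[OF xs] le by (auto simp: inj_on_def nth_eq_iff_index_eq)
    moreover have "(!) xs ` {0..<k} \<subseteq> verts G"
      using path_subset[OF xs] le by (auto simp: V_def)
    moreover have "(!) xs ` e \<in> edges G" if e: "e \<in> edges (path_graph k)" for e
    proof -
      obtain i where "e = {i, Suc i}" "Suc i < k" using e by (auto simp: path_graph_def)
      then show ?thesis using path_nth[OF xs, of i] le by (simp add: adj_def)
    qed
    moreover have "verts (path_graph k) = {0..<k}" by (simp add: path_graph_def)
    ultimately have "subgraph_of (path_graph k) G"
      unfolding subgraph_of_def by (intro exI[of _ "(!) xs"]) simp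
    then show False using assms(3) by simp
  qed
  obtain xs where xs: "path xs" and longest: "\<And>ys. path ys \<Longrightarrow> length ys \<le> length xs"
    using ex_has_greatest_nat[of path "[]" length k] short by auto
  define p where "p = length xs"
  have pk: "p < k" using short[OF xs] by (simp add: p_def)
  have nV: "card V = n" using assms(6) by (simp add: V_def)
  have nbdeg: "card (nb v) = degree G v" for v
  proof -
    have "nb v = {u \<in> V. adj u v}"
      using adjV2 sym by (auto simp: nb_def)
    then show ?thesis by (simp add: degree_def V_def adj_def)
  qed
  interpret longest V adj d p
  proof
    show "(u, v) \<in> {(x, y). adj x y}\<^sup>*" if "u \<in> V" "v \<in> V" for u v
      using assms(2) that by (simp add: connected_graph_def adj_rel_def adj_def V_def)
    show "d \<le> card (nb v)" if "v \<in> V" for v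
    proof -
      have "min_degree G \<le> degree G v"
        unfolding min_degree_def using that fin by (intro Min_le) (auto simp: V_def)
      then show ?thesis using assms(5) nbdeg by (simp add: d_def)
    qed
    show "length ys \<le> p" if "path ys" for ys using longest[OF that] by (simp add: p_def)
    show "p < card V" using pk assms(7) nV by simp
  qed
  \<comment> \<open>Three vertices on a longest path force \<open>k \<ge> 4\<close>, so
    \<open>delta k\<close> is at least 1 and its subtraction is not truncated.\<close>
  have p3: "3 \<le> p" by (rule p_ge3[OF xs p_def[symmetric]])
  then have k4: "4 \<le> k" using pk by simp
  then have d1: "1 \<le> d" by (simp add: d_def delta_def)
  \<comment> \<open>Parity decides the allowed path length: \<open>p \<le> 2 * d + 1\<close> for
    even \<open>k\<close> and \<open>p \<le> 2 * d + 2\<close> for odd \<open>k\<close>. The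
    structures listed with \<open>p = 2 * d + 2\<close> therefore belong to odd
    \<open>k\<close>.\<close>
  have kd: "k = (if even k then 2 * d + 2 else 2 * d + 3)"
    using k4 by (auto simp: d_def delta_def elim!: evenE oddE)
  then have p2: "p \<le> 2 * d + 2" and even_p: "even k \<Longrightarrow> p \<le> 2 * d + 1" using pk by (auto split: if_splits)
  have dn: "d + 2 < card V" if "odd k" using kd that assms(7) nV d1 by simp
  have dn': "d < card V" using kd assms(7) nV by (auto split: if_splits)
  have cl: "r < m" if r: "has_clique r" for r
  proof (rule ccontr)
    assume a: "\<not> r < m"
    obtain Q where Q: "Q \<subseteq> V" "card Q = r" "\<forall>x\<in>Q. \<forall>y\<in>Q. x \<noteq> y \<longrightarrow> adj x y"
      using r unfolding has_clique_def by blast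
    have "finite Q" using Q(1) finite_subset fin by blast
    then have "subgraph_of (complete_graph m) G"
      using Q a by (intro clique_complete_subgraph[of Q]) (auto simp: V_def adj_def)
    then show False using assms(4) by simp
  qed
  \<comment> \<open>The empty clique yields \<open>m > 0\<close>, so that
    \<open>Suc (m - 1) = m\<close> holds in \<open>free\<close> despite truncated
    subtraction.\<close>
  have "has_clique 0" unfolding has_clique_def by (intro exI[of _ "{}"]) simp
  then have m0: "0 < m" by (rule cl)
  have isoI: "iso G H" if mod: "models H" for H :: "'b graph"
  proof -
    obtain f where "bij_betw f V (verts H)" "\<forall>x\<in>V. \<forall>y\<in>V. adj x y \<longleftrightarrow> {f x, f y} \<in> edges H"
      using mod unfolding models_def by blast
    then show ?thesis unfolding iso_def V_def adj_def by blast
  qed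
  have subI: "subgraph_of G H"
    if sub: "embeds H" for H :: "'b graph"
  proof -
    obtain f where f: "inj_on f V" "f ` V \<subseteq> verts H" "\<And>x y. adj x y \<Longrightarrow> {f x, f y} \<in> edges H"
      using sub unfolding embeds_def by blast
    have "f ` e \<in> edges H" if e: "e \<in> edges G" for e
    proof -
      obtain x y where "e = {x, y}" "adj x y" using edge[OF e] by blast
      then show ?thesis using f(3) by simp
    qed
    then show ?thesis unfolding subgraph_of_def using f(1,2) by (auto simp: V_def)
  qed
  have free: "\<not> subgraph_of (complete_graph (m - 1)) ({0..<d}, EH)"
    if "\<forall>r. subgraph_of (complete_graph r) ({0..<d}, EH) \<longrightarrow> has_clique (Suc r)" for EH
    using spec[OF that, of "m - 1"] cl[of "Suc (m - 1)"] m0 by auto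
  consider "near_bipartite (p = 2 * d + 2)" | c where "c \<in> V" "cliques d (V - {c}) {c}"
    | "p = 2 * d + 2" linked_windmills | "p = 2 * d + 2" large_block
    | "p = 2 * d + 2" "d = 2" bipartite_block | "p = 2 * d + 2" "d = 3" matching_join
    using longest_path_structure[OF d1 xs p_def[symmetric] p2] by blast
  then show ?thesis
  proof cases
    case 1
    have ?join
    proof (cases "even k")
      case True
      then have "near_bipartite False" using 1 even_p by simp
      from near_bipartite_join_empty[OF this dn'] obtain EH where EH: "graph ({0..<d}, EH)"
        "\<forall>r. subgraph_of (complete_graph r) ({0..<d}, EH) \<longrightarrow> has_clique (Suc r)"
        "embeds (join ({0..<d}, EH) (empty_graph (card V - d)))"
        unfolding embeds_in_join_def by blast
      from subI[OF EH(3)] have "subgraph_of G (join ({0..<delta k}, EH) (empty_graph (n - delta k)))"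
        unfolding nV d_def .
      then show ?thesis using True EH(1) free[OF EH(2)] unfolding d_def by (intro exI[of _ EH]) simp
    next
      case False
      from near_bipartite_join_edge[OF 1 dn[OF False]] obtain EH where EH: "graph ({0..<d}, EH)"
        "\<forall>r. subgraph_of (complete_graph r) ({0..<d}, EH) \<longrightarrow> has_clique (Suc r)"
        "embeds (join ({0..<d}, EH) (disj_union (empty_graph (card V - d - 2)) (complete_graph 2)))"
        unfolding embeds_in_join_def by blast
      from subI[OF EH(3)] have "subgraph_of G (join ({0..<delta k}, EH)
          (disj_union (empty_graph (n - delta k - 2)) (complete_graph 2)))"
        unfolding nV d_def .
      then show ?thesis using False EH(1) free[OF EH(2)] unfolding d_def by (intro exI[of _ EH]) simp
    qed
    then show ?thesis ..
  next
    case (2 c)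
    obtain t where t: "models (windmill d t)" "card V = 1 + t * d" by (rule windmill_models[OF 2])
    have "V - {c} \<noteq> {}" using dn' d1 by (metis Diff_eq_empty_iff card_mono finite.simps is_singletonI is_singleton_altdef le_trans not_less)
    \<comment> \<open>A clique together with its centre is a \<open>K_{d+1}\<close>, so the absence
      of \<open>K_m\<close> gives \<open>m \<ge> d + 2\<close>; the same argument recurs in the next
      three cases.\<close>
    from cliques_has_clique[OF 2(2) this, of "{c}"] have "has_clique (d + 1)" using 2(1) by auto
    then have "d + 2 \<le> m" using cl by fastforce
    moreover have "1 \<le> t" using t(2) dn' d1 by (cases t) auto
    moreover have "iso G (G1 k t)" using isoI[OF t(1)] by (simp add: G1_windmill d_def)
    ultimately have ?mills using t(2) nV by (auto simp: d_def)
    then show ?thesis by blast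
  next
    case 3
    have odd: "odd k" using 3(1) even_p by fastforce
    obtain t1 t2 where t: "1 \<le> t1" "1 \<le> t2" "card V = (1 + t1 * d) + (1 + t2 * d)"
      "models (add_edges (disj_union (windmill d t1) (windmill d t2)) {{Inl (Inl 0), Inr (Inl 0)}})"
      by (rule linked_windmills_models[OF 3(2)])
    have "iso G (G2 k t1 t2)" using isoI[OF t(4)] by (simp add: G2_def G1_windmill d_def)
    moreover have "has_clique (d + 1)"
    proof -
      obtain c e U1 where "adj c e" "cliques d U1 {c}" "U1 \<noteq> {}"
        using 3(2) unfolding linked_windmills_def by blast
      then show ?thesis using cliques_has_clique[of d U1 "{c}" "{c}"] adjV by auto
    qed
    then have "d + 2 \<le> m" using cl by fastforce
    ultimately have ?mills using t nV odd unfolding d_def by blast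
    then show ?thesis by blast
  next
    case 4
    have odd: "odd k" using 4(1) even_p by fastforce
    obtain t EB where t: "1 \<le> t" "card V = 2 + t * d" "has_clique (d + 1)"
      "graph (G3_block_verts k, EB)" "connected_graph (G3_block_verts k, EB)" "no_cut_vertex (G3_block_verts k, EB)"
      "\<forall>m. subgraph_of (complete_graph m) (G3_block_verts k, EB) \<longrightarrow> has_clique m"
      "models (G3_graph k t EB)"
      by (rule large_block_models[OF 4(2) d_def[symmetric]])
    \<comment> \<open>The degree condition in \<open>is_G3\<close> is that of \<open>G\<close>,
      carried over by the isomorphism.\<close>
    have "min_degree (G3_graph k t EB) = min_degree G"
      using isoI[OF t(8)] iso_min_degree unfolding iso_def by blast
    moreover have "\<not> subgraph_of (complete_graph m) (G3_block_verts k, EB)" using spec[OF t(7), of m] cl[of m] by auto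
    ultimately have "is_G3 n k m G"
      unfolding is_G3_def using t(1,2,4-6) isoI[OF t(8)] nV assms(5)
      by (intro exI[of _ t] exI[of _ EB]) (simp add: d_def)
    moreover have "d + 2 \<le> m" using cl[OF t(3)] by simp
    ultimately have ?mills using odd by (simp add: d_def)
    then show ?thesis by blast
  next
    case 5
    have "odd k" using 5(1) even_p by fastforce
    then have k7: "k = 7" using kd 5(2) by simp
    obtain t s where t: "1 \<le> t" "2 \<le> s" "card V = 2 + s + 2 * t" "models (G4 t s) \<or> models (G5 t s)"
      by (rule bipartite_block_models[OF 5(3,2)])
    have "has_clique (d + 1)"
    proof -
      obtain a b T U where "V = {a, b} \<union> T \<union> U" "U \<noteq> {}" "cliques d U {a}"
        using 5(3) unfolding bipartite_block_def by blast
      then show ?thesis using cliques_has_clique[of d U "{a}" "{a}"] by auto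
    qed
    then have "4 \<le> m" using cl 5(2) by fastforce
    moreover have "iso G (G4 t s) \<or> iso G (G5 t s)" using t(4) isoI by blast
    \<comment> \<open>The star has \<open>s = n2 - 2\<close> leaves, so \<open>n2 = s + 2\<close>
      and \<open>2 \<le> s\<close> is \<open>n2 \<ge> 4\<close>.\<close>
    ultimately have ?seven using k7 t(1-3) nV
      by (intro conjI exI[of _ t] exI[of _ "s + 2"]) auto
    then show ?thesis by blast
  next
    case 6
    have "odd k" using 6(1) even_p by fastforce
    then have k9: "k = 9" using kd 6(2) by simp
    obtain a b where ab: "a \<in> V" "b \<in> V" "a \<noteq> b" "cliques 2 (V - {a, b}) {a, b}"
      using 6(3) unfolding matching_join_def by blast
    obtain t where t: "card V = 2 + 2 * t"
      "models (join (if adj a b then complete_graph 2 else empty_graph 2) (copies t (complete_graph 2)))"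
      by (rule matching_join_models[OF ab])
    have ne: "V - {a, b} \<noteq> {}"
    proof
      assume "V - {a, b} = {}"
      then have "card V \<le> card {a, b}" by (intro card_mono) auto
      then show False using p_lt p3 ab(3) by simp
    qed
    \<comment> \<open>A \<open>K_2\<close> off \<open>{a, b}\<close> forms a triangle with
      \<open>a\<close>, and a \<open>K_4\<close> with \<open>a\<close> and \<open>b\<close> if these
      are adjacent; hence \<open>m \<ge> 4\<close> and \<open>m \<ge> 5\<close>.\<close>
    have "has_clique 3" using cliques_has_clique[OF ab(4) ne, of "{a}"] ab(1) by simp
    then have m4: "4 \<le> m" using cl by fastforce
    show ?thesis
    proof (cases "adj a b")
      case True
      have "has_clique 4"
        using cliques_has_clique[OF ab(4) ne, of "{a, b}"] ab(1-3) True sym by auto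
      then have "5 \<le> m" using cl by fastforce
      moreover have "iso G (join (complete_graph 2) (copies t (complete_graph 2)))"
        using isoI[OF t(2)] True by simp
      ultimately have ?nine' using k9 t(1) nV by blast
      then show ?thesis by blast
    next
      case False
      then have "iso G (join (empty_graph 2) (copies t (complete_graph 2)))" using isoI[OF t(2)] by simp
      then have ?nine using k9 t(1) nV m4 by blast
      then show ?thesis by blast
    qed
  qed
qed

end
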